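(* Let $n\ge 1$. The permutations $\pi$ of $\{1,\dots,n\}$ for which the multiplicity $N(\pi)$ is maximum (among all permutations of $\{1,\dots,n\}$) are exactly the following: for $n=1$, the identity; for $n=2$, cycle left and the identity; for $n=3$, cycle left and the double cycle lefts; for $4\le n\le 17$, the double cycle lefts; for $n\ge 18$, the identity.
   Context: Permutations are composed from right to left; $(i\ j)$ denotes the transposition exchanging $i$ and $j$, and $(i\ i)$ denotes the identity. The multiplicity $N(\pi)$ of a permutation $\pi$ of $\{1,\dots,n\}$ is the number of sequences $(a_1,\dots,a_n)\in\{1,\dots,n\}^n$ with $\pi=(n\ a_n)\cdots(2\ a_2)(1\ a_1)$. Cycle notation: $(x_1\ x_2\ \cdots\ x_r)$ sends $x_1\mapsto x_2\mapsto\cdots\mapsto x_r\mapsto x_1$. "Cycle left" is the permutation $(n\ n-1\ \cdots\ 2\ 1)$. A "double cycle left" is a permutation $(n\ n-1\ \cdots\ m+1)(m\ \cdots\ 2\ 1)$ where $m$ is either $\lfloor n/2\rfloor$ or $\lceil n/2\rceil$ (so there is one such permutation if $n$ is even, and the two choices of $m$ are both allowed if $n$ is odd). *)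

theory Defs
  imports "HOL-Combinatorics.Combinatorics" "HOL-Library.FuncSet"
begin

text \<open>
  \<^term>\<open>exchange_prod a k\<close> is the product \<open>(k a\<^sub>k) \<cdots> (2 a\<^sub>2) (1 a\<^sub>1)\<close>, composed from
  right to left.  Note that \<^term>\<open>transpose i i = id\<close>.
\<close>
primrec exchange_prod :: "(nat \<Rightarrow> nat) \<Rightarrow> nat \<Rightarrow> nat \<Rightarrow> nat" where
  "exchange_prod a 0 = id"
| "exchange_prod a (Suc k) = transpose (Suc k) (a (Suc k)) \<circ> exchange_prod a k"

text \<open>Sequences in \<open>{1..n}\<^sup>n\<close> are extensional functions, so that each is counted once.\<close>
definition multiplicity_of :: "nat \<Rightarrow> (nat \<Rightarrow> nat) \<Rightarrow> nat" where
  "multiplicity_of n \<pi> = card {a \<in> {1..n} \<rightarrow>\<^sub>E {1..n}. \<pi> = exchange_prod a n}"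

text \<open>
  \<^term>\<open>cycle_of_list [x, y, z]\<close> sends \<open>x \<mapsto> y \<mapsto> z \<mapsto> x\<close>, and lists of length at most 1
  give the identity.
\<close>
definition cycle_left :: "nat \<Rightarrow> nat \<Rightarrow> nat" where
  "cycle_left n = cycle_of_list (rev [1..<n+1])"

text \<open>The two values of \<open>m\<close> are the floor and the ceiling of \<open>n/2\<close>.\<close>
definition double_cycle_lefts :: "nat \<Rightarrow> (nat \<Rightarrow> nat) set" where
  "double_cycle_lefts n =
     {cycle_of_list (rev [m+1..<n+1]) \<circ> cycle_of_list (rev [1..<m+1]) | m.
        m = n div 2 \<or> m = (n + 1) div 2}"

end

theory Submission
  imports Defs "HOL-Computational_Algebra.Formal_Power_Series"
begin

text \<open>
  A sequence \<open>a\<close> is a function on \<open>{1..n}\<close>, and the factors \<open>(k a\<^sub>k)\<close> are the edges of its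
  functional graph. A connected component with \<open>r\<close> vertices has \<open>r\<close> edges. If one of them is a
  loop, the others form a tree, and the product over the component is a single cycle. Otherwise
  the edges are those of a tree and one more, which splits that cycle into two. Hence \<open>N(\<pi>)\<close>
  is a sum over all ways to pair up some of the cycles of \<open>\<pi>\<close>, in which every unpaired cycle
  and every pair contributes the number of components that produce it. For the identity all
  contributions are 1, and \<open>N(id)\<close> is the number of involutions.

  The contributions are computed by removing the factors in the order \<open>(n a\<^sub>n), (n-1 a\<^bsub>n-1\<^esub>), ...\<close>.
  When \<open>(k a\<^sub>k)\<close> is removed, either the cycle of \<open>k\<close> is cut into two, or it is merged with
  another cycle. In both cases \<open>k\<close> has no factor any more and becomes the root of a tree, and no
  cycle can contain two roots. For a cycle with a root this gives the recursion of
  \<open>rooted_count\<close>, which is a partial sum of the Catalan recursion. So a rooted cycle with \<open>r\<close>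
  further elements contributes at most the Catalan number of \<open>r\<close>, with equality only if it is
  decreasing (\<open>rooted_count_le_catalan\<close>). For a pair of cycles one has to sum over the ways to
  merge them (\<open>merge_count_le\<close>). Here too the contribution is largest only if both cycles are
  decreasing and one of them lies above the other. Since all these maxima are attained together by
  decreasing cycles on consecutive intervals, the largest multiplicity for a given cycle type is
  the number \<open>matching_sum\<close> that depends only on the lengths (\<open>prefix_count_bound\<close>).

  It remains to find the cycle types with the largest \<open>matching_sum\<close> (\<open>matching_sum_le_peak\<close>).
  For two cycles the bound grows when the lengths are balanced (\<open>two_cycle_bound_step\<close>), and a
  single cycle of length \<open>n\<close> ties with the lengths \<open>n - 1\<close> and \<open>1\<close>. A type with three or more
  cycles that are not all fixed points never wins: removing its longest cycle and bounding what
  remains by induction stays below the maximum (\<open>three_cycle_step\<close>). So the competition is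
  between two cycles of almost equal length, whose bound is below \<open>4\<^sup>n\<close>, and the identity,
  whose number of involutions grows faster than any exponential. The lead changes between
  \<open>n = 17\<close> and \<open>n = 18\<close>. Finally \<open>single_cycle_extremal\<close>, \<open>two_cycles_extremal\<close> and
  \<open>cycle_partition_ones\<close> recover the permutation from the equality cases.
\<close>

section \<open>Words and Catalan numbers\<close>

fun catalan :: "nat \<Rightarrow> nat" where
  "catalan 0 = 1"
| "catalan (Suc n) = (\<Sum>i\<le>n. catalan i * catalan (n - i))"

declare catalan.simps(2) [simp del]

lemma catalan_pos: "catalan n > 0"
  by (induction n rule: catalan.induct) (auto simp: catalan.simps(2) intro!: sum_pos)

text \<open>
  The sum over all cuts of a word into a prefix and a suffix. Nested, it enumerates the cuts
  into several pieces, and the lemmas below are what one needs to compare such enumerations.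
\<close>
definition split_sum :: "('a list \<Rightarrow> 'a list \<Rightarrow> nat) \<Rightarrow> 'a list \<Rightarrow> nat" where
  "split_sum f w = (\<Sum>i\<le>length w. f (take i w) (drop i w))"

lemma split_sum_Nil [simp]: "split_sum f [] = f [] []"
  by (simp add: split_sum_def)

lemma split_sum_Cons: "split_sum f (x # w) = f [] (x # w) + split_sum (\<lambda>u v. f (x # u) v) w"
  by (simp add: split_sum_def sum.atMost_Suc_shift del: sum.atMost_Suc)

lemma split_sum_append:
  "split_sum f (p @ x # q) = split_sum (\<lambda>u v. f u (v @ x # q)) p + split_sum (\<lambda>u v. f (p @ x # u) v) q"
  by (induction p arbitrary: f) (simp_all add: split_sum_Cons)

text \<open>The cut at the seam is counted on both sides of the seam.\<close>
lemma split_sum_append_boundary: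
  "split_sum f (p @ q) + f p q = split_sum (\<lambda>u v. f u (v @ q)) p + split_sum (\<lambda>u v. f (p @ u) v) q"
proof (induction p arbitrary: f)
  case Nil
  show ?case by simp
next
  case (Cons x p)
  from Cons.IH[of "\<lambda>u v. f (x # u) v"] show ?case by (simp add: split_sum_Cons)
qed

text \<open>Both sides enumerate the cuts of \<open>w\<close> into three pieces.\<close>
lemma split_sum_assoc:
  "split_sum (\<lambda>u v. split_sum (\<lambda>s t. f u s t) v) w = split_sum (\<lambda>u t. split_sum (\<lambda>r s. f r s t) u) w"
proof (induction w arbitrary: f)
  case Nil
  show ?case by simp
next
  case (Cons x w)
  have add: "split_sum (\<lambda>u v. g u v + h u v) w = split_sum g w + split_sum h w" for g h :: "'a list \<Rightarrow> 'a list \<Rightarrow> nat"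
    by (simp add: split_sum_def sum.distrib)
  show ?case
    using Cons.IH[of "\<lambda>u. f (x # u)"] by (simp add: split_sum_Cons add)
qed

lemma split_sum_swap:
  "split_sum (\<lambda>a b. split_sum (\<lambda>c d. f a b c d) q) p = split_sum (\<lambda>c d. split_sum (\<lambda>a b. f a b c d) p) q"
  unfolding split_sum_def by (rule sum.swap)

lemma split_sum_cong:
  assumes "\<And>u v. u @ v = w \<Longrightarrow> f u v = g u v"
  shows "split_sum f w = split_sum g w"
  unfolding split_sum_def by (intro sum.cong refl assms) auto

lemma split_sum_mono:
  assumes "\<And>u v. u @ v = w \<Longrightarrow> f u v \<le> g u v"
  shows "split_sum f w \<le> split_sum g w"
  unfolding split_sum_def by (intro sum_mono assms) auto

lemma split_sum_strict_mono:
  assumes "\<And>u v. u @ v = w \<Longrightarrow> f u v \<le> g u v" "a @ b = w" "f a b < g a b"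
  shows "split_sum f w < split_sum g w"
  unfolding split_sum_def
proof (rule sum_strict_mono_ex1)
  show "\<exists>i\<in>{..length w}. f (take i w) (drop i w) < g (take i w) (drop i w)"
    using assms(2,3) by (intro bexI[of _ "length a"]) auto
qed (use assms(1) in auto)

lemma split_sum_distrib: "split_sum (\<lambda>u v. f u v + g u v) w = split_sum f w + split_sum g w"
  by (simp add: split_sum_def sum.distrib)

lemma split_sum_mult_left: "c * split_sum f w = split_sum (\<lambda>u v. c * f u v) w"
  by (simp add: split_sum_def sum_distrib_left)

lemma split_sum_mult_right: "split_sum f w * c = split_sum (\<lambda>u v. f u v * c) w"
  by (simp add: split_sum_def sum_distrib_right)

lemma split_sum_length: "split_sum (\<lambda>u v. f (length u) (length v)) w = (\<Sum>i\<le>length w. f i (length w - i))"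
  by (auto simp: split_sum_def intro!: sum.cong)

lemma length_around_Max:
  fixes w :: "'a::linorder list"
  assumes "w \<noteq> []"
  shows "length (takeWhile (\<lambda>x. x \<noteq> Max (set w)) w) + length (tl (dropWhile (\<lambda>x. x \<noteq> Max (set w)) w)) < length w"
proof -
  have "dropWhile (\<lambda>x. x \<noteq> Max (set w)) w \<noteq> []" using assms by (auto simp: dropWhile_eq_Nil_conv)
  moreover have "length (takeWhile (\<lambda>x. x \<noteq> Max (set w)) w) + length (dropWhile (\<lambda>x. x \<noteq> Max (set w)) w) = length w"
    by (metis length_append takeWhile_dropWhile_id)
  ultimately show ?thesis by (cases "dropWhile (\<lambda>x. x \<noteq> Max (set w)) w") auto
qed

text \<open>
  The number of ways to write the cycle \<open>x # w\<close> as a product of factors \<open>(k a\<^sub>k)\<close>,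
  one for each letter \<open>k\<close> of \<open>w\<close>, the largest applied last, when the root \<open>x\<close> has no
  factor itself. Removing the factor of the largest letter \<open>z\<close> from \<open>x # p @ z # q\<close> cuts
  the cycle at some place in \<open>q\<close>, into a cycle with root \<open>z\<close> and a cycle with root \<open>x\<close>.
\<close>
function rooted_count :: "'a::linorder list \<Rightarrow> nat" where
  "rooted_count w = (if w = [] then 1 else
     (let z = Max (set w); p = takeWhile (\<lambda>x. x \<noteq> z) w; q = tl (dropWhile (\<lambda>x. x \<noteq> z) w) in
      (\<Sum>i\<le>length q. rooted_count (take i q) * rooted_count (p @ drop i q))))"
  by auto
termination
proof (relation "measure length", goal_cases)
  case (2 w z p q i)
  then show ?case using length_around_Max[of w] by simp
next
  case (3 w z p q i)
  then show ?case using length_around_Max[of w] by simp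
qed simp

declare rooted_count.simps [simp del]

lemma rooted_count_Nil [simp]: "rooted_count [] = 1"
  by (simp add: rooted_count.simps)

lemma rooted_count_max:
  assumes "\<And>x. x \<in> set p \<union> set q \<Longrightarrow> x < z"
  shows "rooted_count (p @ z # q) = split_sum (\<lambda>u v. rooted_count u * rooted_count (p @ v)) q"
proof -
  have m: "Max (set (p @ z # q)) = z"
    using assms by (intro Max_eqI) (auto intro: less_imp_le)
  have t: "takeWhile (\<lambda>x. x \<noteq> z) (p @ z # q) = p" "dropWhile (\<lambda>x. x \<noteq> z) (p @ z # q) = z # q"
    using assms by (auto simp: takeWhile_append dropWhile_append)
  show ?thesis
    by (subst rooted_count.simps) (simp add: m t Let_def split_sum_def del: set_append)
qed

lemma distinct_obtain_Max:
  fixes w :: "'a::linorder list"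
  assumes "w \<noteq> []" "distinct w"
  obtains p z q where "w = p @ z # q" "\<And>x. x \<in> set p \<union> set q \<Longrightarrow> x < z"
proof -
  obtain p q where w: "w = p @ Max (set w) # q"
    using Max_in[of "set w"] assms(1) by (metis List.finite_set set_empty split_list)
  have "x < Max (set w)" if "x \<in> set p \<union> set q" for x
  proof -
    have "x \<noteq> Max (set w)"
      using assms(2) that by (subst (asm) w) auto
    moreover have "x \<in> set w" by (subst w) (use that in auto)
    ultimately show ?thesis using Max_ge[of "set w" x] by (simp add: order_less_le)
  qed
  with w that show ?thesis by blast
qed

text \<open>
  The mirror image of the recursion at the largest letter. Each of the two recursions can be
  expanded once more by the other one, and then both enumerate the pairs of segments that are
  cut out along with the largest letter \<open>z\<close> and the smallest letter \<open>y\<close>, in different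
  orders. The bound for pairs of cycles is proved by removing the smallest letter, whereas
  permutations provide the recursion at the largest.
\<close>
lemma rooted_count_min:
  fixes y :: "'a::linorder"
  assumes "distinct (p @ q)" "\<And>x. x \<in> set p \<union> set q \<Longrightarrow> y < x"
  shows "rooted_count (p @ y # q) = split_sum (\<lambda>u v. rooted_count v * rooted_count (u @ q)) p"
  using assms
proof (induction "length (p @ q)" arbitrary: p q rule: less_induct)
  case less
  let ?G = rooted_count
  note prems = less.prems
  show ?case
  proof (cases "p @ q = []")
    case True
    then show ?thesis by (simp add: rooted_count_max[of "[]" "[]" y, simplified])
  next
    case False
    obtain a z b where pq: "p @ q = a @ z # b" and z: "\<And>x. x \<in> set a \<union> set b \<Longrightarrow> x < z"
      using distinct_obtain_Max[OF False prems(1)] by metis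
    have set_pq: "set p \<union> set q = insert z (set a \<union> set b)" using arg_cong[OF pq, of set] by auto
    have yz: "y < z" using prems(2) set_pq by blast
    have d: "distinct (a @ z # b)" using prems(1) pq by simp
    consider (right) q' where "p @ q' = a" "q = q' @ z # b" | (left) p2 where "p = a @ z # p2" "p2 @ q = b"
      using pq by (auto simp: append_eq_append_conv2 append_eq_Cons_conv)
    then show ?thesis
    proof cases
      case right
      have "?G (p @ y # q) = split_sum (\<lambda>v t. ?G v * ?G (p @ y # q' @ t)) b"
        using rooted_count_max[of "p @ y # q'" b z] z yz right by force
      also have "\<dots> = split_sum (\<lambda>v t. ?G v * split_sum (\<lambda>c d. ?G d * ?G (c @ q' @ t)) p) b"
      proof (rule split_sum_cong)
        fix v t assume vt: "v @ t = b"
        have "?G (p @ y # q' @ t) = split_sum (\<lambda>c d. ?G d * ?G (c @ q' @ t)) p"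
        proof (rule less.hyps)
          show "length (p @ q' @ t) < length (p @ q)" using right vt by auto
          show "distinct (p @ q' @ t)" using prems(1) right vt by auto
          show "y < x" if "x \<in> set p \<union> set (q' @ t)" for x
            using that prems(2) right vt by auto
        qed
        then show "?G v * ?G (p @ y # q' @ t) = ?G v * split_sum (\<lambda>c d. ?G d * ?G (c @ q' @ t)) p" by simp
      qed
      also have "\<dots> = split_sum (\<lambda>c d. split_sum (\<lambda>v t. ?G d * (?G v * ?G (c @ q' @ t))) b) p"
        by (subst split_sum_swap) (simp add: split_sum_mult_left mult_ac)
      also have "\<dots> = split_sum (\<lambda>c d. ?G d * ?G (c @ q)) p"
      proof (rule split_sum_cong)
        fix c d assume cd: "c @ d = p"
        have "?G (c @ q) = split_sum (\<lambda>v t. ?G v * ?G (c @ q' @ t)) b"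
          using rooted_count_max[of "c @ q'" b z] z right cd by force
        then show "split_sum (\<lambda>v t. ?G d * (?G v * ?G (c @ q' @ t))) b = ?G d * ?G (c @ q)"
          by (simp add: split_sum_mult_left)
      qed
      finally show ?thesis .
    next
      case left
      have IH: "?G (r @ y # s) = split_sum (\<lambda>u v. ?G v * ?G (u @ s)) r"
        if "length (r @ s) < length (p @ q)" "distinct (r @ s)" "set r \<union> set s \<subseteq> set p \<union> set q" for r s
        using less.hyps[OF that(1,2)] that(3) prems(2) by blast
      have za: "\<And>x. x \<in> set a \<Longrightarrow> x < z" "\<And>x. x \<in> set p2 \<Longrightarrow> x < z" "\<And>x. x \<in> set q \<Longrightarrow> x < z"
        using z left by auto
      let ?B = "split_sum (\<lambda>v s. ?G v * ?G s * ?G (a @ q)) p2"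
      let ?X = "split_sum (\<lambda>v s. split_sum (\<lambda>c d. ?G v * ?G (d @ s) * ?G (c @ q)) a) p2"
      let ?Y = "split_sum (\<lambda>v s. split_sum (\<lambda>c d. ?G v * ?G d * ?G (a @ c @ q)) s) p2"
      let ?Z = "split_sum (\<lambda>c d. split_sum (\<lambda>v s. ?G s * ?G (v @ c) * ?G (a @ d)) p2) q"
      have "?G (p @ y # q) = split_sum (\<lambda>v t. ?G v * ?G (a @ t)) (p2 @ y # q)"
        using rooted_count_max[of a "p2 @ y # q" z] za yz left by auto
      also have "\<dots> = split_sum (\<lambda>v s. ?G v * ?G ((a @ s) @ y # q)) p2
                     + split_sum (\<lambda>c d. ?G (p2 @ y # c) * ?G (a @ d)) q"
        by (simp add: split_sum_append)
      also have "split_sum (\<lambda>c d. ?G (p2 @ y # c) * ?G (a @ d)) q = ?Z"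
      proof (rule split_sum_cong)
        fix c d assume cd: "c @ d = q"
        have "?G (p2 @ y # c) = split_sum (\<lambda>u v. ?G v * ?G (u @ c)) p2"
          by (rule IH) (use cd left prems(1) in auto)
        then show "?G (p2 @ y # c) * ?G (a @ d) = split_sum (\<lambda>v s. ?G s * ?G (v @ c) * ?G (a @ d)) p2"
          by (simp add: split_sum_mult_right)
      qed
      finally have L: "?G (p @ y # q) = split_sum (\<lambda>v s. ?G v * ?G ((a @ s) @ y # q)) p2 + ?Z" .
      have "split_sum (\<lambda>v s. ?G v * ?G ((a @ s) @ y # q)) p2 + ?B
          = split_sum (\<lambda>v s. ?G v * (?G ((a @ s) @ y # q) + ?G s * ?G (a @ q))) p2"
        by (simp add: split_sum_distrib[symmetric] algebra_simps)
      also have "\<dots> = split_sum (\<lambda>v s. ?G v * (split_sum (\<lambda>c d. ?G (d @ s) * ?G (c @ q)) a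
                        + split_sum (\<lambda>c d. ?G d * ?G (a @ c @ q)) s)) p2"
      proof (rule split_sum_cong)
        fix v s assume vs: "v @ s = p2"
        have "?G ((a @ s) @ y # q) = split_sum (\<lambda>u v. ?G v * ?G (u @ q)) (a @ s)"
          by (rule IH) (use vs left prems(1) in auto)
        then have "?G ((a @ s) @ y # q) + ?G s * ?G (a @ q)
            = split_sum (\<lambda>c d. ?G (d @ s) * ?G (c @ q)) a + split_sum (\<lambda>c d. ?G d * ?G (a @ c @ q)) s"
          using split_sum_append_boundary[of "\<lambda>u v. ?G v * ?G (u @ q)" a s] by simp
        then show "?G v * (?G ((a @ s) @ y # q) + ?G s * ?G (a @ q)) = ?G v * (split_sum (\<lambda>c d. ?G (d @ s) * ?G (c @ q)) a
                        + split_sum (\<lambda>c d. ?G d * ?G (a @ c @ q)) s)" by simp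
      qed
      also have "\<dots> = ?X + ?Y"
        by (simp add: split_sum_distrib[symmetric] split_sum_mult_left algebra_simps)
      finally have 1: "?G (p @ y # q) + ?B = ?X + ?Y + ?Z" using L by simp
      have "split_sum (\<lambda>u v. ?G v * ?G (u @ q)) p
          = split_sum (\<lambda>u v. ?G (v @ z # p2) * ?G (u @ q)) a + split_sum (\<lambda>u v. ?G v * ?G (a @ z # u @ q)) p2"
        using left by (simp add: split_sum_append)
      also have "split_sum (\<lambda>u v. ?G (v @ z # p2) * ?G (u @ q)) a
          = split_sum (\<lambda>u v. split_sum (\<lambda>r s. ?G r * ?G (v @ s) * ?G (u @ q)) p2) a"
      proof (rule split_sum_cong)
        fix u v assume uv: "u @ v = a"
        have "?G (v @ z # p2) = split_sum (\<lambda>r s. ?G r * ?G (v @ s)) p2"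
          by (rule rooted_count_max) (use za uv in auto)
        then show "?G (v @ z # p2) * ?G (u @ q) = split_sum (\<lambda>r s. ?G r * ?G (v @ s) * ?G (u @ q)) p2"
          by (simp add: split_sum_mult_right)
      qed
      also have "\<dots> = ?X"
        by (rule split_sum_swap)
      finally have R: "split_sum (\<lambda>u v. ?G v * ?G (u @ q)) p = ?X + split_sum (\<lambda>u v. ?G v * ?G (a @ z # u @ q)) p2" .
      have "split_sum (\<lambda>u v. ?G v * ?G (a @ z # u @ q)) p2 + ?B
          = split_sum (\<lambda>u v. ?G v * (?G (a @ z # u @ q) + ?G u * ?G (a @ q))) p2"
        by (simp add: split_sum_distrib[symmetric] algebra_simps)
      also have "\<dots> = split_sum (\<lambda>u v. ?G v * (split_sum (\<lambda>r s. ?G r * ?G (a @ s @ q)) u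
                         + split_sum (\<lambda>c d. ?G (u @ c) * ?G (a @ d)) q)) p2"
      proof (rule split_sum_cong)
        fix u v assume uv: "u @ v = p2"
        have "?G (a @ z # u @ q) = split_sum (\<lambda>r s. ?G r * ?G (a @ s)) (u @ q)"
          by (rule rooted_count_max) (use za uv in auto)
        then show "?G v * (?G (a @ z # u @ q) + ?G u * ?G (a @ q)) =
           ?G v * (split_sum (\<lambda>r s. ?G r * ?G (a @ s @ q)) u + split_sum (\<lambda>c d. ?G (u @ c) * ?G (a @ d)) q)"
          using split_sum_append_boundary[of "\<lambda>r s. ?G r * ?G (a @ s)" u q] by simp
      qed
      also have "\<dots> = split_sum (\<lambda>u v. split_sum (\<lambda>r s. ?G r * ?G v * ?G (a @ s @ q)) u) p2
                     + split_sum (\<lambda>u v. split_sum (\<lambda>c d. ?G v * ?G (u @ c) * ?G (a @ d)) q) p2"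
        by (simp add: split_sum_distrib[symmetric] split_sum_mult_left algebra_simps)
      also have "split_sum (\<lambda>u v. split_sum (\<lambda>r s. ?G r * ?G v * ?G (a @ s @ q)) u) p2 = ?Y"
        by (rule split_sum_assoc[symmetric])
      also have "split_sum (\<lambda>u v. split_sum (\<lambda>c d. ?G v * ?G (u @ c) * ?G (a @ d)) q) p2 = ?Z"
        by (rule split_sum_swap)
      finally have 2: "split_sum (\<lambda>u v. ?G v * ?G (u @ q)) p + ?B = ?X + ?Y + ?Z" using R by simp
      from 1 2 show ?thesis by linarith
    qed
  qed
qed

abbreviation decreasing :: "'a::linorder list \<Rightarrow> bool" where
  "decreasing \<equiv> sorted_wrt (>)"

lemma rooted_count_decreasing: "decreasing w \<Longrightarrow> rooted_count w = catalan (length w)"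
proof (induction "length w" arbitrary: w rule: less_induct)
  case less
  show ?case
  proof (cases w)
    case (Cons z q)
    have "rooted_count (z # q) = split_sum (\<lambda>u v. rooted_count u * rooted_count v) q"
      using rooted_count_max[of "[]" q z] less.prems Cons by auto
    also have "\<dots> = split_sum (\<lambda>u v. catalan (length u) * catalan (length v)) q"
    proof (rule split_sum_cong)
      fix u v assume uv: "u @ v = q"
      then have "decreasing u" "decreasing v"
        using less.prems Cons by (auto simp: sorted_wrt_append)
      then show "rooted_count u * rooted_count v = catalan (length u) * catalan (length v)"
        using less.hyps[of u] less.hyps[of v] uv Cons by auto
    qed
    also have "\<dots> = catalan (length w)"
      by (simp add: split_sum_length[of "\<lambda>a b. catalan a * catalan b"] catalan.simps(2) Cons)
    finally show ?thesis using Cons by simp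
  qed simp
qed

lemma catalan_partial_sum_le:
  "(\<Sum>i\<le>k. catalan i * catalan (m + k - i)) \<le> catalan (Suc (m + k))" for m k
  unfolding catalan.simps by (intro sum_mono2) auto

lemma catalan_partial_sum_less:
  assumes "m > 0"
  shows "(\<Sum>i\<le>k. catalan i * catalan (m + k - i)) < catalan (Suc (m + k))"
  unfolding catalan.simps by (intro sum_strict_mono2[of _ _ "m+k"]) (use assms catalan_pos in auto)

text \<open>
  By induction, the recursion at the largest letter is bounded by the first terms of the
  recursion of the Catalan numbers. It contains all of them only if no letter precedes the
  largest one.
\<close>
lemma rooted_count_le_catalan:
  assumes "distinct w"
  shows "rooted_count w \<le> catalan (length w)"
    and "rooted_count w = catalan (length w) \<longleftrightarrow> decreasing w"
proof -
  have "rooted_count w \<le> catalan (length w) \<and> (rooted_count w = catalan (length w) \<longrightarrow> decreasing w)"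
    using assms
  proof (induction "length w" arbitrary: w rule: less_induct)
    case less
    show ?case
    proof (cases "w = []")
      case False
      obtain p z q where w: "w = p @ z # q" and z: "\<And>x. x \<in> set p \<union> set q \<Longrightarrow> x < z"
        using distinct_obtain_Max[OF False less.prems] by metis
      have IH: "rooted_count u \<le> catalan (length u)" "rooted_count (p @ v) \<le> catalan (length (p @ v))"
        if "u @ v = q" for u v
        using less.hyps[of u] less.hyps[of "p @ v"] less.prems w that[symmetric] by auto
      have rc: "rooted_count w = split_sum (\<lambda>u v. rooted_count u * rooted_count (p @ v)) q"
        unfolding w by (rule rooted_count_max) (use z in auto)
      have le: "rooted_count u * rooted_count (p @ v) \<le> catalan (length u) * catalan (length p + length v)"
        if "u @ v = q" for u v
        using IH[OF that] by (intro mult_mono) auto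
      have sm: "split_sum (\<lambda>u v. catalan (length u) * catalan (length p + length v)) q
          = (\<Sum>i\<le>length q. catalan i * catalan (length p + length q - i))"
        unfolding split_sum_length[of "\<lambda>a b. catalan a * catalan (length p + b)"] by (intro sum.cong) auto
      have 1: "rooted_count w \<le> (\<Sum>i\<le>length q. catalan i * catalan (length p + length q - i))"
        unfolding rc sm[symmetric] by (rule split_sum_mono) (use le in auto)
      have "decreasing w" if eq: "rooted_count w = catalan (length w)"
      proof -
        have p: "p = []"
          using 1 catalan_partial_sum_less[of "length p" "length q"] eq w by fastforce
        have "rooted_count q = catalan (length q)"
        proof (rule ccontr)
          assume "rooted_count q \<noteq> catalan (length q)"
          then have "rooted_count q < catalan (length q)" using IH(1)[of q "[]"] by simp
          then have "rooted_count w < (\<Sum>i\<le>length q. catalan i * catalan (length p + length q - i))"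
            unfolding rc sm[symmetric]
            by (intro split_sum_strict_mono[of _ _ _ q "[]"]) (use le p in auto)
          then show False using eq w p by (simp add: catalan.simps(2))
        qed
        then have "decreasing q" using less.hyps[of q] less.prems w by auto
        then show ?thesis using w p z by auto
      qed
      moreover have "rooted_count w \<le> catalan (length w)"
        using 1 catalan_partial_sum_le[of "length p" "length q"] w by (simp add: add_ac)
      ultimately show ?thesis by blast
    qed simp
  qed
  then show "rooted_count w \<le> catalan (length w)" "rooted_count w = catalan (length w) \<longleftrightarrow> decreasing w"
    using rooted_count_decreasing by auto
qed

section \<open>The bounds for merging and for pairs of cycles\<close>

text \<open>Multiplication by the generating function \<open>C\<close> of the Catalan numbers.\<close>
definition catalan_sum :: "(nat \<Rightarrow> nat) \<Rightarrow> nat \<Rightarrow> nat" where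
  "catalan_sum f n = (\<Sum>i\<le>n. catalan i * f (n - i))"

lemma catalan_sum_0 [simp]: "catalan_sum f 0 = f 0"
  by (simp add: catalan_sum_def)

lemma catalan_sum_catalan: "catalan_sum catalan n = catalan (Suc n)"
  by (simp add: catalan_sum_def catalan.simps(2))

lemma catalan_sum_altdef: "catalan_sum f n = (\<Sum>i\<le>n. catalan (n - i) * f i)"
  unfolding catalan_sum_def by (rule sum.reindex_bij_witness[of _ "\<lambda>i. n - i" "\<lambda>i. n - i"]) auto

lemma catalan_sum_add: "catalan_sum (\<lambda>i. f i + g i) n = catalan_sum f n + catalan_sum g n"
  by (simp add: catalan_sum_def distrib_left sum.distrib)

lemma catalan_sum_sum: "catalan_sum (\<lambda>i. \<Sum>j\<in>J. f i j) n = (\<Sum>j\<in>J. catalan_sum (\<lambda>i. f i j) n)"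
  unfolding catalan_sum_def sum_distrib_left by (rule sum.swap)

lemma catalan_sum_mult: "catalan_sum (\<lambda>i. f i * c) n = catalan_sum f n * c"
  by (simp add: catalan_sum_def sum_distrib_right mult.assoc)

lemma catalan_sum_swap:
  "catalan_sum (\<lambda>i. catalan_sum (f i) m) n = catalan_sum (\<lambda>j. catalan_sum (\<lambda>i. f i j) n) m"
  unfolding catalan_sum_def sum_distrib_left by (subst sum.swap) (simp add: mult_ac)

definition catalan_fps :: "int fps" where
  "catalan_fps = Abs_fps (\<lambda>n. int (catalan n))"

lemma catalan_fps_eq: "catalan_fps = 1 + fps_X * catalan_fps ^ 2"
proof (rule fps_ext)
  fix n show "fps_nth catalan_fps n = fps_nth (1 + fps_X * catalan_fps ^ 2) n"
    by (cases n) (simp_all add: catalan_fps_def fps_square_nth catalan.simps(2) atLeast0AtMost del: fps_X_power_mult_nth)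
qed

lemma catalan_sum_fps: "Abs_fps (\<lambda>n. int (catalan_sum f n)) = catalan_fps * Abs_fps (\<lambda>n. int (f n))"
  by (rule fps_ext) (simp add: catalan_fps_def fps_mult_nth catalan_sum_def atLeast0AtMost)

text \<open>
  The equation \<open>C = 1 + x C\<^sup>2\<close> yields \<open>(1 - 2xC)\<^sup>2 = 1 - 4x\<close>, and its
  derivative yields \<open>(1 - 2xC) C' = C\<^sup>2\<close>. Together they give the linear differential
  equation \<open>x (1 - 4x) C' = 2xC - (C - 1)\<close>, whose coefficients are compared.
\<close>
lemma catalan_recurrence: "(n + 2) * catalan (Suc n) = (4 * n + 2) * catalan n"
proof -
  let ?C = catalan_fps and ?x = "fps_X :: int fps"
  have eq: "?C - 1 = ?x * ?C\<^sup>2" using catalan_fps_eq by (metis add_diff_cancel_left')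
  have dC: "fps_deriv ?C = ?C\<^sup>2 + 2 * ?x * ?C * fps_deriv ?C"
    by (subst catalan_fps_eq) (simp add: power2_eq_square algebra_simps)
  have "?x * ((1 - 4 * ?x) * fps_deriv ?C) = 2 * ?x * ?C - (?C - 1)"
  proof -
    have "(1 - 2 * ?x * ?C)\<^sup>2 = 1 - 4 * ?x"
      using eq by algebra
    moreover have "(1 - 2 * ?x * ?C) * fps_deriv ?C = ?C\<^sup>2" using dC by (simp add: algebra_simps)
    ultimately have "(1 - 4 * ?x) * fps_deriv ?C = (1 - 2 * ?x * ?C) * ?C\<^sup>2"
      by (metis mult.assoc power2_eq_square)
    then show ?thesis using eq by algebra
  qed
  then have "fps_nth (?x * ((1 - 4 * ?x) * fps_deriv ?C)) (Suc n) = fps_nth (2 * ?x * ?C - (?C - 1)) (Suc n)" by simp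
  then have e: "fps_nth ((1 - 4 * ?x) * fps_deriv ?C) n = 2 * int (catalan n) - int (catalan (Suc n))"
    by (simp add: catalan_fps_def mult.assoc numeral_fps_const)
  have "fps_nth ((1 - 4 * ?x) * fps_deriv ?C) n = int (n + 1) * int (catalan (Suc n)) - 4 * int n * int (catalan n)"
    by (cases n) (simp_all add: catalan_fps_def left_diff_distrib mult.assoc numeral_fps_const algebra_simps)
  with e have "int ((n + 2) * catalan (Suc n)) = int ((4 * n + 2) * catalan n)"
    by (simp add: algebra_simps)
  then show ?thesis by linarith
qed

lemma catalan_Suc_le: "catalan (Suc n) \<le> 4 * catalan n"
proof -
  have "(n + 2) * catalan (Suc n) \<le> (n + 2) * (4 * catalan n)"
    unfolding catalan_recurrence by simp
  then show ?thesis using mult_le_cancel1[of "n + 2" "catalan (Suc n)" "4 * catalan n"] by linarith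
qed

text \<open>
  The coefficients of \<open>K\<^sup>2\<close>, where \<open>K\<close> is the generating function of \<open>catalan (i +
  j)\<close> in two variables.
\<close>
definition catalan_conv :: "nat \<Rightarrow> nat \<Rightarrow> nat" where
  "catalan_conv i j = (\<Sum>a\<le>i. \<Sum>b\<le>j. catalan (a + b) * catalan ((i - a) + (j - b)))"

text \<open>
  The maximum of \<open>merge_count b e\<close>, defined below, for words \<open>e\<close> of length \<open>l\<close> and \<open>b\<close>
  of length \<open>m\<close>. Its generating function is \<open>y C(y) K\<^sup>2\<close> if \<open>y\<close> marks \<open>l\<close> and
  \<open>x\<close> marks \<open>m\<close>.
\<close>
fun merge_bound :: "nat \<Rightarrow> nat \<Rightarrow> nat" where
  "merge_bound 0 m = 0"
| "merge_bound (Suc l) m = catalan_sum (\<lambda>i. catalan_conv i m) l"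

text \<open>
  The largest contribution of a pair of cycles of lengths \<open>k\<close> and \<open>l\<close>. Its generating
  function \<open>x y C(x) C(y) K\<^sup>2\<close> is symmetric.
\<close>
fun pair_bound :: "nat \<Rightarrow> nat \<Rightarrow> nat" where
  "pair_bound 0 l = 0"
| "pair_bound (Suc k) l = catalan_sum (merge_bound l) k"

text \<open>
  As generating functions, \<open>F = x C G\<close>, and \<open>C = 1 + x C\<^sup>2\<close> gives \<open>C G = C F + G\<close>.
\<close>
lemma catalan_sum_inverse:
  assumes "F 0 = 0" "\<And>n. F (Suc n) = catalan_sum G n"
  shows "F (Suc n) = catalan_sum F n + G n"
proof -
  let ?F = "Abs_fps (\<lambda>n. int (F n))" and ?G = "Abs_fps (\<lambda>n. int (G n))"
  have F: "?F = fps_X * (catalan_fps * ?G)"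
  proof (rule fps_ext)
    fix n show "fps_nth ?F n = fps_nth (fps_X * (catalan_fps * ?G)) n"
      using assms by (cases n) (simp_all flip: catalan_sum_fps)
  qed
  have "catalan_fps * ?G = catalan_fps * ?F + ?G"
    unfolding F by (subst (1) catalan_fps_eq) (simp add: power2_eq_square algebra_simps)
  then have "fps_nth (catalan_fps * ?G) n = fps_nth (catalan_fps * ?F) n + G n" by simp
  then show ?thesis using assms by (simp flip: catalan_sum_fps)
qed

lemma merge_bound_rec: "merge_bound (Suc l) m = catalan_sum (\<lambda>i. merge_bound i m) l + catalan_conv l m"
  by (rule catalan_sum_inverse[of "\<lambda>i. merge_bound i m" "\<lambda>i. catalan_conv i m"]) auto

lemma pair_bound_rec: "pair_bound (Suc k) l = catalan_sum (\<lambda>i. pair_bound i l) k + merge_bound l k"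
  by (rule catalan_sum_inverse[of "\<lambda>i. pair_bound i l" "merge_bound l"]) auto

lemma catalan_conv_commute: "catalan_conv i j = catalan_conv j i"
  unfolding catalan_conv_def by (subst sum.swap) (simp add: add_ac)

lemma pair_bound_Suc_Suc:
  "pair_bound (Suc k) (Suc l) = catalan_sum (\<lambda>i. catalan_sum (\<lambda>j. catalan_conv j i) l) k"
proof -
  have "merge_bound (Suc l) = (\<lambda>i. catalan_sum (\<lambda>j. catalan_conv j i) l)" by (rule ext) simp
  then show ?thesis by simp
qed

lemma pair_bound_commute: "pair_bound k l = pair_bound l k"
proof (cases k; cases l)
  fix k' l' assume "k = Suc k'" "l = Suc l'"
  then show ?thesis
    by (simp only: pair_bound_Suc_Suc) (subst catalan_sum_swap, simp add: catalan_conv_commute)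
qed (auto simp: catalan_sum_def)

text \<open>
  The terms of \<open>catalan_conv l m\<close> with \<open>b = m\<close> are separated from the others, because they
  come from a different kind of cut in \<open>merge_count_min_right\<close>.
\<close>
lemma merge_bound_Suc_unfold:
  "merge_bound (Suc l) m = catalan_sum (\<lambda>i. merge_bound i m + catalan (i + m)) l
     + (\<Sum>j\<le>l. \<Sum>p<m. catalan (j + p) * catalan (l - j + (m - p)))"
proof -
  have "catalan_conv l m = catalan_sum (\<lambda>i. catalan (i + m)) l
     + (\<Sum>j\<le>l. \<Sum>p<m. catalan (j + p) * catalan (l - j + (m - p)))"
    unfolding catalan_conv_def catalan_sum_altdef lessThan_Suc_atMost[of m, symmetric] sum.lessThan_Suc
    by (simp add: sum.distrib mult.commute)
  then show ?thesis unfolding merge_bound_rec catalan_sum_add by simp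
qed

text \<open>
  Convolving \<open>catalan (a + b)\<close> yields only a part of the Catalan recursion for \<open>catalan (a
  + b + 1)\<close>, and the term with \<open>b = 0\<close> on the right-hand side is left over.
\<close>
lemma catalan_sum_conv_less: "catalan_sum (catalan_conv l) m < catalan_conv l (Suc m)"
proof -
  let ?h = "\<lambda>a m. \<Sum>b\<le>m. catalan (a + b) * catalan (l - a + (m - b))"
  have *: "catalan_sum (?h a) m < ?h a (Suc m)" if "a \<le> l" for a
  proof -
    have "catalan_sum (?h a) m = (\<Sum>b\<le>m. (\<Sum>i\<le>b. catalan i * catalan (a + b - i)) * catalan (l - a + (m - b)))"
    proof -
      have "catalan_sum (?h a) m = (\<Sum>(i,b)\<in>Sigma {..m} (\<lambda>i. {..m - i}). catalan i * (catalan (a + b) * catalan (l - a + (m - i - b))))"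
        unfolding catalan_sum_def sum_distrib_left by (rule sum.Sigma) auto
      also have "\<dots> = (\<Sum>(b,i)\<in>Sigma {..m} (\<lambda>b. {..b}). catalan i * catalan (a + b - i) * catalan (l - a + (m - b)))"
        by (rule sum.reindex_bij_witness[of _ "\<lambda>(b,i). (i, b - i)" "\<lambda>(i,b). (i + b, i)"]) auto
      also have "\<dots> = (\<Sum>b\<le>m. (\<Sum>i\<le>b. catalan i * catalan (a + b - i)) * catalan (l - a + (m - b)))"
        unfolding sum_distrib_right by (rule sum.Sigma[symmetric]) auto
      finally show ?thesis .
    qed
    also have "\<dots> \<le> (\<Sum>b\<le>m. catalan (Suc (a + b)) * catalan (l - a + (m - b)))"
      by (intro sum_mono mult_right_mono catalan_partial_sum_le) auto
    also have "\<dots> < ?h a (Suc m)"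
      by (simp add: sum.atMost_Suc_shift catalan_pos del: sum.atMost_Suc)
    finally show ?thesis .
  qed
  show ?thesis
    unfolding catalan_conv_def catalan_sum_sum by (rule sum_strict_mono) (use * in auto)
qed

lemma catalan_sum_merge_bound_less:
  assumes "l > 0"
  shows "catalan_sum (merge_bound l) m < merge_bound l (Suc m)"
proof -
  obtain l' where l: "l = Suc l'" using assms by (cases l) auto
  have mb: "merge_bound l = (\<lambda>i. catalan_sum (\<lambda>j. catalan_conv j i) l')" unfolding l by (rule ext) simp
  have "catalan_sum (merge_bound l) m = catalan_sum (\<lambda>i. catalan_sum (catalan_conv i) m) l'"
    unfolding mb by (rule catalan_sum_swap)
  also have "\<dots> < catalan_sum (\<lambda>i. catalan_conv i (Suc m)) l'"
    unfolding catalan_sum_def[of _ l']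
    by (intro sum_strict_mono) (auto simp: catalan_sum_conv_less catalan_pos)
  finally show ?thesis by (simp add: l)
qed

section \<open>Merging two cycles\<close>

text \<open>
  When the factor of the largest letter \<open>z\<close> joins the cycle \<open>z # b\<close> to the cycle \<open>e\<close>,
  the result is the cycle \<open>z # b @ rotate i e\<close> with root \<open>z\<close>, where \<open>i\<close> is the place at
  which \<open>e\<close> is entered.
\<close>
definition merge_count :: "'a::linorder list \<Rightarrow> 'a list \<Rightarrow> nat" where
  "merge_count b e = (\<Sum>i<length e. rooted_count (b @ rotate i e))"

lemma merge_count_rotate1: "merge_count b (rotate1 e) = merge_count b e"
proof -
  let ?f = "\<lambda>i. rooted_count (b @ rotate i e)"
  have "(\<Sum>i<length e. ?f (Suc i)) + ?f 0 = (\<Sum>i<length e. ?f i) + ?f (length e)"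
    using sum.lessThan_Suc_shift[of ?f "length e"] sum.lessThan_Suc[of ?f "length e"] by linarith
  moreover have "rotate (length e) e = e" by simp
  ultimately show ?thesis by (simp add: merge_count_def rotate1_rotate_swap)
qed

lemma merge_count_rotate: "merge_count b (rotate k e) = merge_count b e"
  by (induction k) (simp_all add: merge_count_rotate1)

lemma split_sum_rotations: "split_sum (\<lambda>v u. rooted_count (b @ u @ v)) e = merge_count b e + rooted_count (b @ e)"
proof -
  have "rotate i e = drop i e @ take i e" if "i < length e" for i
    using that by (simp add: rotate_drop_take)
  then show ?thesis
    unfolding split_sum_def merge_count_def lessThan_Suc_atMost[symmetric] by simp
qed

lemma merge_count_Cons: "merge_count b (y # f) = split_sum (\<lambda>v u. rooted_count (b @ u @ y # v)) f"
proof -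
  have "rotate i (f @ [y]) = drop i f @ y # take i f" if "i \<le> length f" for i
    using that by (simp add: rotate_drop_take)
  moreover have "merge_count b (y # f) = merge_count b (f @ [y])"
    using merge_count_rotate1[of b "y # f"] by simp
  ultimately show ?thesis
    unfolding split_sum_def merge_count_def by (simp flip: lessThan_Suc_atMost)
qed

lemma split_sum_append_left:
  "split_sum f (p @ q) = (\<Sum>i<length p. f (take i p) (drop i p @ q)) + split_sum (\<lambda>u v. f (p @ u) v) q"
proof -
  have "split_sum f (p @ q) + f p q = (\<Sum>i<length p. f (take i p) (drop i p @ q)) + f p q + split_sum (\<lambda>u v. f (p @ u) v) q"
    unfolding split_sum_append_boundary by (simp add: split_sum_def flip: lessThan_Suc_atMost)
  then show ?thesis by simp
qed

text \<open>
  By \<open>rooted_count_min\<close> the smallest letter \<open>y\<close> is removed along with a segment that ends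
  just before it. In the first sum this segment lies within the rotated cycle \<open>y # f\<close>; what
  remains of the cycle then occurs in all rotations, and twice in the initial one. In the
  second sum the segment extends into \<open>b\<close>.
\<close>
lemma merge_count_min_right:
  fixes y :: "'a::linorder"
  assumes "distinct (b @ f)" "\<And>x. x \<in> set b \<union> set f \<Longrightarrow> y < x"
  shows "merge_count b (y # f) = split_sum (\<lambda>h s. rooted_count s * (merge_count b h + rooted_count (b @ h))) f
    + split_sum (\<lambda>v u. \<Sum>i<length b. rooted_count (drop i b @ u) * rooted_count (take i b @ v)) f"
proof -
  let ?G = rooted_count
  have "merge_count b (y # f) = split_sum (\<lambda>v u. ?G ((b @ u) @ y # v)) f"
    by (simp add: merge_count_Cons)
  also have "\<dots> = split_sum (\<lambda>v u. split_sum (\<lambda>c d. ?G d * ?G (c @ v)) (b @ u)) f"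
  proof (rule split_sum_cong)
    fix v u assume "v @ u = f"
    then show "?G ((b @ u) @ y # v) = split_sum (\<lambda>c d. ?G d * ?G (c @ v)) (b @ u)"
      using assms by (intro rooted_count_min) auto
  qed
  also have "\<dots> = split_sum (\<lambda>v u. \<Sum>i<length b. ?G (drop i b @ u) * ?G (take i b @ v)) f
      + split_sum (\<lambda>v u. split_sum (\<lambda>t s. ?G s * ?G (b @ t @ v)) u) f"
    by (simp add: split_sum_append_left split_sum_distrib)
  also have "split_sum (\<lambda>v u. split_sum (\<lambda>t s. ?G s * ?G (b @ t @ v)) u) f
      = split_sum (\<lambda>h s. split_sum (\<lambda>v t. ?G s * ?G (b @ t @ v)) h) f"
    by (rule split_sum_assoc)
  also have "\<dots> = split_sum (\<lambda>h s. ?G s * (merge_count b h + ?G (b @ h))) f"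
    by (simp add: split_sum_mult_left[symmetric] split_sum_rotations)
  finally show ?thesis by simp
qed

text \<open>
  The recursion of \<open>merge_count_min_right\<close> with each count replaced by its bound.
\<close>
lemma merge_bound_split:
  "merge_bound (Suc (length f)) (length b) =
     split_sum (\<lambda>h s. catalan (length s) * (merge_bound (length h) (length b) + catalan (length (b @ h)))) f
     + split_sum (\<lambda>v u. \<Sum>i<length b. catalan (length (drop i b @ u)) * catalan (length (take i b @ v))) f"
proof -
  have "split_sum (\<lambda>h s. catalan (length s) * (merge_bound (length h) (length b) + catalan (length (b @ h)))) f
     = catalan_sum (\<lambda>i. merge_bound i (length b) + catalan (i + length b)) (length f)"
    unfolding split_sum_def catalan_sum_altdef by (intro sum.cong) (auto simp: add_ac)
  moreover have "split_sum (\<lambda>v u. \<Sum>i<length b. catalan (length (drop i b @ u)) * catalan (length (take i b @ v))) f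
     = (\<Sum>j\<le>length f. \<Sum>p<length b. catalan (j + p) * catalan (length f - j + (length b - p)))"
    unfolding split_sum_def by (intro sum.cong) (auto simp: add_ac mult_ac)
  ultimately show ?thesis by (simp only: merge_bound_Suc_unfold)
qed

lemma merge_count_decreasing:
  "decreasing (b @ e) \<Longrightarrow> merge_count b e = merge_bound (length e) (length b)"
proof (induction "length e" arbitrary: e rule: less_induct)
  case less
  show ?case
  proof (cases e rule: rev_cases)
    case (snoc f y)
    have dec: "decreasing (b @ f)"
      using less.prems snoc by (auto simp: sorted_wrt_append)
    have less_y: "y < x" if "x \<in> set b \<union> set f" for x
      using that less.prems snoc by (auto simp: sorted_wrt_append)
    have d: "distinct (b @ f)"
      using dec
      by (metis distinct_rev sorted_wrt_rev strict_sorted_iff)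
    have part: "decreasing (b @ h)" "decreasing s" "decreasing (take i b @ h)" "decreasing (drop i b @ s)" if "h @ s = f" for h s i
      using dec that set_take_subset[of i b] set_drop_subset[of i b]
      by (auto simp: sorted_wrt_append sorted_wrt_take sorted_wrt_drop dest: subsetD)
    have "merge_count b e = merge_count b (y # f)"
      using merge_count_rotate1[of b "y # f"] snoc by simp
    also note merge_count_min_right[OF d less_y]
    also have "split_sum (\<lambda>h s. rooted_count s * (merge_count b h + rooted_count (b @ h))) f
        + split_sum (\<lambda>v u. \<Sum>i<length b. rooted_count (drop i b @ u) * rooted_count (take i b @ v)) f
        = merge_bound (Suc (length f)) (length b)"
      unfolding merge_bound_split
    proof (intro arg_cong2[of _ _ _ _ "(+)"] split_sum_cong sum.cong refl)
      fix h s assume hs: "h @ s = f"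
      have "merge_count b h = merge_bound (length h) (length b)"
        using hs snoc part[OF hs] by (intro less.hyps) auto
      then show "rooted_count s * (merge_count b h + rooted_count (b @ h)) =
        catalan (length s) * (merge_bound (length h) (length b) + catalan (length (b @ h)))"
        by (simp only: rooted_count_decreasing part[OF hs])
    next
      fix v u i assume vu: "v @ u = f"
      show "rooted_count (drop i b @ u) * rooted_count (take i b @ v) =
        catalan (length (drop i b @ u)) * catalan (length (take i b @ v))"
        by (simp only: rooted_count_decreasing part[OF vu])
    qed
    finally show ?thesis using snoc by simp
  qed (simp add: merge_count_def)
qed

lemma merge_count_min_left:
  fixes y :: "'a::linorder"
  assumes "distinct (p @ q @ e)" "\<And>x. x \<in> set (p @ q @ e) \<Longrightarrow> y < x"
  shows "merge_count (p @ y # q) e = split_sum (\<lambda>u v. rooted_count v * merge_count (u @ q) e) p"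
proof -
  have "rooted_count (p @ y # (q @ rotate i e)) = split_sum (\<lambda>u v. rooted_count v * rooted_count (u @ q @ rotate i e)) p" for i
    by (rule rooted_count_min) (use assms in auto)
  then have "merge_count (p @ y # q) e = (\<Sum>i<length e. split_sum (\<lambda>u v. rooted_count v * rooted_count (u @ q @ rotate i e)) p)"
    by (simp add: merge_count_def)
  also have "\<dots> = split_sum (\<lambda>u v. rooted_count v * merge_count (u @ q) e) p"
    unfolding split_sum_def merge_count_def sum_distrib_left by (subst sum.swap) simp
  finally show ?thesis .
qed

text \<open>
  Induction that removes the smallest letter \<open>y\<close>. If \<open>y\<close> lies in \<open>e\<close>, all terms of the
  recursion are bounded separately, and the term of \<open>b @ f\<close> reaches its bound only if this
  word is decreasing. If \<open>y\<close> lies in \<open>b\<close>, the recursion is a part of a Catalan convolution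
  of smaller bounds, and this convolution is too small by \<open>catalan_sum_merge_bound_less\<close>.
\<close>
lemma merge_count_le:
  assumes "distinct (b @ e)" "e \<noteq> []"
  shows "merge_count b e \<le> merge_bound (length e) (length b)"
    and "merge_count b e = merge_bound (length e) (length b) \<Longrightarrow> \<exists>i. decreasing (b @ rotate i e)"
proof -
  have "merge_count b e \<le> merge_bound (length e) (length b) \<and>
     (merge_count b e = merge_bound (length e) (length b) \<longrightarrow> (\<exists>i. decreasing (b @ rotate i e)))"
    using assms
  proof (induction "length (b @ e)" arbitrary: b e rule: less_induct)
    case less
    define y where "y = Min (set (b @ e))"
    have y: "y \<in> set (b @ e)" unfolding y_def by (rule Min_in) (use less.prems in auto)
    have y_min: "y < x" if "x \<in> set (b @ e)" "x \<noteq> y" for x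
      using Min_le[of "set (b @ e)" x] that unfolding y_def by (simp add: order_less_le)
    from y consider "y \<in> set e" | "y \<in> set b" by auto
    then show ?case
    proof cases
      case 1
      then obtain e1 e2 where e: "e = e1 @ y # e2" by (meson split_list)
      define f where "f = e2 @ e1"
      have rot: "rotate (length e1) e = y # f" by (simp add: e f_def rotate_append)
      have d: "distinct (b @ f)" using less.prems by (auto simp: e f_def)
      have less_y: "y < x" if "x \<in> set b \<union> set f" for x
        using that less.prems by (intro y_min) (auto simp: e f_def)
      have len: "length e = Suc (length f)" by (simp add: e f_def)
      have mc: "merge_count b e = merge_count b (y # f)" by (metis rot merge_count_rotate)
      have IH: "merge_count b h \<le> merge_bound (length h) (length b)" if "h @ s = f" for h s
      proof (cases "h = []")
        case False
        have "length (b @ h) < length (b @ e)" "distinct (b @ h)" using that[symmetric] d len by auto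
        then show ?thesis using less.hyps[of b h] False by blast
      qed (simp add: merge_count_def)
      have part: "rooted_count (b @ h) \<le> catalan (length (b @ h))" "rooted_count s \<le> catalan (length s)"
         "rooted_count (take i b @ h) \<le> catalan (length (take i b @ h))"
         "rooted_count (drop i b @ s) \<le> catalan (length (drop i b @ s))" if "h @ s = f" for h s i
      proof -
        have "distinct (b @ h)" "distinct s" "distinct (take i b @ h)" "distinct (drop i b @ s)"
          using d that by (auto dest: in_set_takeD in_set_dropD simp: disjoint_iff)
        then show "rooted_count (b @ h) \<le> catalan (length (b @ h))" "rooted_count s \<le> catalan (length s)"
           "rooted_count (take i b @ h) \<le> catalan (length (take i b @ h))"
           "rooted_count (drop i b @ s) \<le> catalan (length (drop i b @ s))"
          by (blast intro: rooted_count_le_catalan(1))+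
      qed
      have le1: "rooted_count s * (merge_count b h + rooted_count (b @ h)) \<le>
          catalan (length s) * (merge_bound (length h) (length b) + catalan (length (b @ h)))" if "h @ s = f" for h s
        using part[OF that] IH[OF that] by (intro mult_mono add_mono) auto
      have le2: "split_sum (\<lambda>v u. \<Sum>i<length b. rooted_count (drop i b @ u) * rooted_count (take i b @ v)) f
           \<le> split_sum (\<lambda>v u. \<Sum>i<length b. catalan (length (drop i b @ u)) * catalan (length (take i b @ v))) f"
      proof (intro split_sum_mono sum_mono mult_mono)
        fix v u i assume vu: "v @ u = f"
        show "rooted_count (drop i b @ u) \<le> catalan (length (drop i b @ u))" by (rule part(4)[OF vu])
        show "rooted_count (take i b @ v) \<le> catalan (length (take i b @ v))" by (rule part(3)[OF vu])
      qed simp_all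
      have "merge_count b (y # f) \<le> merge_bound (Suc (length f)) (length b)"
        unfolding merge_bound_split
        by (subst merge_count_min_right[OF d less_y], assumption) (intro add_mono le2 split_sum_mono le1)
      moreover have "decreasing (b @ f @ [y])" if eq: "merge_count b (y # f) = merge_bound (Suc (length f)) (length b)"
      proof -
        have "rooted_count (b @ f) = catalan (length (b @ f))"
        proof (rule ccontr)
          assume "\<not> ?thesis"
          then have "rooted_count (b @ f) < catalan (length (b @ f))" using part(1)[of f "[]"] by simp
          then have "split_sum (\<lambda>h s. rooted_count s * (merge_count b h + rooted_count (b @ h))) f
            < split_sum (\<lambda>h s. catalan (length s) * (merge_bound (length h) (length b) + catalan (length (b @ h)))) f"
            using IH[of f "[]"] by (intro split_sum_strict_mono[of _ _ _ f "[]"] le1) auto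
          then show False
            using eq le2 merge_count_min_right[OF d less_y] merge_bound_split[of f b] by linarith
        qed
        then have "decreasing (b @ f)" using rooted_count_le_catalan(2)[OF d] by blast
        then show ?thesis using less_y by (auto simp: sorted_wrt_append)
      qed
      moreover have "rotate (Suc (length e1)) e = f @ [y]" using rot by simp
      ultimately show ?thesis unfolding mc len by (metis append.assoc)
    next
      case 2
      then obtain p q where b: "b = p @ y # q" by (meson split_list)
      have d: "distinct (p @ q @ e)" using less.prems by (auto simp: b)
      have less_y: "y < x" if "x \<in> set (p @ q @ e)" for x
        using that less.prems by (intro y_min) (auto simp: b)
      have "merge_count b e = split_sum (\<lambda>u v. rooted_count v * merge_count (u @ q) e) p"
        unfolding b by (rule merge_count_min_left[OF d less_y])
      also have "\<dots> \<le> split_sum (\<lambda>u v. catalan (length v) * merge_bound (length e) (length u + length q)) p"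
      proof (intro split_sum_mono mult_mono)
        fix u v assume uv: "u @ v = p"
        show "rooted_count v \<le> catalan (length v)" using d uv by (intro rooted_count_le_catalan) auto
        have "length ((u @ q) @ e) < length (b @ e)" "distinct ((u @ q) @ e)"
          using d by (auto simp: b uv[symmetric])
        then have "merge_count (u @ q) e \<le> merge_bound (length e) (length (u @ q))"
          using less.hyps less.prems(2) by blast
        then show "merge_count (u @ q) e \<le> merge_bound (length e) (length u + length q)" by simp
      qed auto
      also have "\<dots> = (\<Sum>i\<le>length p. catalan (length p - i) * merge_bound (length e) (i + length q))"
        unfolding split_sum_def by (intro sum.cong) (auto simp: add.commute)
      also have "\<dots> = (\<Sum>i\<le>length p. catalan i * merge_bound (length e) (length p + length q - i))"
        by (rule sum.reindex_bij_witness[of _ "\<lambda>i. length p - i" "\<lambda>i. length p - i"]) (auto simp: add.commute)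
      also have "\<dots> \<le> catalan_sum (merge_bound (length e)) (length p + length q)"
        unfolding catalan_sum_def by (intro sum_mono2) auto
      also have "\<dots> < merge_bound (length e) (length b)"
        using catalan_sum_merge_bound_less[of "length e" "length p + length q"] less.prems by (simp add: b)
      finally show ?thesis by simp
    qed
  qed
  then show "merge_count b e \<le> merge_bound (length e) (length b)"
    "merge_count b e = merge_bound (length e) (length b) \<Longrightarrow> \<exists>i. decreasing (b @ rotate i e)" by auto
qed

section \<open>Balancing the lengths of two cycles\<close>

text \<open>
  Along a diagonal \<open>k + l\<close> the differences of \<open>pair_bound\<close> are short convolutions, because
  multiplying the generating function by \<open>y - x\<close> cancels one factor \<open>K\<close>: from \<open>(y - x) K
  = y C(y) - x C(x)\<close> and \<open>x C(x)\<^sup>2 = C(x) - 1\<close> one gets \<open>x y K (C(y) - C(x))\<close>.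
\<close>
lemma pair_bound_step:
  assumes "k \<le> l"
  shows "pair_bound (Suc k) l = pair_bound k (Suc l) + (\<Sum>j\<in>{k<..l}. catalan j * catalan (k + l - j))"
proof -
  define B :: "(nat \<Rightarrow> nat \<Rightarrow> nat) \<Rightarrow> int fps fps" where "B = (\<lambda>f. Abs_fps (\<lambda>i. Abs_fps (\<lambda>j. int (f i j))))"
  define x y X Y :: "int fps fps" where "x = fps_X" and "y = fps_const fps_X"
    and "X = Abs_fps (\<lambda>i. fps_const (int (catalan i)))" and "Y = fps_const catalan_fps"
  define K where "K = B (\<lambda>i j. catalan (i + j))"
  have nth_B: "fps_nth (fps_nth (B f) i) j = int (f i j)" for f i j
    by (simp add: B_def)
  have nth_X: "fps_nth (fps_nth (X * h) i) j = (\<Sum>a\<le>i. int (catalan a) * fps_nth (fps_nth h (i - a)) j)" for h i j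
    by (simp add: X_def fps_mult_nth[of _ h] fps_sum_nth atLeast0AtMost)
  have nth_Y: "fps_nth (fps_nth (Y * h) i) j = (\<Sum>a\<le>j. int (catalan a) * fps_nth (fps_nth h i) (j - a))" for h i j
    unfolding Y_def by (simp only: fps_mult_left_const_nth) (simp add: catalan_fps_def fps_mult_nth atLeast0AtMost)
  have nth_x: "fps_nth (fps_nth (x * h) i) j = (if i = 0 then 0 else fps_nth (fps_nth h (i - 1)) j)" for h i j
    by (simp add: x_def)
  have nth_y: "fps_nth (fps_nth (y * h) i) j = (if j = 0 then 0 else fps_nth (fps_nth h i) (j - 1))" for h i j
    by (simp add: y_def)
  have ext: "f = g" if "\<And>i j. fps_nth (fps_nth f i) j = fps_nth (fps_nth g i) j" for f g :: "int fps fps"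
    by (intro fps_ext that)
  have nth_X': "fps_nth (fps_nth X i) j = (if j = 0 then int (catalan i) else 0)" for i j
    by (simp add: X_def)
  have nth_Y': "fps_nth (fps_nth Y i) j = (if i = 0 then int (catalan j) else 0)" for i j
    by (simp add: Y_def catalan_fps_def)
  have x0: "fps_nth x 0 = 0" by (simp add: x_def)
  have X: "X = 1 + x * X\<^sup>2"
  proof (rule ext)
    fix i j show "fps_nth (fps_nth X i) j = fps_nth (fps_nth (1 + x * X\<^sup>2) i) j"
      by (cases i; cases j) (simp_all add: nth_x nth_X nth_X' x0 power2_eq_square catalan.simps(2))
  qed
  have Y: "Y = 1 + y * Y\<^sup>2"
    unfolding Y_def y_def by (subst catalan_fps_eq) (simp flip: fps_const_add fps_const_mult add: fps_const_power)
  have conv: "B catalan_conv = K\<^sup>2"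
  proof (rule ext)
    fix i j show "fps_nth (fps_nth (B catalan_conv) i) j = fps_nth (fps_nth (K\<^sup>2) i) j"
      by (simp add: nth_B K_def power2_eq_square fps_mult_nth fps_sum_nth catalan_conv_def atLeast0AtMost add_ac)
  qed
  have pair: "B pair_bound = x * (y * (X * (Y * K\<^sup>2)))"
  proof (rule ext)
    fix i j show "fps_nth (fps_nth (B pair_bound) i) j = fps_nth (fps_nth (x * (y * (X * (Y * K\<^sup>2)))) i) j"
      by (cases i; cases j) (simp_all add: nth_x nth_y nth_X nth_Y nth_B x0 pair_bound_Suc_Suc catalan_conv_commute
          catalan_sum_def flip: conv)
  qed
  have K: "(y - x) * K = y * Y - x * X"
  proof (rule ext)
    fix i j show "fps_nth (fps_nth ((y - x) * K) i) j = fps_nth (fps_nth (y * Y - x * X) i) j"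
      by (cases i; cases j) (simp_all add: left_diff_distrib nth_x nth_y nth_X' nth_Y' nth_B K_def del: fps_mult_nth_0)
  qed
  have "(y - x) * B pair_bound = x * y * X * Y * K * ((y - x) * K)"
    unfolding pair by (simp add: power2_eq_square algebra_simps)
  also have "\<dots> = x * y * K * (X * (y * Y\<^sup>2) - Y * (x * X\<^sup>2))"
    unfolding K by (simp add: power2_eq_square algebra_simps)
  also have "y * Y\<^sup>2 = Y - 1" using Y by (metis add_diff_cancel_left')
  also have "x * X\<^sup>2 = X - 1" using X by (metis add_diff_cancel_left')
  also have "x * y * K * (X * (Y - 1) - Y * (X - 1)) = x * (y * (Y * K - X * K))"
    by (simp add: algebra_simps)
  finally have "(y - x) * B pair_bound = x * (y * (Y * K - X * K))" .
  then have "fps_nth (fps_nth ((y - x) * B pair_bound) (Suc k)) (Suc l) = fps_nth (fps_nth (x * (y * (Y * K - X * K))) (Suc k)) (Suc l)"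
    by simp
  then have "int (pair_bound (Suc k) l) - int (pair_bound k (Suc l))
     = (\<Sum>j\<le>l. int (catalan j * catalan (k + (l - j)))) - (\<Sum>j\<le>k. int (catalan j * catalan (k - j + l)))"
    by (simp add: left_diff_distrib nth_x nth_y nth_X nth_Y nth_B K_def del: pair_bound.simps)
  also have "(\<Sum>j\<le>l. int (catalan j * catalan (k + (l - j)))) = (\<Sum>j\<le>l. int (catalan j * catalan (k + l - j)))"
    by (intro sum.cong) auto
  also have "(\<Sum>j\<le>k. int (catalan j * catalan (k - j + l))) = (\<Sum>j\<le>k. int (catalan j * catalan (k + l - j)))"
    by (intro sum.cong) auto
  also have "(\<Sum>j\<le>l. int (catalan j * catalan (k + l - j))) - (\<Sum>j\<le>k. int (catalan j * catalan (k + l - j)))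
     = (\<Sum>j\<in>{..l}-{..k}. int (catalan j * catalan (k + l - j)))"
    by (rule sum_diff[symmetric]) (use assms in auto)
  also have "{..l} - {..k} = {k<..l}" by auto
  finally have "int (pair_bound (Suc k) l) = int (pair_bound k (Suc l) + (\<Sum>j\<in>{k<..l}. catalan j * catalan (k + l - j)))"
    by (simp del: pair_bound.simps)
  then show ?thesis by (simp only: of_nat_eq_iff)
qed

abbreviation catalan_diff :: "nat \<Rightarrow> nat" where
  "catalan_diff s \<equiv> catalan s - catalan (s - 1)"

text \<open>
  Every difference in \<open>pair_bound_step\<close> is at most the recursion for the next Catalan number
  without its first term.
\<close>
lemma pair_bound_le_catalan_diff:
  assumes "k \<le> l"
  shows "pair_bound k l \<le> k * catalan_diff (k + l)"
  using assms
proof (induction k arbitrary: l)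
  case (Suc k)
  have "(\<Sum>j\<in>{k<..l}. catalan j * catalan (k + l - j)) \<le> (\<Sum>j\<in>{0<..k+l}. catalan j * catalan (k + l - j))"
    by (intro sum_mono2) auto
  also have "\<dots> = catalan (Suc (k + l)) - catalan (k + l)"
  proof -
    have "{..k+l} = insert 0 {0<..k+l}" by auto
    then show ?thesis by (simp add: catalan.simps(2))
  qed
  finally show ?case
    using Suc.IH[of "Suc l"] Suc.prems pair_bound_step[of k l] by (simp del: pair_bound.simps)
qed simp

fun involution_count :: "nat \<Rightarrow> nat" where
  "involution_count 0 = 1"
| "involution_count (Suc 0) = 1"
| "involution_count (Suc (Suc n)) = involution_count (Suc n) + Suc n * involution_count n"

text \<open>
  The value of \<open>matching_sum\<close> at two parts: the two cycles are either left alone or paired.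
\<close>
definition two_cycle_bound :: "nat \<Rightarrow> nat \<Rightarrow> nat" where
  "two_cycle_bound k l = catalan k * catalan l + pair_bound k l"

lemma two_cycle_bound_commute: "two_cycle_bound k l = two_cycle_bound l k"
  by (simp add: two_cycle_bound_def mult.commute pair_bound_commute[of k])

lemma catalan_ratio: "real (catalan (Suc n)) = (4 - 6 / (real n + 2)) * real (catalan n)"
proof -
  have "(real n + 2) * real (catalan (Suc n)) = (4 * real n + 2) * real (catalan n)"
    using arg_cong[OF catalan_recurrence[of n], of real] by (simp only: of_nat_mult of_nat_add of_nat_numeral)
  then show ?thesis by (simp add: field_simps)
qed

text \<open>
  By \<open>pair_bound_step\<close> the claim is \<open>c\<^sub>k c\<^bsub>l+1\<^esub> \<le>
  c\<^bsub>k+1\<^esub> c\<^sub>l + S\<close>. The ratios \<open>c\<^bsub>n+1\<^esub> / c\<^sub>n = 4 - 6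
  / (n + 2)\<close> are at least 2 for \<open>n > 0\<close> and below 4. If \<open>l\<close> is at most \<open>k + 2\<close>, those
  for \<open>k\<close> and \<open>l\<close> differ by less than 1, and the term \<open>j = l\<close> of \<open>S\<close> suffices.
  Otherwise the terms \<open>j = k + 1\<close> and \<open>j = l - 1\<close> together contribute as much again. For
  \<open>k = 0\<close> both sides agree.
\<close>
lemma two_cycle_bound_step:
  assumes "k < l"
  shows "two_cycle_bound k (Suc l) \<le> two_cycle_bound (Suc k) l"
    and "k > 0 \<Longrightarrow> two_cycle_bound k (Suc l) < two_cycle_bound (Suc k) l"
proof -
  let ?c = "\<lambda>n. real (catalan n)"
  define S where "S = (\<Sum>j\<in>{k<..l}. catalan j * catalan (k + l - j))"
  have strict: "catalan k * catalan (Suc l) < catalan (Suc k) * catalan l + S" if k: "k > 0"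
  proof -
    have pos: "?c k * ?c l > 0" by (simp add: catalan_pos)
    have rec: "?c (Suc k) * ?c l = (4 - 6 / (real k + 2)) * (?c k * ?c l)"
        "?c k * ?c (Suc l) = (4 - 6 / (real l + 2)) * (?c k * ?c l)"
      by (simp_all add: catalan_ratio)
    consider "l \<le> k + 2" | "l \<ge> k + 3" by linarith
    then have "?c k * ?c (Suc l) < ?c (Suc k) * ?c l + real S"
    proof cases
      case 1
      have "catalan l * catalan k \<le> S"
        using member_le_sum[of l "{k<..l}" "\<lambda>j. catalan j * catalan (k + l - j)"] assms by (simp add: S_def)
      then have "?c l * ?c k \<le> real S"
        by (metis of_nat_le_iff of_nat_mult)
      moreover have "6 / (real k + 2) < 6 / (real l + 2) + 1"
      proof -
        have "6 / (real k + 4) \<le> 6 / (real l + 2)" using 1 by (intro divide_left_mono) auto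
        moreover have "6 / (real k + 2) < 6 / (real k + 4) + 1"
        proof -
          have "12 < (real k + 2) * (real k + 4)" using k mult_mono[of 3 "real k + 2" 5 "real k + 4"] by simp
          then show ?thesis by (simp add: field_simps)
        qed
        ultimately show ?thesis by linarith
      qed
      then have "(4 - 6 / (real l + 2)) * (?c k * ?c l) < (4 - 6 / (real k + 2) + 1) * (?c k * ?c l)"
        using pos by (intro mult_strict_right_mono) auto
      ultimately show ?thesis unfolding rec by (simp add: algebra_simps)
    next
      case 2
      have ck: "2 * ?c k \<le> ?c (Suc k)"
      proof -
        have "2 * ?c k \<le> (4 - 6 / (real k + 2)) * ?c k"
          using k by (intro mult_right_mono) (auto simp: field_simps)
        then show ?thesis by (simp add: catalan_ratio)
      qed
      obtain l' where l: "l = Suc l'" using 2 by (cases l) auto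
      have cl: "?c l \<le> 4 * ?c l'" using catalan_Suc_le[of l'] l by simp
      have "(\<Sum>j\<in>{l, l', Suc k}. catalan j * catalan (k + l - j)) \<le> S"
        unfolding S_def using 2 l by (intro sum_mono2) auto
      then have "catalan l * catalan k + 2 * (catalan (Suc k) * catalan l') \<le> S"
        using 2 l by (simp add: mult.commute Suc_diff_le)
      then have "?c l * ?c k + 2 * (?c (Suc k) * ?c l') \<le> real S"
        by (metis (mono_tags, opaque_lifting) of_nat_add of_nat_le_iff of_nat_mult of_nat_numeral)
      moreover have "?c l * ?c k \<le> 2 * (?c (Suc k) * ?c l')"
        using mult_mono[OF cl ck] by (simp add: mult.commute)
      moreover have "2 * (?c k * ?c l) \<le> ?c (Suc k) * ?c l"
        using mult_right_mono[OF ck, of "?c l"] by simp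
      moreover have "?c k * ?c (Suc l) < 4 * (?c k * ?c l)"
        unfolding rec using pos by (intro mult_strict_right_mono) auto
      ultimately show ?thesis by (simp add: mult.commute)
    qed
    then show ?thesis by (simp only: of_nat_mult[symmetric] of_nat_add[symmetric] of_nat_less_iff)
  qed
  have "catalan k * catalan (Suc l) \<le> catalan (Suc k) * catalan l + S"
  proof (cases "k = 0")
    case True
    have "{..l} = insert 0 {0<..l}" by auto
    then show ?thesis using True by (simp add: catalan.simps(2) S_def)
  qed (use strict in auto)
  then show "two_cycle_bound k (Suc l) \<le> two_cycle_bound (Suc k) l"
    using pair_bound_step[of k l] assms unfolding two_cycle_bound_def S_def by linarith
  show "k > 0 \<Longrightarrow> two_cycle_bound k (Suc l) < two_cycle_bound (Suc k) l"
    using pair_bound_step[of k l] assms strict unfolding two_cycle_bound_def S_def by linarith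
qed

definition balanced_bound :: "nat \<Rightarrow> nat" where
  "balanced_bound n = two_cycle_bound (n div 2) (n - n div 2)"

lemma two_cycle_bound_le_balanced:
  assumes "k \<le> l"
  shows "two_cycle_bound k l \<le> balanced_bound (k + l)"
    and "k + l \<ge> 4 \<Longrightarrow> two_cycle_bound k l = balanced_bound (k + l) \<Longrightarrow> k = (k + l) div 2"
proof -
  define n where "n = k + l"
  define f where "f = (\<lambda>i. two_cycle_bound i (n - i))"
  have step: "f i \<le> f (Suc i)" "i > 0 \<Longrightarrow> f i < f (Suc i)" if "Suc i \<le> n div 2" for i
  proof -
    have "n - i = Suc (n - Suc i)" "i < n - Suc i" using that by linarith+
    then show "f i \<le> f (Suc i)" "i > 0 \<Longrightarrow> f i < f (Suc i)"
      using two_cycle_bound_step[of i "n - Suc i"] by (auto simp: f_def)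
  qed
  have mono: "f i \<le> f j" if "i \<le> j" "j \<le> n div 2" for i j
    using that by (induction rule: dec_induct) (use step(1) in \<open>fastforce intro: order.trans\<close>)+
  have strict: "f i < f (n div 2)" if "i < n div 2" "n \<ge> 4" for i
  proof (cases "i = 0")
    case True
    have "Suc 1 \<le> n div 2" using that by linarith
    then have "f 0 \<le> f 1" "f 1 < f (Suc 1)" "f (Suc 1) \<le> f (n div 2)"
      using step(1)[of 0] step(2)[of 1] mono[of "Suc 1" "n div 2"] by auto
    then show ?thesis using True by simp
  next
    case False
    then show ?thesis using step(2)[of i] mono[of "Suc i" "n div 2"] that by simp
  qed
  have k: "k \<le> n div 2" using assms by (simp add: n_def)
  have fk: "two_cycle_bound k l = f k" "balanced_bound (k + l) = f (n div 2)"
    by (auto simp: f_def n_def balanced_bound_def)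
  show "two_cycle_bound k l \<le> balanced_bound (k + l)" using mono[OF k] fk by simp
  show "k = (k + l) div 2" if "k + l \<ge> 4" "two_cycle_bound k l = balanced_bound (k + l)"
    using strict[of k] k that fk by (fastforce simp: n_def)
qed

section \<open>Sums over the matchings of a cycle type\<close>

text \<open>
  The sum, over all ways to pair up some of the parts, of the product of \<open>pair_bound\<close> over
  the pairs and \<open>catalan\<close> over the other parts. The recursion treats the largest part first,
  but by \<open>matching_sum_add_mset\<close> any part may be chosen.
\<close>
function matching_sum :: "nat multiset \<Rightarrow> nat" where
  "matching_sum M = (if M = {#} then 1 else
     (let x = Max_mset M; N = M - {#x#} in
      catalan x * matching_sum N + (\<Sum>y\<in>#N. pair_bound x y * matching_sum (N - {#y#}))))"
  by auto
termination
proof (relation "measure size", goal_cases)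
  case (2 M x N)
  then have "x \<in># M" by simp
  then show ?case using 2 by (simp add: size_Diff_singleton nonempty_has_size)
next
  case (3 M x N y)
  then have "x \<in># M" by simp
  then have "size N < size M" using 3 by (simp add: size_Diff_singleton nonempty_has_size)
  moreover have "size (N - {#y#}) \<le> size N" by (simp add: size_mset_mono)
  ultimately show ?case by simp
qed simp

declare matching_sum.simps [simp del]

lemma matching_sum_empty [simp]: "matching_sum {#} = 1"
  by (simp add: matching_sum.simps)

lemma sum_mset_remove_swap:
  fixes h :: "'a \<Rightarrow> 'a \<Rightarrow> nat"
  shows "(\<Sum>y\<in>#N. \<Sum>w\<in>#N - {#y#}. h y w) = (\<Sum>y\<in>#N. \<Sum>w\<in>#N - {#y#}. h w y)"
proof -
  have remove: "(\<Sum>y\<in>#N. \<Sum>w\<in>#N - {#y#}. g y w) + (\<Sum>y\<in>#N. g y y) = (\<Sum>y\<in>#N. \<Sum>w\<in>#N. g y w)"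
    for g :: "'a \<Rightarrow> 'a \<Rightarrow> nat"
  proof -
    have "(\<Sum>w\<in>#N - {#y#}. g y w) + g y y = (\<Sum>w\<in>#N. g y w)" if "y \<in># N" for y
      using insert_DiffM[OF that] by (metis add.commute image_mset_add_mset sum_mset.add_mset)
    then have "(\<Sum>y\<in>#N. (\<Sum>w\<in>#N - {#y#}. g y w) + g y y) = (\<Sum>y\<in>#N. \<Sum>w\<in>#N. g y w)"
      by (intro arg_cong[of _ _ sum_mset] image_mset_cong) auto
    then show ?thesis by (simp add: sum_mset.distrib)
  qed
  have "(\<Sum>y\<in>#N. \<Sum>w\<in>#N. h y w) = (\<Sum>y\<in>#N. \<Sum>w\<in>#N. h w y)"
    by (rule sum_mset.swap)
  then show ?thesis using remove[of h] remove[of "\<lambda>y w. h w y"] by linarith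
qed

text \<open>
  Two parts may be removed in either order, since the sum over the partners of both is
  symmetric.
\<close>
lemma matching_sum_add_mset:
  "matching_sum (add_mset x M) = catalan x * matching_sum M + (\<Sum>y\<in>#M. pair_bound x y * matching_sum (M - {#y#}))"
proof (induction "size M" arbitrary: x M rule: less_induct)
  case less
  let ?F = matching_sum and ?D = pair_bound and ?c = catalan
  define z where "z = Max_mset (add_mset x M)"
  have zM: "z \<in># add_mset x M" unfolding z_def by (rule Max_in) auto
  have unfold: "?F (add_mset x M) = ?c z * ?F (add_mset x M - {#z#})
      + (\<Sum>y\<in>#add_mset x M - {#z#}. ?D z y * ?F (add_mset x M - {#z#} - {#y#}))"
    unfolding z_def by (subst matching_sum.simps) (simp add: Let_def)
  show ?case
  proof (cases "z = x")
    case True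
    then show ?thesis using unfold by simp
  next
    case False
    then have "z \<in># M" using zM by simp
    then obtain N where M: "M = add_mset z N" by (metis insert_DiffM)
    \<comment> \<open>Removing \<open>a\<close> first and then \<open>b\<close>. Up to the last sum the right-hand side is symmetric in
      \<open>a\<close> and \<open>b\<close>, and the last sum is symmetric after its two indices are exchanged.\<close>
    have expand: "?c a * ?F (add_mset b N) + (\<Sum>y\<in>#add_mset b N. ?D a y * ?F (add_mset b N - {#y#}))
        = ?c a * ?c b * ?F N + ?D a b * ?F N
          + (\<Sum>y\<in>#N. (?c a * ?D b y + ?c b * ?D a y) * ?F (N - {#y#}))
          + (\<Sum>y\<in>#N. \<Sum>w\<in>#N - {#y#}. ?D a y * ?D b w * ?F (N - {#y#} - {#w#}))" for a b
    proof -
      have "?F (add_mset b N) = ?c b * ?F N + (\<Sum>y\<in>#N. ?D b y * ?F (N - {#y#}))"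
        by (rule less.hyps) (unfold M, simp)
      moreover have "(\<Sum>y\<in>#add_mset b N. ?D a y * ?F (add_mset b N - {#y#}))
         = ?D a b * ?F N + (\<Sum>y\<in>#N. ?D a y * (?c b * ?F (N - {#y#})
              + (\<Sum>w\<in>#N - {#y#}. ?D b w * ?F (N - {#y#} - {#w#}))))"
      proof -
        have "(\<Sum>y\<in>#N. ?D a y * ?F (add_mset b N - {#y#})) = (\<Sum>y\<in>#N. ?D a y * (?c b * ?F (N - {#y#})
              + (\<Sum>w\<in>#N - {#y#}. ?D b w * ?F (N - {#y#} - {#w#}))))"
        proof (intro arg_cong[of _ _ sum_mset] image_mset_cong)
          fix y assume y: "y \<in># N"
          have "add_mset b N - {#y#} = add_mset b (N - {#y#})"
            using multi_member_split[OF y] by (auto simp: add_mset_commute[of b y])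
          moreover have "?F (add_mset b (N - {#y#})) = ?c b * ?F (N - {#y#})
              + (\<Sum>w\<in>#N - {#y#}. ?D b w * ?F (N - {#y#} - {#w#}))"
            by (rule less.hyps) (unfold M, use y in \<open>simp add: size_Diff_singleton\<close>)
          ultimately show "?D a y * ?F (add_mset b N - {#y#}) = ?D a y * (?c b * ?F (N - {#y#})
              + (\<Sum>w\<in>#N - {#y#}. ?D b w * ?F (N - {#y#} - {#w#})))" by simp
        qed
        then show ?thesis by simp
      qed
      ultimately show ?thesis
        by (simp add: sum_mset.distrib sum_mset_distrib_left distrib_left distrib_right mult_ac)
    qed
    have "add_mset x M - {#z#} = add_mset x N" using M by (simp add: add_mset_commute)
    then have "?F (add_mset x M) = ?c z * ?F (add_mset x N) + (\<Sum>y\<in>#add_mset x N. ?D z y * ?F (add_mset x N - {#y#}))"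
      using unfold by simp
    also have "\<dots> = ?c x * ?F (add_mset z N) + (\<Sum>y\<in>#add_mset z N. ?D x y * ?F (add_mset z N - {#y#}))"
    proof -
      have "(\<Sum>y\<in>#N. \<Sum>w\<in>#N - {#y#}. ?D z y * ?D x w * ?F (N - {#y#} - {#w#}))
          = (\<Sum>y\<in>#N. \<Sum>w\<in>#N - {#y#}. ?D x y * ?D z w * ?F (N - {#y#} - {#w#}))"
        using sum_mset_remove_swap[of "\<lambda>y w. ?D z y * ?D x w * ?F (N - {#y#} - {#w#})" N]
        by (simp add: diff_diff_add_mset add_mset_commute mult_ac)
      then show ?thesis
        unfolding expand[of z x] expand[of x z] pair_bound_commute[of z x] by (simp add: add_ac mult_ac)
    qed
    finally show ?thesis using M by simp
  qed
qed

section \<open>Maximizing over cycle types\<close>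

text \<open>
  An iterative form that the simplifier evaluates in linear time, like
  \<open>involution_count_fold\<close>.
\<close>
lemma catalan_fold: "catalan n = fold (\<lambda>i c. (4 * i + 2) * c div (i + 2)) [0..<n] 1"
proof (induction n)
  case (Suc n)
  have "catalan (Suc n) = (4 * n + 2) * catalan n div (n + 2)"
    unfolding catalan_recurrence[symmetric] by (rule nonzero_mult_div_cancel_left[symmetric]) simp
  then show ?case using Suc by simp
qed simp

lemma involution_count_fold:
  "involution_count n = fst (fold (\<lambda>i (a, b). (b, b + Suc i * a)) [0..<n] (1, 1))"
proof -
  have "fold (\<lambda>i (a, b). (b, b + Suc i * a)) [0..<n] (1, 1) = (involution_count n, involution_count (Suc n))"
    by (induction n) simp_all
  then show ?thesis by simp
qed

lemma pair_bound_sum_list: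
  assumes "k \<le> Suc l"
  shows "pair_bound k l = (\<Sum>i\<leftarrow>[0..<k]. \<Sum>j\<leftarrow>[Suc i..<k + l - i]. catalan j * catalan (k + l - 1 - j))"
  using assms
proof (induction k arbitrary: l)
  case (Suc k)
  have "pair_bound (Suc k) l = pair_bound k (Suc l) + (\<Sum>j\<in>{k<..l}. catalan j * catalan (k + l - j))"
    by (rule pair_bound_step) (use Suc.prems in auto)
  also have "(\<Sum>j\<in>{k<..l}. catalan j * catalan (k + l - j)) = (\<Sum>j\<leftarrow>[Suc k..<Suc l]. catalan j * catalan (k + l - j))"
    by (subst sum_list_distinct_conv_sum_set) (auto intro!: sum.cong)
  also have "pair_bound k (Suc l) = (\<Sum>i\<leftarrow>[0..<k]. \<Sum>j\<leftarrow>[Suc i..<Suc k + l - i]. catalan j * catalan (Suc k + l - 1 - j))"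
    using Suc.IH[of "Suc l"] Suc.prems by simp
  finally show ?case by (simp del: upt_Suc add: upt_Suc[of 0 k])
qed simp

lemma catalan_values:
  "catalan (Suc 0) = 1" "catalan 2 = 2" "catalan 3 = 5" "catalan 4 = 14" "catalan 5 = 42"
  "catalan 6 = 132" "catalan 7 = 429" "catalan 8 = 1430" "catalan 9 = 4862"
  "catalan 10 = 16796" "catalan 11 = 58786" "catalan 12 = 208012" "catalan 13 = 742900"
  "catalan 14 = 2674440" "catalan 15 = 9694845" "catalan 16 = 35357670"
  "catalan 17 = 129644790" "catalan 18 = 477638700" "catalan 19 = 1767263190"
  "catalan 20 = 6564120420" "catalan 21 = 24466267020" "catalan 22 = 91482563640"
  "catalan 23 = 343059613650" "catalan 24 = 1289904147324" "catalan 25 = 4861946401452"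
  "catalan 26 = 18367353072152" "catalan 27 = 69533550916004" "catalan 28 = 263747951750360"
  "catalan 29 = 1002242216651368"
  by (simp_all add: catalan_fold upt_conv_Cons flip: numeral_2_eq_2)

lemma involution_count_values:
  "involution_count 2 = 2" "involution_count 3 = 4" "involution_count 4 = 10"
  "involution_count 5 = 26" "involution_count 6 = 76" "involution_count 7 = 232"
  "involution_count 8 = 764" "involution_count 9 = 2620" "involution_count 10 = 9496"
  "involution_count 11 = 35696" "involution_count 12 = 140152" "involution_count 13 = 568504"
  "involution_count 14 = 2390480" "involution_count 15 = 10349536"
  "involution_count 16 = 46206736" "involution_count 17 = 211799312"
  "involution_count 18 = 997313824" "involution_count 19 = 4809701440"
  "involution_count 20 = 23758664096" "involution_count 21 = 119952692896"
  "involution_count 22 = 618884638912" "involution_count 23 = 3257843882624"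
  "involution_count 24 = 17492190577600" "involution_count 25 = 95680443760576"
  "involution_count 26 = 532985208200576" "involution_count 27 = 3020676745975552"
  "involution_count 28 = 17411277367391104" "involution_count 29 = 101990226254706560"
  "involution_count 30 = 606917269909048576"
  by (simp_all add: involution_count_fold upt_conv_Cons flip: numeral_2_eq_2)

lemma balanced_bound_values:
  "balanced_bound 0 = 1" "balanced_bound (Suc 0) = 1" "balanced_bound 2 = 2"
  "balanced_bound 3 = 5" "balanced_bound 4 = 15" "balanced_bound 5 = 47"
  "balanced_bound 6 = 159" "balanced_bound 7 = 543" "balanced_bound 8 = 1931"
  "balanced_bound 9 = 6879" "balanced_bound 10 = 25118" "balanced_bound 11 = 91693"
  "balanced_bound 12 = 340306" "balanced_bound 13 = 1262050" "balanced_bound 14 = 4736133"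
  "balanced_bound 15 = 17758947" "balanced_bound 16 = 67184515" "balanced_bound 17 = 253977515"
  "balanced_bound 18 = 966771894" "balanced_bound 19 = 3677629395"
  "balanced_bound 20 = 14067435174" "balanced_bound 21 = 53779580634"
  "balanced_bound 22 = 206531665288" "balanced_bound 23 = 792769577405"
  "balanced_bound 24 = 3054546754650" "balanced_bound 25 = 11764346864802"
  "balanced_bound 26 = 45454464053924" "balanced_bound 27 = 175562470792998"
  "balanced_bound 28 = 679949451218420" "balanced_bound 29 = 2632624609695316"
  by (simp_all add: balanced_bound_def two_cycle_bound_def pair_bound_sum_list catalan_values
      upt_conv_Cons del: pair_bound.simps flip: numeral_2_eq_2)

text \<open>The maximum multiplicity for \<open>n > 0\<close>.\<close>
definition peak_bound :: "nat \<Rightarrow> nat" where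
  "peak_bound n = (if n \<le> 17 then balanced_bound n else involution_count n)"

lemma peak_bound_values:
  "peak_bound 0 = 1" "peak_bound (Suc 0) = 1" "peak_bound 2 = 2" "peak_bound 3 = 5"
  "peak_bound 4 = 15" "peak_bound 5 = 47" "peak_bound 6 = 159" "peak_bound 7 = 543"
  "peak_bound 8 = 1931" "peak_bound 9 = 6879" "peak_bound 10 = 25118" "peak_bound 11 = 91693"
  "peak_bound 12 = 340306" "peak_bound 13 = 1262050" "peak_bound 14 = 4736133"
  "peak_bound 15 = 17758947" "peak_bound 16 = 67184515" "peak_bound 17 = 253977515"
  "peak_bound 18 = 997313824" "peak_bound 19 = 4809701440" "peak_bound 20 = 23758664096"
  "peak_bound 21 = 119952692896" "peak_bound 22 = 618884638912" "peak_bound 23 = 3257843882624"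
  "peak_bound 24 = 17492190577600" "peak_bound 25 = 95680443760576"
  "peak_bound 26 = 532985208200576" "peak_bound 27 = 3020676745975552"
  "peak_bound 28 = 17411277367391104" "peak_bound 29 = 101990226254706560"
  by (simp_all add: peak_bound_def balanced_bound_values involution_count_values)

text \<open>
  The cases \<open>n < 30\<close> of \<open>three_cycle_step\<close>. They are checked one by one, because for \<open>n =
  18\<close> the two sides are within about one percent of each other in the tightest case.
\<close>
lemma three_cycle_step_small:
  "list_all (\<lambda>n. list_all (\<lambda>x. list_all (\<lambda>y.
     catalan x * peak_bound (n - x) + (n - x) * (catalan_diff (x + y) * peak_bound (n - x - y))
       < peak_bound n) [1..<Suc (min x (n - x - 1))]) [2..<n - 1]) [4..<30]"
  by (simp add: peak_bound_values catalan_values upt_conv_Cons flip: numeral_2_eq_2)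

lemma matching_sum_single: "matching_sum {#x#} = catalan x"
  by (simp add: matching_sum_add_mset)

lemma matching_sum_pair: "matching_sum {#x, y#} = two_cycle_bound x y"
  by (simp add: matching_sum_add_mset two_cycle_bound_def)

lemma matching_sum_ones: "matching_sum (replicate_mset n 1) = involution_count n"
proof (induction n rule: involution_count.induct)
  case (3 n)
  have "pair_bound 1 1 = 1" by (simp add: catalan_conv_def)
  then show ?case
    using 3 by (simp add: matching_sum_add_mset[of _ "add_mset _ _"] matching_sum_add_mset[of _ "replicate_mset _ _"] catalan_values)
qed (simp_all add: matching_sum_single catalan_values)

lemma involution_count_pos: "involution_count n > 0"
  by (induction n rule: involution_count.induct) simp_all

lemma involution_count_ge_4_times:
  assumes "n \<ge> 12"
  shows "4 * involution_count n \<le> involution_count (Suc n)"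
proof -
  have "4 * involution_count n \<le> involution_count (Suc n) \<and> 4 * involution_count (Suc n) \<le> involution_count (Suc (Suc n))"
    using assms
  proof (induction n rule: dec_induct)
    case base
    then show ?case by (simp add: involution_count_values del: involution_count.simps)
  next
    case (step n)
    let ?t = involution_count
    have "Suc n * (4 * ?t n) \<le> Suc n * ?t (Suc n)" using step.IH by (intro mult_left_mono) auto
    then have "4 * (Suc n * ?t n) \<le> n * ?t (Suc n) + ?t (Suc n)"
      by (simp only: mult.left_commute[of _ 4] mult_Suc add.commute)
    moreover have "7 * ?t (Suc n) \<le> n * ?t (Suc n)" using step.hyps by (intro mult_right_mono) auto
    moreover have "?t (Suc (Suc n)) = ?t (Suc n) + Suc n * ?t n"
      "?t (Suc (Suc (Suc n))) = ?t (Suc (Suc n)) + (n * ?t (Suc n) + 2 * ?t (Suc n))" by simp_all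
    ultimately have "4 * ?t (Suc (Suc n)) \<le> ?t (Suc (Suc (Suc n)))" by linarith
    then show ?case using step.IH by blast
  qed
  then show ?thesis by blast
qed

lemma power_4_involution_count:
  assumes "m \<ge> 12"
  shows "4 ^ k * involution_count m \<le> involution_count (k + m)"
proof (induction k)
  case (Suc k)
  then show ?case using involution_count_ge_4_times[of "k + m"] assms by simp
qed simp

text \<open>From 30 on the involutions are numerous enough for the crude estimates below.\<close>
lemma power_4_le_involution_count:
  assumes "n \<ge> 30"
  shows "4 ^ n \<le> 2 * involution_count n"
proof -
  have "4 ^ n = 4 ^ (n - 30) * (4 ^ 30 :: nat)" using assms by (metis le_add_diff_inverse2 power_add)
  also have "\<dots> \<le> 4 ^ (n - 30) * (2 * involution_count 30)" by (simp add: involution_count_values)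
  also have "\<dots> \<le> 2 * involution_count (n - 30 + 30)" using power_4_involution_count[of 30 "n - 30"] by simp
  finally show ?thesis using assms by simp
qed

lemma catalan_le_power_4: "s > 0 \<Longrightarrow> 2 * (Suc s * catalan s) \<le> 4 ^ s"
proof (induction s rule: nat_induct_non_zero)
  case 1
  then show ?case by (simp add: catalan_values)
next
  case (Suc s)
  have "Suc (Suc s) * catalan (Suc s) \<le> 4 * (Suc s * catalan s)"
    using catalan_recurrence[of s] by simp
  then show ?case using Suc by simp
qed

text \<open>Sharp at \<open>x = 2\<close>, the smallest length of the largest part that matters.\<close>
lemma catalan_le_power_4': "x \<ge> 2 \<Longrightarrow> catalan x \<le> 2 * 4 ^ (x - 2)"
proof (induction x rule: nat_induct_at_least)
  case (Suc x)
  then obtain k where "x = k + 2" by (metis add.commute le_Suc_ex)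
  then show ?case using Suc.IH catalan_Suc_le[of x] by simp
qed (simp add: catalan_values)

lemma catalan_diff_le_power_4:
  assumes "s \<ge> 3"
  shows "catalan_diff s \<le> 4 ^ (s - 2)"
proof (cases "s = 3")
  case False
  have *: "s \<ge> 4 \<Longrightarrow> 3 * catalan (s - 1) \<le> 4 ^ (s - 2)"
  proof (induction s rule: nat_induct_at_least)
    case (Suc s)
    then have eq: "Suc (s - 1) = s" "Suc s - 2 = Suc (s - 2)" "Suc s - 1 = s" by simp_all
    show ?case using Suc.IH catalan_Suc_le[of "s - 1"] unfolding eq power_Suc by linarith
  qed (simp add: catalan_values)
  then show ?thesis using False assms catalan_Suc_le[of "s - 1"] by fastforce
qed (simp add: catalan_values)

lemma peak_bound_le_power_4:
  assumes "0 < m" "m \<le> 17"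
  shows "4 * peak_bound m \<le> 4 ^ m" "3 * (m * peak_bound m) \<le> 4 ^ m" "m \<ge> 2 \<Longrightarrow> 8 * peak_bound m \<le> 4 ^ m"
proof -
  have "\<forall>m\<in>set [1..<18]. 4 * peak_bound m \<le> 4 ^ m \<and> 3 * (m * peak_bound m) \<le> 4 ^ m \<and> (m \<ge> 2 \<longrightarrow> 8 * peak_bound m \<le> 4 ^ m)"
    by (simp add: upt_conv_Cons peak_bound_values flip: numeral_2_eq_2 del: set_upt)
  then show "4 * peak_bound m \<le> 4 ^ m" "3 * (m * peak_bound m) \<le> 4 ^ m" "m \<ge> 2 \<Longrightarrow> 8 * peak_bound m \<le> 4 ^ m"
    unfolding set_upt Ball_def atLeastLessThan_iff using assms by simp_all
qed

text \<open>
  If \<open>m\<close> is at least 18, all terms are compared with \<open>involution_count n\<close> through \<open>t(m +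
  1) \<ge> 4 t(m)\<close>, and the recursion \<open>t(n) = n t(n - 2) + (n - 2) t(n - 3)\<close> leaves enough
  room. If \<open>m\<close> is smaller, each summand is at most a sixth of the right-hand side.
\<close>
lemma three_cycle_step_large:
  assumes "n \<ge> 30" "n = x + y + m" "2 \<le> x" "1 \<le> y" "y \<le> x" "1 \<le> m"
  shows "catalan x * peak_bound (y + m) + (y + m) * (catalan_diff (x + y) * peak_bound m) < peak_bound n"
proof -
  let ?t = involution_count
  have peak_n: "peak_bound n = ?t n" and peak_big: "\<And>k. k \<ge> 18 \<Longrightarrow> peak_bound k = ?t k"
    using assms(1) by (auto simp: peak_bound_def)
  have pow_n: "4 ^ n \<le> 2 * ?t n" by (rule power_4_le_involution_count) fact
  have pos: "?t n > 0" by (rule involution_count_pos)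
  show ?thesis
  proof (cases "m \<ge> 18")
    case True
    have n3: "n = Suc (Suc (n - 2))" "n - 2 = Suc (n - 3)" using assms by auto
    have "catalan x * peak_bound (y + m) \<le> 2 * (4 ^ (x - 2) * ?t (y + m))"
      using catalan_le_power_4'[OF assms(3)] peak_big[of "y + m"] True by simp
    also have "4 ^ (x - 2) * ?t (y + m) \<le> ?t (n - 2)"
    proof -
      have "x - 2 + (y + m) = n - 2" using assms by simp
      then show ?thesis using power_4_involution_count[of "y + m" "x - 2"] True by simp
    qed
    finally have 1: "catalan x * peak_bound (y + m) \<le> 2 * ?t (n - 2)" by simp
    have "catalan_diff (x + y) * peak_bound m \<le> 4 ^ (x + y - 2) * ?t m"
      using catalan_diff_le_power_4[of "x + y"] peak_big[OF True] assms by (intro mult_mono) auto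
    also have "\<dots> = 4 * (4 ^ (x + y - 3) * ?t m)"
    proof -
      have "x + y - 2 = Suc (x + y - 3)" using assms by auto
      then show ?thesis by simp
    qed
    also have "4 ^ (x + y - 3) * ?t m \<le> ?t (n - 3)"
    proof -
      have "x + y - 3 + m = n - 3" using assms by simp
      then show ?thesis using power_4_involution_count[of m "x + y - 3"] True by simp
    qed
    finally have "catalan_diff (x + y) * peak_bound m \<le> 4 * ?t (n - 3)" by simp
    moreover have "y + m \<le> n - 2" using assms by simp
    ultimately have "(y + m) * (catalan_diff (x + y) * peak_bound m) \<le> (n - 2) * (4 * ?t (n - 3))"
      by (rule mult_le_mono[rotated])
    moreover have "(n - 2) * (4 * ?t (n - 3)) \<le> (n - 2) * ?t (n - 2)"
      using involution_count_ge_4_times[of "n - 3"] n3 assms by (intro mult_left_mono) auto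
    moreover have "?t n = ?t (n - 2) + (n - 2) * ?t (n - 3) + (n - 1) * ?t (n - 2)"
    proof -
      have "?t n = ?t (Suc (n - 2)) + Suc (n - 2) * ?t (n - 2)" by (subst n3(1)) simp
      also have "?t (Suc (n - 2)) = ?t (n - 2) + (n - 2) * ?t (n - 3)" by (subst (1 2 3) n3(2)) simp
      also have "Suc (n - 2) = n - 1" using assms by simp
      finally show ?thesis .
    qed
    moreover have "(n - 1) * ?t (n - 2) = (n - 2) * ?t (n - 2) + ?t (n - 2)"
      by (subst (1 2) n3(1)) simp
    moreover have "(n - 2) * ?t (n - 3) > 0" using assms involution_count_pos[of "n - 3"] by simp
    ultimately show ?thesis using 1 unfolding peak_n by linarith
  next
    case False
    define s where "s = x + y"
    have s: "s \<ge> 13" "n = s + m" using assms False by (auto simp: s_def)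
    \<comment> \<open>The factor \<open>48 (s + 1)\<close> clears the denominators of the bounds \<open>4\<^sup>s / (2 (s +
      1))\<close> for \<open>catalan s\<close>, \<open>4\<^sup>m / 4\<close> for \<open>peak_bound m\<close> and \<open>4\<^sup>m / 3\<close>
      for \<open>m * peak_bound m\<close>.\<close>
    have "48 * (Suc s * ((y + m) * (catalan_diff s * peak_bound m)))
        \<le> 24 * (2 * (Suc s * catalan s)) * ((y + m) * peak_bound m)"
    proof -
      have "catalan_diff s * ((y + m) * peak_bound m) \<le> catalan s * ((y + m) * peak_bound m)"
        by (intro mult_right_mono) auto
      then have "48 * Suc s * (catalan_diff s * ((y + m) * peak_bound m)) \<le> 48 * Suc s * (catalan s * ((y + m) * peak_bound m))"
        by (rule mult_left_mono) simp
      then show ?thesis by (simp only: mult_ac)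
    qed
    also have "\<dots> \<le> 24 * 4 ^ s * ((y + m) * peak_bound m)"
      using catalan_le_power_4[of s] s by (intro mult_mono) auto
    also have "\<dots> = 4 ^ s * (6 * y * (4 * peak_bound m) + 8 * (3 * (m * peak_bound m)))"
      by (simp add: algebra_simps)
    also have "\<dots> \<le> 4 ^ s * (6 * y * 4 ^ m + 8 * 4 ^ m)"
      using peak_bound_le_power_4[of m] False assms by (intro mult_left_mono add_mono) auto
    also have "\<dots> = 4 ^ n * (6 * y + 8)" by (simp add: s(2) power_add algebra_simps)
    also have "\<dots> \<le> 4 ^ n * (4 * Suc s)" using s assms by (intro mult_left_mono) (auto simp: s_def)
    finally have "Suc s * (12 * ((y + m) * (catalan_diff s * peak_bound m))) \<le> Suc s * 4 ^ n"
    proof -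
      show "Suc s * (12 * T) \<le> Suc s * 4 ^ n" if "48 * (Suc s * T) \<le> 4 ^ n * (4 * Suc s)" for T
        using that by (simp add: algebra_simps)
    qed
    then have 2: "12 * ((y + m) * (catalan_diff s * peak_bound m)) \<le> 4 ^ n"
      by (simp only: mult_le_cancel1)
    have x: "6 * catalan x \<le> 4 ^ x"
    proof -
      have "6 * catalan x \<le> 2 * (Suc x * catalan x)" using assms by simp
      then show ?thesis using catalan_le_power_4[of x] assms by linarith
    qed
    have "6 * (catalan x * peak_bound (y + m)) \<le> ?t n"
    proof (cases "y + m \<ge> 18")
      case True
      have "6 * (catalan x * peak_bound (y + m)) \<le> 4 ^ x * ?t (y + m)"
        using mult_right_mono[OF x, of "?t (y + m)"] peak_big[OF True] by (simp add: mult.assoc)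
      also have "\<dots> \<le> ?t n" using power_4_involution_count[of "y + m" x] True assms by (simp add: add.assoc)
      finally show ?thesis .
    next
      case False
      have "8 * peak_bound (y + m) \<le> 4 ^ (y + m)" using peak_bound_le_power_4[of "y + m"] False assms by auto
      then have "(6 * catalan x) * (8 * peak_bound (y + m)) \<le> 4 ^ x * 4 ^ (y + m)"
        using x by (intro mult_mono) auto
      then show ?thesis using pow_n by (simp add: assms(2) power_add mult_ac)
    qed
    then show ?thesis using 2 pow_n pos unfolding peak_n s_def by linarith
  qed
qed

text \<open>
  The induction step for a type with three or more parts: \<open>x\<close> is its largest part, \<open>y\<close> a
  partner of \<open>x\<close>, and \<open>m\<close> the sum of the others. The difference of Catalan numbers bounds
  \<open>pair_bound x y / y\<close>, by \<open>pair_bound_le_catalan_diff\<close>; after this division the sum over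
  all partners amounts to at most the factor \<open>y + m\<close>, the sum of their sizes.
\<close>
lemma three_cycle_step:
  assumes "n = x + y + m" "2 \<le> x" "1 \<le> y" "y \<le> x" "1 \<le> m"
  shows "catalan x * peak_bound (y + m) + (y + m) * (catalan_diff (x + y) * peak_bound m) < peak_bound n"
proof (cases "n \<ge> 30")
  case False
  define P where "P = (\<lambda>n x y. catalan x * peak_bound (n - x)
     + (n - x) * (catalan_diff (x + y) * peak_bound (n - x - y)) < peak_bound n)"
  have "list_all (\<lambda>n. list_all (\<lambda>x. list_all (P n x) [1..<Suc (min x (n - x - 1))]) [2..<n - 1]) [4..<30]"
    unfolding P_def by (rule three_cycle_step_small)
  then have P: "P n x y" if "4 \<le> n" "n < 30" "2 \<le> x" "x < n - 1" "1 \<le> y" "y \<le> x" "y \<le> n - x - 1" for n x y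
    using that unfolding list_all_iff set_upt Ball_def atLeastLessThan_iff less_Suc_eq_le min.bounded_iff by blast
  have diff: "n - x = y + m" "n - x - y = m" "n - x - 1 = y + (m - 1)" "n - 1 = x + (y + (m - 1))" using assms by simp_all
  have "P n x y"
  proof (rule P)
    show "4 \<le> n" "n < 30" using assms False by linarith+
    show "x < n - 1" "y \<le> n - x - 1" unfolding diff using assms by simp_all
  qed (use assms in simp_all)
  then show ?thesis unfolding P_def by (simp only: diff diff_add_inverse)
next
  case True
  from three_cycle_step_large[OF True assms] show ?thesis .
qed

lemma balanced_bound_less_involution_count:
  assumes "n \<ge> 18"
  shows "balanced_bound n < involution_count n"
proof (cases "n \<ge> 30")
  case True
  define k l where "k = n div 2" and "l = n - n div 2"
  have kl: "k + l = n" "k \<le> l" "2 * k \<le> n" by (auto simp: k_def l_def)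
  have "catalan k * catalan l \<le> catalan (Suc n)"
    using member_le_sum[of k "{..n}" "\<lambda>i. catalan i * catalan (n - i)"] kl by (simp add: catalan.simps(2) l_def k_def)
  then have "catalan k * catalan l \<le> 4 * catalan n" using catalan_Suc_le[of n] by linarith
  moreover have "pair_bound k l \<le> k * catalan n"
    using pair_bound_le_catalan_diff[OF kl(2)] kl(1) by (meson diff_le_self le_trans mult_le_mono2)
  ultimately have "balanced_bound n \<le> (k + 4) * catalan n"
    unfolding balanced_bound_def two_cycle_bound_def k_def[symmetric]
    using kl(1) by (simp add: algebra_simps l_def flip: k_def)
  then have "2 * 2 * Suc n * balanced_bound n \<le> 2 * 2 * Suc n * ((k + 4) * catalan n)"
    by (rule mult_le_mono2)
  then have "2 * (2 * (Suc n * balanced_bound n)) \<le> 2 * (k + 4) * (2 * (Suc n * catalan n))"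
    by (simp only: mult_ac)
  also have "\<dots> \<le> 2 * (k + 4) * 4 ^ n"
    using catalan_le_power_4[of n] True by (intro mult_left_mono) auto
  also have "\<dots> < 2 * Suc n * 4 ^ n" using kl True by (intro mult_strict_right_mono) auto
  finally have "2 * balanced_bound n < 4 ^ n"
    by (metis (no_types, lifting) mult.left_commute mult.assoc mult_less_cancel1)
  then show ?thesis using power_4_le_involution_count[OF True] by linarith
next
  case False
  have "\<forall>n\<in>set [18..<30]. balanced_bound n < involution_count n"
    by (simp add: upt_conv_Cons balanced_bound_values involution_count_values del: set_upt)
  moreover have "n \<in> set [18..<30]" unfolding set_upt atLeastLessThan_iff using assms False by linarith
  ultimately show ?thesis by blast
qed

lemma involution_count_le_balanced_bound:
  assumes "n \<le> 17"
  shows "involution_count n \<le> balanced_bound n" "n \<ge> 4 \<Longrightarrow> involution_count n < balanced_bound n"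
proof -
  have "\<forall>n\<in>set [0..<18]. involution_count n \<le> balanced_bound n \<and> (n \<ge> 4 \<longrightarrow> involution_count n < balanced_bound n)"
    by (simp add: upt_conv_Cons balanced_bound_values involution_count_values del: set_upt flip: numeral_2_eq_2)
  then show "involution_count n \<le> balanced_bound n" "n \<ge> 4 \<Longrightarrow> involution_count n < balanced_bound n"
    unfolding set_upt Ball_def atLeastLessThan_iff using assms by simp_all
qed

lemma two_cycle_bound_le_peak:
  "two_cycle_bound k l \<le> peak_bound (k + l)"
  "k + l \<ge> 4 \<Longrightarrow> two_cycle_bound k l = peak_bound (k + l) \<Longrightarrow>
     k + l \<le> 17 \<and> {#k, l#} = {#(k + l) div 2, k + l - (k + l) div 2#}"
proof -
  have "two_cycle_bound k l \<le> peak_bound (k + l) \<and> (k + l \<ge> 4 \<longrightarrow> two_cycle_bound k l = peak_bound (k + l) \<longrightarrow>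
     k + l \<le> 17 \<and> {#k, l#} = {#(k + l) div 2, k + l - (k + l) div 2#})" if "k \<le> l" for k l
  proof -
    note le = two_cycle_bound_le_balanced[OF that]
    show ?thesis
    proof (cases "k + l \<le> 17")
      case True
      then have p: "peak_bound (k + l) = balanced_bound (k + l)" by (simp add: peak_bound_def)
      have "{#k, l#} = {#(k + l) div 2, k + l - (k + l) div 2#}" if k: "k = (k + l) div 2"
      proof -
        have "l = k + l - (k + l) div 2" by (subst k[symmetric]) simp
        then show ?thesis by (simp only: k[symmetric])
      qed
      then show ?thesis using le p True by auto
    next
      case False
      then have "balanced_bound (k + l) < peak_bound (k + l)"
        using balanced_bound_less_involution_count[of "k + l"] by (simp add: peak_bound_def)
      then show ?thesis using le(1) by simp
    qed
  qed
  note * = this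
  show "two_cycle_bound k l \<le> peak_bound (k + l)"
    using *[of k l] *[of l k] by (metis add.commute linear two_cycle_bound_commute)
  show "k + l \<le> 17 \<and> {#k, l#} = {#(k + l) div 2, k + l - (k + l) div 2#}"
    if "k + l \<ge> 4" "two_cycle_bound k l = peak_bound (k + l)"
  proof (cases "k \<le> l")
    case True
    then show ?thesis using *[OF True] that by blast
  next
    case False
    then have "l \<le> k" by simp
    from *[OF this] show ?thesis
      using that unfolding add.commute[of l k] two_cycle_bound_commute[of l k] add_mset_commute[of l k] by blast
  qed
qed

text \<open>
  With three or more parts that are not all 1, the largest part \<open>x\<close> is removed. Among the
  possible partners of \<open>x\<close> the best one relative to its size is \<open>y0\<close>.
\<close>
lemma matching_sum_le_peak:
  assumes "\<And>x. x \<in># M \<Longrightarrow> x > 0"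
  shows "matching_sum M \<le> peak_bound (\<Sum>\<^sub># M)"
    and "\<Sum>\<^sub># M \<ge> 4 \<Longrightarrow> matching_sum M = peak_bound (\<Sum>\<^sub># M) \<Longrightarrow>
      M = (if \<Sum>\<^sub># M \<le> 17 then {#\<Sum>\<^sub># M div 2, \<Sum>\<^sub># M - \<Sum>\<^sub># M div 2#} else replicate_mset (\<Sum>\<^sub># M) 1)"
proof -
  have "matching_sum M \<le> peak_bound (\<Sum>\<^sub># M) \<and> (\<Sum>\<^sub># M \<ge> 4 \<longrightarrow> matching_sum M = peak_bound (\<Sum>\<^sub># M) \<longrightarrow>
      M = (if \<Sum>\<^sub># M \<le> 17 then {#\<Sum>\<^sub># M div 2, \<Sum>\<^sub># M - \<Sum>\<^sub># M div 2#} else replicate_mset (\<Sum>\<^sub># M) 1))"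
    using assms
  proof (induction "size M" arbitrary: M rule: less_induct)
    case less
    define n where "n = \<Sum>\<^sub># M"
    consider (none) "M = {#}" | (one) x where "M = {#x#}" | (two) x y where "M = {#x, y#}" | (more) "size M \<ge> 3"
    proof -
      consider "size M = 0" | "size M = 1" | "size M = 2" | "size M \<ge> 3" by linarith
      then show ?thesis
      proof cases
        case 1 then show ?thesis using that(1) by simp
      next
        case 2 then show ?thesis using that(2) by (metis One_nat_def size_1_singleton_mset)
      next
        case 3
        then obtain x N where M: "M = add_mset x N" using size_eq_Suc_imp_eq_union[of M 1] by auto
        then obtain y where "N = {#y#}" using 3 size_1_singleton_mset[of N] by auto
        then show ?thesis using that(3) M by blast
      next
        case 4 then show ?thesis by (rule that(4))
      qed
    qed
    then show ?case
    proof cases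
      case none
      then show ?thesis by (simp add: peak_bound_values)
    next
      case (one x)
      have "two_cycle_bound 0 x = matching_sum M" by (simp add: one matching_sum_single two_cycle_bound_def)
      moreover have "{#0, x#} \<noteq> {#x div 2, x - x div 2#}" if "x \<ge> 4"
      proof
        assume "{#0, x#} = {#x div 2, x - x div 2#}"
        then have "0 \<in># {#x div 2, x - x div 2#}" by (metis union_single_eq_member)
        then show False using that by auto
      qed
      ultimately show ?thesis using two_cycle_bound_le_peak[of 0 x] one by auto
    next
      case (two x y)
      then show ?thesis using two_cycle_bound_le_peak[of x y] by (auto simp: matching_sum_pair)
    next
      case more
      show ?thesis
      proof (cases "\<forall>x\<in>#M. x = 1")
        case True
        then have M: "M = replicate_mset (size M) 1"
          by (intro set_mset_subset_singletonD) auto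
        have "n = size M" unfolding n_def by (subst M) simp
        then have M: "M = replicate_mset n 1" using M by simp
        have F: "matching_sum M = involution_count n" unfolding M by (rule matching_sum_ones)
        show ?thesis
        proof (cases "n \<le> 17")
          case True
          then have "matching_sum M < peak_bound n" if "n \<ge> 4"
            using that involution_count_le_balanced_bound[OF True] True by (simp add: peak_bound_def F)
          moreover have "matching_sum M \<le> peak_bound n"
            using involution_count_le_balanced_bound[OF True] True by (simp add: peak_bound_def F)
          ultimately show ?thesis unfolding n_def by auto
        next
          case False
          then have eq: "matching_sum M = peak_bound n" by (simp add: peak_bound_def F)
          show ?thesis unfolding n_def[symmetric] eq using M False by simp
        qed
      next
        case False
        \<comment> \<open>Any part may be removed by \<open>matching_sum_add_mset\<close>; the largest one gives the
          bound \<open>y \<le> x\<close> that \<open>three_cycle_step\<close> needs.\<close>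
        define x where "x = Max_mset M"
        define N where "N = M - {#x#}"
        have "M \<noteq> {#}" using more by auto
        then have x: "x \<in># M" unfolding x_def by simp
        have x_max: "y \<le> x" if "y \<in># M" for y unfolding x_def using that by simp
        obtain w where "w \<in># M" "w \<noteq> 1" using False by auto
        then have x2: "x \<ge> 2" using less.prems[of w] x_max[of w] by linarith
        have M: "M = add_mset x N" using x by (simp add: N_def)
        have n: "n = x + \<Sum>\<^sub># N" by (simp add: n_def M)
        have posN: "y > 0" if "y \<in># N" for y using that less.prems M by auto
        define v where "v = (\<lambda>y. catalan_diff (x + y) * peak_bound (\<Sum>\<^sub># N - y))"
        have IH: "matching_sum K \<le> peak_bound (\<Sum>\<^sub># K)" if "K \<subseteq># N" for K
          using less.hyps[of K] less.prems size_mset_mono[OF that] mset_subset_eqD[OF that] M by auto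
        have "N \<noteq> {#}" using more M by auto
        then obtain y0 where y0: "y0 \<in># N" "\<And>y. y \<in># N \<Longrightarrow> v y \<le> v y0"
          using Max_in[of "v ` set_mset N"] Max_ge[of "v ` set_mset N"] by (metis (no_types, lifting) finite_imageI finite_set_mset imageE imageI image_is_empty set_mset_eq_empty_iff)
        obtain K where K: "N = add_mset y0 K" using y0(1) by (metis insert_DiffM)
        have "K \<noteq> {#}" using more M K by auto
        then obtain u K' where "K = add_mset u K'" by (metis multiset_cases)
        then have m: "\<Sum>\<^sub># K \<ge> 1" using posN[of u] K by simp
        have "(\<Sum>y\<in>#N. pair_bound x y * matching_sum (N - {#y#})) \<le> (\<Sum>y\<in>#N. y * v y0)"
        proof (rule sum_mset_mono)
          fix y assume y: "y \<in># N"
          have "pair_bound x y \<le> y * (catalan_diff (x + y))"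
            using pair_bound_le_catalan_diff[of y x] x_max[of y] y M by (simp add: pair_bound_commute[of x] add.commute)
          moreover have "matching_sum (N - {#y#}) \<le> peak_bound (\<Sum>\<^sub># N - y)"
            using IH[of "N - {#y#}"] sum_mset_diff[of "{#y#}" N] y by simp
          ultimately have "pair_bound x y * matching_sum (N - {#y#}) \<le> y * catalan_diff (x + y) * peak_bound (\<Sum>\<^sub># N - y)"
            by (rule mult_mono) auto
          also have "\<dots> = y * v y" by (simp add: v_def mult.assoc)
          also have "\<dots> \<le> y * v y0" using y0(2)[OF y] by simp
          finally show "pair_bound x y * matching_sum (N - {#y#}) \<le> y * v y0" .
        qed
        also have "\<dots> = \<Sum>\<^sub># N * v y0" by (simp flip: sum_mset_distrib_right)
        finally have "matching_sum M \<le> catalan x * peak_bound (\<Sum>\<^sub># N) + \<Sum>\<^sub># N * v y0"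
          unfolding M matching_sum_add_mset by (intro add_mono mult_left_mono IH) auto
        also have "\<dots> < peak_bound n"
          using three_cycle_step[of n x y0 "\<Sum>\<^sub># K"] x2 m posN[OF y0(1)] x_max[of y0] y0(1) M K n
          by (simp add: v_def)
        finally show ?thesis unfolding n_def by simp
      qed
    qed
  qed
  then show "matching_sum M \<le> peak_bound (\<Sum>\<^sub># M)"
    "\<Sum>\<^sub># M \<ge> 4 \<Longrightarrow> matching_sum M = peak_bound (\<Sum>\<^sub># M) \<Longrightarrow>
      M = (if \<Sum>\<^sub># M \<le> 17 then {#\<Sum>\<^sub># M div 2, \<Sum>\<^sub># M - \<Sum>\<^sub># M div 2#} else replicate_mset (\<Sum>\<^sub># M) 1)" by auto
qed

section \<open>Removing factors from an exchange product\<close>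

text \<open>
  The sequences whose first \<open>k\<close> factors have the product \<open>\<sigma>\<close>. The numbers above
  \<open>k\<close> have no factor here, and they are the roots.
\<close>
definition prefix_count :: "nat \<Rightarrow> nat \<Rightarrow> (nat \<Rightarrow> nat) \<Rightarrow> nat" where
  "prefix_count n k \<sigma> = card {a \<in> {1..k} \<rightarrow>\<^sub>E {1..n}. \<sigma> = exchange_prod a k}"

lemma exchange_prod_cong: "(\<And>i. i \<in> {1..k} \<Longrightarrow> a i = b i) \<Longrightarrow> exchange_prod a k = exchange_prod b k"
  by (induction k) auto

lemma prefix_count_0: "prefix_count n 0 \<sigma> = (if \<sigma> = id then 1 else 0)"
  by (simp add: prefix_count_def)

lemma prefix_count_Suc:
  "prefix_count n (Suc k) \<sigma> = (\<Sum>b\<in>{1..n}. prefix_count n k (transpose (Suc k) b \<circ> \<sigma>))"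
proof -
  let ?A = "\<lambda>b. {g \<in> {1..k} \<rightarrow>\<^sub>E {1..n}. transpose (Suc k) b \<circ> \<sigma> = exchange_prod g k}"
  let ?h = "\<lambda>(b, g). g(Suc k := b)"
  have ins: "{1..Suc k} = insert (Suc k) {1..k}" by auto
  have ep: "exchange_prod (g(Suc k := b)) (Suc k) = transpose (Suc k) b \<circ> exchange_prod g k" for g b
    using exchange_prod_cong[of k "g(Suc k := b)" g] by simp
  have eq: "\<sigma> = transpose (Suc k) b \<circ> \<rho> \<longleftrightarrow> transpose (Suc k) b \<circ> \<sigma> = \<rho>" for b \<rho>
    unfolding fun_eq_iff comp_def by (metis transpose_involutory)
  have "{a \<in> {1..Suc k} \<rightarrow>\<^sub>E {1..n}. \<sigma> = exchange_prod a (Suc k)} = ?h ` (SIGMA b:{1..n}. ?A b)"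
  proof -
    have "{a \<in> ?h ` A. \<sigma> = exchange_prod a (Suc k)} = ?h ` {x \<in> A. \<sigma> = exchange_prod (?h x) (Suc k)}" for A
      by auto
    then show ?thesis
      unfolding ins PiE_insert_eq by (auto simp: ep eq simp del: exchange_prod.simps intro!: arg_cong[of _ _ "image ?h"])
  qed
  moreover have "inj_on ?h (SIGMA b:{1..n}. ?A b)"
  proof (rule inj_onI, clarify)
    fix b g b' g'
    assume g: "g \<in> {1..k} \<rightarrow>\<^sub>E {1..n}" "g' \<in> {1..k} \<rightarrow>\<^sub>E {1..n}" and e: "g(Suc k := b) = g'(Suc k := b')"
    have "g i = g' i" for i
      using fun_cong[OF e, of i] PiE_arb[OF g(1), of i] PiE_arb[OF g(2), of i] by (cases "i = Suc k") auto
    then show "b = b' \<and> g = g'" using fun_cong[OF e, of "Suc k"] by auto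
  qed
  ultimately have "prefix_count n (Suc k) \<sigma> = card (SIGMA b:{1..n}. ?A b)"
    unfolding prefix_count_def by (simp only: card_image)
  also have "\<dots> = (\<Sum>b\<in>{1..n}. card (?A b))"
  proof (rule card_SigmaI)
    have "finite ({1..k} \<rightarrow>\<^sub>E {1..n})" by (rule finite_PiE) auto
    then show "\<forall>b\<in>{1..n}. finite (?A b)" by (auto intro: rev_finite_subset)
  qed simp
  finally show ?thesis unfolding prefix_count_def .
qed

text \<open>
  Two roots never lie on the same cycle, since the first \<open>k\<close> edges cannot connect them.
  Invariant sets express this without any reference to cycles: of the two disjoint invariant
  sets around \<open>x\<close> and \<open>y\<close> that avoid \<open>k + 1\<close>, the last factor spoils at most one.
\<close>
lemma exchange_prod_separates:
  assumes "x > k" "y > k" "x \<noteq> y"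
  shows "\<exists>S. (\<forall>u. exchange_prod a k u \<in> S \<longleftrightarrow> u \<in> S) \<and> x \<in> S \<and> y \<notin> S"
  using assms
proof (induction k arbitrary: x y)
  case 0
  then show ?case by (intro exI[of _ "{x}"]) auto
next
  case (Suc k)
  let ?\<sigma> = "exchange_prod a k" and ?z = "Suc k"
  have *: "\<exists>S. (\<forall>u. ?\<sigma> u \<in> S \<longleftrightarrow> u \<in> S) \<and> s \<in> S \<and> t \<notin> S" if "s \<in> {x, y, ?z}" "t \<in> {x, y, ?z}" "s \<noteq> t" for s t
    by (rule Suc.IH) (use that Suc.prems in auto)
  have nz: "x \<noteq> ?z" "y \<noteq> ?z" using Suc.prems by auto
  obtain S1 where S1: "\<And>u. ?\<sigma> u \<in> S1 \<longleftrightarrow> u \<in> S1" "x \<in> S1" "y \<notin> S1" using *[of x y] Suc.prems by auto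
  obtain S2 where S2: "\<And>u. ?\<sigma> u \<in> S2 \<longleftrightarrow> u \<in> S2" "x \<in> S2" "?z \<notin> S2" using *[of x ?z] nz by auto
  obtain S3 where S3: "\<And>u. ?\<sigma> u \<in> S3 \<longleftrightarrow> u \<in> S3" "y \<in> S3" "?z \<notin> S3" using *[of y ?z] nz by auto
  have trans: "exchange_prod a ?z u \<in> S \<longleftrightarrow> u \<in> S"
    if "?z \<notin> S" "a ?z \<notin> S" "\<And>u. ?\<sigma> u \<in> S \<longleftrightarrow> u \<in> S" for S u
  proof -
    have "transpose ?z (a ?z) w \<in> S \<longleftrightarrow> w \<in> S" for w using that by (auto simp: transpose_def)
    then show ?thesis using that(3) by simp
  qed
  \<comment> \<open>\<open>S1 \<inter> S2\<close> contains \<open>x\<close>, \<open>S3 - S1\<close> contains \<open>y\<close>, and \<open>a ?z\<close> can only lie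
    in one of them.\<close>
  show ?case
  proof (cases "a ?z \<in> S1 \<inter> S2")
    case False
    have "\<forall>u. exchange_prod a ?z u \<in> S1 \<inter> S2 \<longleftrightarrow> u \<in> S1 \<inter> S2"
      by (intro allI trans) (use False S1 S2 in auto)
    moreover have "x \<in> S1 \<inter> S2" "y \<notin> S1 \<inter> S2" using S1(2,3) S2(2) by auto
    ultimately show ?thesis by (intro exI[of _ "S1 \<inter> S2"] conjI)
  next
    case True
    have "exchange_prod a ?z u \<in> S3 - S1 \<longleftrightarrow> u \<in> S3 - S1" for u
      by (rule trans) (use True S1 S3 in auto)
    then have "\<forall>u. exchange_prod a ?z u \<in> - (S3 - S1) \<longleftrightarrow> u \<in> - (S3 - S1)" by (simp only: Compl_iff simp_thms)
    moreover have "x \<in> - (S3 - S1)" "y \<notin> - (S3 - S1)" using S1(2,3) S3(2) by auto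
    ultimately show ?thesis by (intro exI[of _ "- (S3 - S1)"] conjI)
  qed
qed

text \<open>
  In this form cutting, merging and rotating cycles are computations with lists. A fixed point
  is a cycle of length 1.
\<close>
definition cycle_list :: "('a \<Rightarrow> 'a) \<Rightarrow> 'a list \<Rightarrow> bool" where
  "cycle_list \<sigma> c \<longleftrightarrow> c \<noteq> [] \<and> distinct c \<and> map \<sigma> c = rotate1 c"

lemma cycle_list_invariant:
  assumes "cycle_list \<sigma> c" "\<And>u. \<sigma> u \<in> S \<longleftrightarrow> u \<in> S" "x \<in> set c" "y \<in> set c"
  shows "x \<in> S \<longleftrightarrow> y \<in> S"
proof -
  have step: "c ! Suc i = \<sigma> (c ! i)" if "Suc i < length c" for i
  proof -
    have "map \<sigma> c ! i = rotate1 c ! i" using assms(1) by (simp add: cycle_list_def)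
    then show ?thesis using that by (simp add: nth_rotate1)
  qed
  have "c ! i \<in> S \<longleftrightarrow> c ! 0 \<in> S" if "i < length c" for i
    using that by (induction i) (auto simp: step assms(2))
  then show ?thesis using assms(3,4) by (metis in_set_conv_nth)
qed

lemma prefix_count_eq_0:
  assumes "cycle_list \<sigma> c" "x \<in> set c" "y \<in> set c" "x \<noteq> y" "x > k" "y > k"
  shows "prefix_count n k \<sigma> = 0"
proof -
  have "\<sigma> \<noteq> exchange_prod a k" for a
    using exchange_prod_separates[OF assms(5,6,4), of a] cycle_list_invariant[OF assms(1) _ assms(2,3)] by metis
  then show ?thesis by (simp add: prefix_count_def)
qed

lemma cycle_list_rotate: "cycle_list \<sigma> c \<Longrightarrow> cycle_list \<sigma> (rotate i c)"
proof (induction i)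
  case (Suc i)
  then show ?case by (simp add: cycle_list_def rotate1_map[symmetric])
qed simp

lemma cycle_list_rotate_append: "cycle_list \<sigma> (u @ v) \<Longrightarrow> cycle_list \<sigma> (v @ u)"
  using cycle_list_rotate[of \<sigma> "u @ v" "length u"] by (simp add: rotate_append)

text \<open>
  Composition with \<open>(z a)\<close> exchanges the two elements that are sent to \<open>z\<close> and to \<open>a\<close>.
\<close>
lemma cycle_list_split:
  assumes "cycle_list \<sigma> (z # v @ a # u)"
  shows "cycle_list (transpose z a \<circ> \<sigma>) (z # v)" "cycle_list (transpose z a \<circ> \<sigma>) (a # u)"
proof -
  have d: "distinct (z # v @ a # u)" and m: "map \<sigma> (z # v) @ map \<sigma> (a # u) = (v @ [a]) @ u @ [z]"
    using assms by (auto simp: cycle_list_def)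
  have "map \<sigma> (z # v) = v @ [a] \<and> map \<sigma> (a # u) = u @ [z]"
    using m by (subst (asm) append_eq_append_conv) simp_all
  then have m1: "map \<sigma> (z # v) = v @ [a]" and m2: "map \<sigma> (a # u) = u @ [z]" by blast+
  have v: "map (transpose z a) v = v" "map (transpose z a) u = u"
    using d by (auto intro!: map_idI transpose_apply_other)
  have "map (transpose z a \<circ> \<sigma>) (z # v) = v @ [z]" "map (transpose z a \<circ> \<sigma>) (a # u) = u @ [a]"
    unfolding map_map[symmetric] m1 m2 using v by simp_all
  then show "cycle_list (transpose z a \<circ> \<sigma>) (z # v)" "cycle_list (transpose z a \<circ> \<sigma>) (a # u)"
    using d by (simp_all add: cycle_list_def)
qed

lemma cycle_list_merge:
  assumes "cycle_list \<sigma> (z # v)" "cycle_list \<sigma> (a # u)" "set (z # v) \<inter> set (a # u) = {}"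
  shows "cycle_list (transpose z a \<circ> \<sigma>) (z # v @ a # u)"
proof -
  have m: "map \<sigma> (z # v) = v @ [z]" "map \<sigma> (a # u) = u @ [a]" and d: "distinct (z # v @ a # u)"
    using assms by (auto simp: cycle_list_def)
  have v: "map (transpose z a) v = v" "map (transpose z a) u = u"
    using d by (auto intro!: map_idI transpose_apply_other)
  have "map (transpose z a \<circ> \<sigma>) (z # v) = v @ [a]" "map (transpose z a \<circ> \<sigma>) (a # u) = u @ [z]"
    unfolding map_map[symmetric] m using v by simp_all
  then have "map (transpose z a \<circ> \<sigma>) ((z # v) @ (a # u)) = v @ (a # u) @ [z]"
    unfolding map_append by simp
  then show ?thesis using d by (simp add: cycle_list_def)
qed

lemma cycle_list_transpose_other:
  assumes "cycle_list \<sigma> c" "z \<notin> set c" "a \<notin> set c"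
  shows "cycle_list (transpose z a \<circ> \<sigma>) c"
proof -
  have "map (transpose z a) (rotate1 c) = rotate1 c"
    using assms(2,3) by (intro map_idI transpose_apply_other) auto
  then show ?thesis using assms(1) unfolding cycle_list_def map_map[symmetric] by simp
qed

definition cycle_partition :: "'a set \<Rightarrow> ('a \<Rightarrow> 'a) \<Rightarrow> 'a list set \<Rightarrow> bool" where
  "cycle_partition I \<sigma> C \<longleftrightarrow> finite C \<and> (\<forall>c\<in>C. cycle_list \<sigma> c) \<and>
     (\<forall>c\<in>C. \<forall>d\<in>C. c \<noteq> d \<longrightarrow> set c \<inter> set d = {}) \<and> \<Union>(set ` C) = I \<and> (\<forall>x. x \<notin> I \<longrightarrow> \<sigma> x = x)"

lemma cycle_partition_replace:
  assumes F: "cycle_partition {1..n} \<sigma> F" and P: "P \<subseteq> F" and N: "finite N" "\<And>c. c \<in> N \<Longrightarrow> cycle_list (transpose z a \<circ> \<sigma>) c"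
    "\<And>c d. c \<in> N \<Longrightarrow> d \<in> N \<Longrightarrow> c \<noteq> d \<Longrightarrow> set c \<inter> set d = {}" "\<Union>(set ` N) = \<Union>(set ` P)"
    and za: "z \<in> \<Union>(set ` P)" "a \<in> \<Union>(set ` P)"
  shows "cycle_partition {1..n} (transpose z a \<circ> \<sigma>) (F - P \<union> N)"
proof -
  have fin: "finite F" and cl: "\<And>c. c \<in> F \<Longrightarrow> cycle_list \<sigma> c"
    and dj: "\<And>c d. c \<in> F \<Longrightarrow> d \<in> F \<Longrightarrow> c \<noteq> d \<Longrightarrow> set c \<inter> set d = {}"
    and un: "\<Union>(set ` F) = {1..n}" and out: "\<And>x. x \<notin> {1..n} \<Longrightarrow> \<sigma> x = x"
    using F by (simp_all add: cycle_partition_def)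
  have sub: "set c \<subseteq> \<Union>(set ` P)" if "c \<in> N" for c using N(4) that by auto
  have disj: "set c \<inter> \<Union>(set ` P) = {}" if "c \<in> F - P" for c
  proof -
    have "set c \<inter> set d = {}" if "d \<in> P" for d
      using dj[of c d] \<open>c \<in> F - P\<close> that P by auto
    then show ?thesis by auto
  qed
  have 1: "cycle_list (transpose z a \<circ> \<sigma>) c" if "c \<in> F - P \<union> N" for c
  proof (cases "c \<in> N")
    case False
    then have c: "c \<in> F - P" using that by simp
    then show ?thesis using disj[OF c] za cl[of c] by (intro cycle_list_transpose_other) auto
  qed (rule N(2))
  have 2: "set c \<inter> set d = {}" if cd: "c \<in> F - P \<union> N" "d \<in> F - P \<union> N" "c \<noteq> d" for c d
  proof (cases "c \<in> N"; cases "d \<in> N")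
    assume "c \<in> N" "d \<in> N"
    then show ?thesis using N(3) cd(3) by simp
  next
    assume "c \<in> N" "d \<notin> N"
    then have "d \<in> F - P" using cd by simp
    then show ?thesis using sub[OF \<open>c \<in> N\<close>] disj[of d] by fast
  next
    assume "c \<notin> N" "d \<in> N"
    then have "c \<in> F - P" using cd by simp
    then show ?thesis using sub[OF \<open>d \<in> N\<close>] disj[of c] by fast
  next
    assume "c \<notin> N" "d \<notin> N"
    then show ?thesis using dj[of c d] cd by simp
  qed
  have "\<Union>(set ` (F - P \<union> N)) = \<Union>(set ` (F - P)) \<union> \<Union>(set ` P)"
    unfolding image_Un Union_Un_distrib N(4) ..
  also have "\<dots> = \<Union>(set ` F)" using P by auto
  finally have 3: "\<Union>(set ` (F - P \<union> N)) = {1..n}" using un by simp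
  have "z \<in> {1..n}" "a \<in> {1..n}" using za P unfolding un[symmetric] by auto
  then have 4: "(transpose z a \<circ> \<sigma>) x = x" if "x \<notin> {1..n}" for x
    using out[OF that] that by (auto simp: transpose_def)
  have "finite (F - P \<union> N)" using fin N(1) by simp
  with 1 2 3 4 show ?thesis unfolding cycle_partition_def by simp
qed

lemma matching_sum_add_0: "matching_sum (add_mset 0 M) = matching_sum M"
  by (simp add: matching_sum_add_mset)

lemma catalan_sum_sum_mset: "catalan_sum (\<lambda>i. \<Sum>l\<in>#M. f i l) n = (\<Sum>l\<in>#M. catalan_sum (\<lambda>i. f i l) n)"
  by (induction M) (simp_all add: catalan_sum_add, simp add: catalan_sum_def)

text \<open>
  For a part of length \<open>m + 1\<close>, the decomposition by the length \<open>i\<close> of the piece that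
  stays unrooted after the first cut, with \<open>i = 0\<close> if no such piece remains, and by the
  cycle merged with it otherwise.
\<close>
lemma matching_sum_add_Suc:
  "matching_sum (add_mset (Suc m) M) = catalan_sum (\<lambda>i. matching_sum (add_mset i M)) m
     + (\<Sum>l\<in>#M. merge_bound l m * matching_sum (M - {#l#}))"
proof -
  have "catalan_sum (\<lambda>i. matching_sum (add_mset i M)) m = catalan_sum catalan m * matching_sum M
      + (\<Sum>l\<in>#M. catalan_sum (\<lambda>i. pair_bound i l) m * matching_sum (M - {#l#}))"
    unfolding matching_sum_add_mset catalan_sum_add catalan_sum_mult catalan_sum_sum_mset ..
  then show ?thesis
    by (simp add: matching_sum_add_mset pair_bound_rec catalan_sum_catalan distrib_right sum_mset.distrib
        del: pair_bound.simps)
qed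

text \<open>
  The cycles of \<open>\<sigma>\<close> while the factors up to \<open>k\<close> are still present: those in \<open>R\<close>
  contain exactly one root, which is their head, and those in \<open>C\<close> contain none.
\<close>
definition cycle_state :: "nat \<Rightarrow> nat \<Rightarrow> (nat \<Rightarrow> nat) \<Rightarrow> nat list set \<Rightarrow> nat list set \<Rightarrow> bool" where
  "cycle_state n k \<sigma> R C \<longleftrightarrow> cycle_partition {1..n} \<sigma> (R \<union> C) \<and>
     (\<forall>c\<in>R. k < hd c \<and> set (tl c) \<subseteq> {..k}) \<and> (\<forall>c\<in>C. set c \<subseteq> {..k})"

lemma cycle_stateD:
  assumes "cycle_state n k \<sigma> R C"
  shows "finite R" "finite C" "c \<in> R \<union> C \<Longrightarrow> cycle_list \<sigma> c" "c \<in> R \<union> C \<Longrightarrow> distinct c" "c \<in> R \<union> C \<Longrightarrow> c \<noteq> []"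
    "c \<in> R \<union> C \<Longrightarrow> d \<in> R \<union> C \<Longrightarrow> c \<noteq> d \<Longrightarrow> set c \<inter> set d = {}" "\<Union>(set ` (R \<union> C)) = {1..n}"
    "c \<in> R \<Longrightarrow> k < hd c" "c \<in> R \<Longrightarrow> set (tl c) \<subseteq> {..k}" "c \<in> C \<Longrightarrow> set c \<subseteq> {..k}" "R \<inter> C = {}"
proof -
  have F: "cycle_partition {1..n} \<sigma> (R \<union> C)" and R: "\<And>c. c \<in> R \<Longrightarrow> k < hd c \<and> set (tl c) \<subseteq> {..k}"
    and C: "\<And>c. c \<in> C \<Longrightarrow> set c \<subseteq> {..k}"
    using assms by (auto simp: cycle_state_def)
  show "finite R" "finite C" "c \<in> R \<union> C \<Longrightarrow> cycle_list \<sigma> c" "\<Union>(set ` (R \<union> C)) = {1..n}"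
    "c \<in> R \<union> C \<Longrightarrow> d \<in> R \<union> C \<Longrightarrow> c \<noteq> d \<Longrightarrow> set c \<inter> set d = {}"
    using F by (simp_all add: cycle_partition_def)
  show ne: "c \<in> R \<union> C \<Longrightarrow> distinct c" "c \<in> R \<union> C \<Longrightarrow> c \<noteq> []" for c
    using F by (simp_all add: cycle_partition_def cycle_list_def)
  show "c \<in> R \<Longrightarrow> k < hd c" "c \<in> R \<Longrightarrow> set (tl c) \<subseteq> {..k}" "c \<in> C \<Longrightarrow> set c \<subseteq> {..k}"
    using R C by simp_all
  have "c \<notin> C" if "c \<in> R" for c
  proof
    assume "c \<in> C"
    then have "hd c \<le> k" using C[of c] hd_in_set[OF ne(2)[of c]] that by auto
    then show False using R[OF that] by simp
  qed
  then show "R \<inter> C = {}" by blast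
qed

lemma cycle_state_replace:
  assumes st: "cycle_state n (Suc k) \<sigma> R C" and P: "P \<subseteq> R \<union> C" and N: "finite (NR \<union> NC)"
    "\<And>c. c \<in> NR \<union> NC \<Longrightarrow> cycle_list (transpose (Suc k) a \<circ> \<sigma>) c"
    "\<And>c d. c \<in> NR \<union> NC \<Longrightarrow> d \<in> NR \<union> NC \<Longrightarrow> c \<noteq> d \<Longrightarrow> set c \<inter> set d = {}"
    "\<Union>(set ` (NR \<union> NC)) = \<Union>(set ` P)"
    and z: "Suc k \<in> \<Union>(set ` P)" and a: "a \<in> \<Union>(set ` P)"
    and NR: "\<And>c. c \<in> NR \<Longrightarrow> k < hd c \<and> set (tl c) \<subseteq> {..k}" and NC: "\<And>c. c \<in> NC \<Longrightarrow> set c \<subseteq> {..k}"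
  shows "cycle_state n k (transpose (Suc k) a \<circ> \<sigma>) (R - P \<union> NR) (C - P \<union> NC)"
proof -
  note D = cycle_stateD[OF st]
  have "cycle_partition {1..n} (transpose (Suc k) a \<circ> \<sigma>) ((R \<union> C) - P \<union> (NR \<union> NC))"
    by (rule cycle_partition_replace) (use st P N z a in \<open>auto simp: cycle_state_def\<close>)
  moreover have "(R \<union> C) - P \<union> (NR \<union> NC) = (R - P \<union> NR) \<union> (C - P \<union> NC)" by blast
  moreover have nz: "Suc k \<notin> set c" if c: "c \<in> R \<union> C" "c \<notin> P" for c
  proof
    assume "Suc k \<in> set c"
    moreover obtain d where "d \<in> P" "Suc k \<in> set d" using z by auto
    ultimately show False using D(6)[of c d] c P by auto
  qed
  moreover have "k < hd c \<and> set (tl c) \<subseteq> {..k}" if "c \<in> R - P \<union> NR" for c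
  proof (cases "c \<in> NR")
    case False
    then have c: "c \<in> R" "c \<notin> P" using that by auto
    have "Suc k \<notin> set (tl c)" using nz[of c] c D(5)[of c] list.set_sel(2)[of c "Suc k"] by auto
    then show ?thesis using D(8)[OF c(1)] D(9)[OF c(1)] by (auto simp: le_Suc_eq)
  qed (rule NR)
  moreover have "set c \<subseteq> {..k}" if "c \<in> C - P \<union> NC" for c
  proof (cases "c \<in> NC")
    case False
    then have c: "c \<in> C" "c \<notin> P" using that by auto
    then show ?thesis using D(10)[OF c(1)] nz[of c] by (auto simp: le_Suc_eq)
  qed (rule NC)
  ultimately show ?thesis unfolding cycle_state_def by simp
qed

lemma cycle_state_obtain:
  assumes "cycle_state n k \<sigma> R C" "b \<in> {1..n}"
  obtains d where "d \<in> R \<union> C" "b \<in> set d"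
  using cycle_stateD(7)[OF assms(1)] assms(2) by blast

lemma cycle_list_obtain_rotation:
  assumes "cycle_list \<sigma> d" "b \<in> set d"
  obtains u where "cycle_list \<sigma> (b # u)" "set (b # u) = set d"
proof -
  obtain s t where d: "d = s @ b # t" using assms(2) by (meson split_list)
  show ?thesis
    by (rule that[of "t @ s"]) (use cycle_list_rotate_append[of \<sigma> s "b # t"] assms(1) d in auto)
qed

text \<open>
  If \<open>k + 1\<close> lies on a cycle with root \<open>x\<close>, its factor has to separate it from \<open>x\<close>. This
  leaves the letters of \<open>q\<close> and \<open>x\<close> itself as choices for \<open>a\<^bsub>k+1\<^esub>\<close>.
\<close>
lemma rooted_step:
  assumes st: "cycle_state n (Suc k) \<sigma> R C" and c: "c \<in> R" "c = x # p @ Suc k # q"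
  shows "prefix_count n (Suc k) \<sigma> = (\<Sum>i\<le>length q. prefix_count n k (transpose (Suc k) ((q @ [x]) ! i) \<circ> \<sigma>))"
    and "i \<le> length q \<Longrightarrow> cycle_state n k (transpose (Suc k) ((q @ [x]) ! i) \<circ> \<sigma>)
           (R - {c} \<union> {Suc k # take i q, x # p @ drop i q}) C"
proof -
  let ?z = "Suc k"
  note D = cycle_stateD[OF st]
  have cc: "c \<in> R \<union> C" using c by simp
  have dist: "distinct (x # p @ ?z # q)" and cl: "cycle_list \<sigma> (x # p @ ?z # q)"
    using D(3,4)[OF cc] c(2) by simp_all
  have rot: "cycle_list \<sigma> (?z # q @ x # p)"
    using cycle_list_rotate_append[of \<sigma> "x # p" "?z # q"] cl by simp
  have x: "x > ?z" using D(8)[OF c(1)] c(2) by simp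
  have small: "set p \<union> set q \<subseteq> {..k}"
    using D(9)[OF c(1)] dist c(2) by (auto simp: le_Suc_eq)
  let ?f = "\<lambda>b. prefix_count n k (transpose ?z b \<circ> \<sigma>)"
  have zero: "?f b = 0" if b: "b \<in> {1..n}" "b \<notin> set (q @ [x])" for b
  proof -
    have zx: "?z \<noteq> x" "x > k" using x by auto
    consider "b = ?z" | "b \<in> set p" | "b \<notin> set c" using b c(2) by auto
    then show ?thesis
    proof cases
      case 1
      then show ?thesis using prefix_count_eq_0[OF cl, of x ?z k n] zx by simp
    next
      case 2
      then obtain p1 p2 where p: "p = p1 @ b # p2" by (meson split_list)
      have "cycle_list (transpose ?z b \<circ> \<sigma>) (?z # (q @ x # p1))"
        by (rule cycle_list_split(1)) (use rot p in simp)
      then show ?thesis by (rule prefix_count_eq_0[of _ _ x ?z]) (use zx in auto)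
    next
      case 3
      obtain d where d: "d \<in> R \<union> C" "b \<in> set d" using cycle_state_obtain[OF st b(1)] .
      obtain u where u: "cycle_list \<sigma> (b # u)" "set (b # u) = set d"
        using cycle_list_obtain_rotation[OF D(3)[OF d(1)] d(2)] .
      have "set c \<inter> set d = {}" using D(6)[OF cc d(1)] d 3 by auto
      then have "cycle_list (transpose ?z b \<circ> \<sigma>) (?z # (q @ x # p) @ b # u)"
        using u(2) c(2) by (intro cycle_list_merge rot u(1)) auto
      then show ?thesis by (rule prefix_count_eq_0[of _ _ x ?z]) (use zx in auto)
    qed
  qed
  have "set c \<subseteq> {1..n}" unfolding D(7)[symmetric] using cc by auto
  then have sub: "set (q @ [x]) \<subseteq> {1..n}" using c(2) by auto
  have "prefix_count n (Suc k) \<sigma> = (\<Sum>b\<in>{1..n}. ?f b)" by (rule prefix_count_Suc)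
  also have "\<dots> = (\<Sum>b\<in>set (q @ [x]). ?f b)"
    by (rule sum.mono_neutral_right) (use sub zero in auto)
  also have "\<dots> = (\<Sum>i<length (q @ [x]). ?f ((q @ [x]) ! i))"
    using dist by (intro sum.reindex_bij_betw[OF bij_betw_nth, symmetric]) auto
  finally show "prefix_count n (Suc k) \<sigma> = (\<Sum>i\<le>length q. ?f ((q @ [x]) ! i))"
    by (simp only: length_append_singleton lessThan_Suc_atMost)
  assume i: "i \<le> length q"
  define a where "a = (q @ [x]) ! i"
  obtain u where u: "drop i q @ x # p = a # u"
  proof (cases "i < length q")
    case True
    then show ?thesis using that[of "drop (Suc i) q @ x # p"] by (simp add: a_def nth_append Cons_nth_drop_Suc[symmetric])
  next
    case False
    then show ?thesis using that[of p] i by (simp add: a_def nth_append)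
  qed
  have "q @ x # p = take i q @ a # u"
    unfolding u[symmetric] append.assoc[symmetric] append_take_drop_id ..
  with rot have "cycle_list \<sigma> (?z # take i q @ a # u)" by (simp only:)
  note split = cycle_list_split[OF this]
  have "cycle_list (transpose ?z a \<circ> \<sigma>) ((x # p) @ drop i q)"
    using split(2) unfolding u[symmetric] by (rule cycle_list_rotate_append)
  then have cl': "cycle_list (transpose ?z a \<circ> \<sigma>) d" if "d \<in> {?z # take i q, x # p @ drop i q} \<union> {}" for d
    using that split(1) by auto
  have sets: "set (?z # take i q) \<inter> set (x # p @ drop i q) = {}"
    "set (?z # take i q) \<union> set (x # p @ drop i q) = set c"
    "set (take i q) \<subseteq> set q" "set (drop i q) \<subseteq> set q"
  proof -
    have un: "set (take i q) \<union> set (drop i q) = set q" by (metis append_take_drop_id set_append)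
    have "set (take i q) \<inter> set (drop i q) = {}"
      using dist set_take_disj_set_drop_if_distinct[of q i i] by auto
    then show "set (?z # take i q) \<inter> set (x # p @ drop i q) = {}"
      using dist un by auto
    show "set (?z # take i q) \<union> set (x # p @ drop i q) = set c" using un unfolding c(2) by auto
    show "set (take i q) \<subseteq> set q" "set (drop i q) \<subseteq> set q" using un by auto
  qed
  define A B where "A = ?z # take i q" and "B = x # p @ drop i q"
  have AB: "set A \<inter> set B = {}" "set A \<union> set B = set c" using sets unfolding A_def B_def by blast+
  have a: "a \<in> set c" using i c(2) nth_mem[of i "q @ [x]"] by (auto simp: a_def)
  have z: "?z \<in> set c" using c(2) by simp
  have heads: "k < hd A \<and> set (tl A) \<subseteq> {..k}" "k < hd B \<and> set (tl B) \<subseteq> {..k}"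
    using small x sets(3,4) by (auto simp: A_def B_def)
  have "cycle_state n k (transpose ?z a \<circ> \<sigma>) (R - {c} \<union> {A, B}) (C - {c} \<union> {})"
  proof (rule cycle_state_replace[OF st])
    show "{c} \<subseteq> R \<union> C" using cc by simp
    show "cycle_list (transpose ?z a \<circ> \<sigma>) d" if "d \<in> {A, B} \<union> {}" for d
      using cl'[of d] that by (simp add: A_def B_def)
    show "set d \<inter> set e = {}" if "d \<in> {A, B} \<union> {}" "e \<in> {A, B} \<union> {}" "d \<noteq> e" for d e
      using that AB(1) by (auto simp: Int_commute)
    show "\<Union> (set ` ({A, B} \<union> {})) = \<Union> (set ` {c})" using AB(2) by simp
    show "k < hd d \<and> set (tl d) \<subseteq> {..k}" if "d \<in> {A, B}" for d using that heads by blast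
  qed (use a z in simp_all)
  moreover have "C - {c} \<union> {} = C" using D(11) c(1) by auto
  ultimately show "cycle_state n k (transpose ?z ((q @ [x]) ! i) \<circ> \<sigma>)
           (R - {c} \<union> {Suc k # take i q, x # p @ drop i q}) C" by (simp add: a_def A_def B_def)
qed

text \<open>
  If \<open>k + 1\<close> lies on a cycle without root, its factor either cuts this cycle (or is trivial,
  the choice \<open>i = length b\<close>), or merges it with another cycle without root. Merging it with
  a rooted cycle would put two roots on one cycle.
\<close>
lemma free_step:
  assumes st: "cycle_state n (Suc k) \<sigma> R C" and c: "c \<in> C" "c = p @ Suc k # q" and b: "b = q @ p"
  shows "prefix_count n (Suc k) \<sigma> = (\<Sum>i\<le>length b. prefix_count n k (transpose (Suc k) ((b @ [Suc k]) ! i) \<circ> \<sigma>))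
       + (\<Sum>e\<in>C - {c}. \<Sum>i<length e. prefix_count n k (transpose (Suc k) (e ! i) \<circ> \<sigma>))"
    and "i \<le> length b \<Longrightarrow> cycle_state n k (transpose (Suc k) ((b @ [Suc k]) ! i) \<circ> \<sigma>)
           (R \<union> {Suc k # take i b}) (C - {c} \<union> ({drop i b} - {[]}))"
    and "e \<in> C - {c} \<Longrightarrow> i < length e \<Longrightarrow> cycle_state n k (transpose (Suc k) (e ! i) \<circ> \<sigma>)
           (R \<union> {Suc k # b @ rotate i e}) (C - {c} - {e})"
proof -
  let ?z = "Suc k"
  note D = cycle_stateD[OF st]
  have cc: "c \<in> R \<union> C" using c by simp
  have rot: "cycle_list \<sigma> (?z # b)"
    using cycle_list_rotate_append[of \<sigma> p "?z # q"] D(3)[OF cc] c(2) b by simp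
  then have dist: "distinct (?z # b)" by (simp add: cycle_list_def)
  have setc: "set c = set (?z # b)" using c(2) b by auto
  have small: "set b \<subseteq> {..k}" using D(10)[OF c(1)] dist setc by (auto simp: le_Suc_eq)
  have cR: "c \<notin> R" using D(11) c(1) by auto
  let ?f = "\<lambda>b. prefix_count n k (transpose ?z b \<circ> \<sigma>)"
  have zero: "?f a = 0" if d: "d \<in> R" and a: "a \<in> set d" for d a
  proof -
    obtain u where u: "cycle_list \<sigma> (a # u)" "set (a # u) = set d"
      using cycle_list_obtain_rotation[OF D(3) a] d by auto
    have "set c \<inter> set d = {}" using D(6)[OF cc, of d] d cR by auto
    then have "cycle_list (transpose ?z a \<circ> \<sigma>) (?z # b @ a # u)"
      using u(2) setc by (intro cycle_list_merge rot u(1)) auto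
    moreover have "hd d \<in> set (a # u)" "hd d > ?z" using u(2) D(5,8)[of d] d by auto
    ultimately show ?thesis by (intro prefix_count_eq_0[of _ "?z # b @ a # u" "hd d" ?z]) auto
  qed
  have nth: "(\<Sum>a\<in>set d. ?f a) = (\<Sum>i<length d. ?f (d ! i))" if "distinct d" for d
    using that by (intro sum.reindex_bij_betw[OF bij_betw_nth, symmetric]) auto
  have "prefix_count n (Suc k) \<sigma> = (\<Sum>a\<in>\<Union>(set ` (R \<union> C)). ?f a)" unfolding D(7) by (rule prefix_count_Suc)
  also have "\<dots> = (\<Sum>d\<in>R \<union> C. \<Sum>a\<in>set d. ?f a)"
    using D(1,2,6) by (intro sum.UNION_disjoint) auto
  also have "\<dots> = (\<Sum>d\<in>C. \<Sum>a\<in>set d. ?f a)"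
    using D(1,2) zero by (intro sum.mono_neutral_right) auto
  also have "\<dots> = (\<Sum>a\<in>set c. ?f a) + (\<Sum>d\<in>C - {c}. \<Sum>a\<in>set d. ?f a)"
    using D(2) c(1) by (rule sum.remove)
  also have "(\<Sum>d\<in>C - {c}. \<Sum>a\<in>set d. ?f a) = (\<Sum>d\<in>C - {c}. \<Sum>i<length d. ?f (d ! i))"
    using D(4) by (intro sum.cong refl nth) auto
  also have "set c = set (b @ [?z])" using setc by auto
  also have "(\<Sum>a\<in>set (b @ [?z]). ?f a) = (\<Sum>i<length (b @ [?z]). ?f ((b @ [?z]) ! i))"
    using dist by (intro nth) auto
  finally show "prefix_count n (Suc k) \<sigma> = (\<Sum>i\<le>length b. ?f ((b @ [?z]) ! i))
       + (\<Sum>e\<in>C - {c}. \<Sum>i<length e. ?f (e ! i))"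
    by (simp only: length_append_singleton lessThan_Suc_atMost)
  show "cycle_state n k (transpose ?z ((b @ [?z]) ! i) \<circ> \<sigma>) (R \<union> {?z # take i b}) (C - {c} \<union> ({drop i b} - {[]}))"
    if i: "i \<le> length b"
  proof -
    define a where "a = (b @ [?z]) ! i"
    have split: "cycle_list (transpose ?z a \<circ> \<sigma>) d" if "d \<in> {?z # take i b} \<union> ({drop i b} - {[]})" for d
    proof (cases "i < length b")
      case True
      then have "drop i b = a # drop (Suc i) b" by (simp add: a_def nth_append Cons_nth_drop_Suc[symmetric])
      moreover from this have "cycle_list \<sigma> (?z # take i b @ a # drop (Suc i) b)"
        using rot by (metis append_take_drop_id)
      ultimately show ?thesis using cycle_list_split[of \<sigma> ?z "take i b" a "drop (Suc i) b"] that by auto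
    next
      case False
      then show ?thesis using that rot i by (simp add: a_def nth_append)
    qed
    have disj: "set (?z # take i b) \<inter> set (drop i b) = {}"
      using dist set_take_disj_set_drop_if_distinct[of b i i] by (auto dest: in_set_dropD)
    have un: "set (take i b) \<union> set (drop i b) = set b" by (metis append_take_drop_id set_append)
    have un': "\<Union>(set ` ({?z # take i b} \<union> ({drop i b} - {[]}))) = \<Union>(set ` {c})"
      using un setc by auto
    have "a \<in> set (b @ [?z])" using i unfolding a_def by (intro nth_mem) simp
    then have "a \<in> set c" using setc by auto
    then have "cycle_state n k (transpose ?z a \<circ> \<sigma>) (R - {c} \<union> {?z # take i b}) (C - {c} \<union> ({drop i b} - {[]}))"
      using cc setc small un disj by (intro cycle_state_replace[OF st] split un') auto
    moreover have "R - {c} = R" using cR by simp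
    ultimately show ?thesis by (simp add: a_def)
  qed
  show "cycle_state n k (transpose ?z (e ! i) \<circ> \<sigma>) (R \<union> {?z # b @ rotate i e}) (C - {c} - {e})"
    if e: "e \<in> C - {c}" and i: "i < length e"
  proof -
    have ec: "e \<in> R \<union> C" "e \<noteq> c" using e by auto
    have "rotate i e = e ! i # drop (Suc i) e @ take i e"
      using i by (simp add: rotate_drop_take Cons_nth_drop_Suc[symmetric])
    moreover have "cycle_list \<sigma> (rotate i e)" by (rule cycle_list_rotate[OF D(3)[OF ec(1)]])
    moreover have disj: "set c \<inter> set e = {}" using D(6)[OF cc ec(1)] ec(2) by simp
    ultimately have cl: "cycle_list (transpose ?z (e ! i) \<circ> \<sigma>) (?z # b @ rotate i e)"
      using rot setc by (metis cycle_list_merge set_rotate)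
    have eR: "R - {c, e} = R" using D(11) c(1) e by auto
    have "set e \<subseteq> {..k}" using D(10)[of e] disj setc e by (auto simp: le_Suc_eq)
    then have "cycle_state n k (transpose ?z (e ! i) \<circ> \<sigma>) (R - {c, e} \<union> {?z # b @ rotate i e}) (C - {c, e} \<union> {})"
      using cc ec setc small i cl by (intro cycle_state_replace[OF st]) auto
    moreover have "C - {c, e} \<union> {} = C - {c} - {e}" by auto
    ultimately show ?thesis unfolding eR by simp
  qed
qed

section \<open>Multiplicity is bounded by the cycle type\<close>

definition rooted_weight :: "nat list set \<Rightarrow> nat" where
  "rooted_weight R = (\<Prod>c\<in>R. rooted_count (tl c))"

definition cycle_type :: "'a list set \<Rightarrow> nat multiset" where
  "cycle_type C = image_mset length (mset_set C)"

text \<open>One of the two cycles lies entirely above the other.\<close>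
definition apart :: "nat list \<Rightarrow> nat list \<Rightarrow> bool" where
  "apart c d \<longleftrightarrow> (\<forall>x\<in>set c. \<forall>y\<in>set d. y < x) \<or> (\<forall>x\<in>set c. \<forall>y\<in>set d. x < y)"

definition separated :: "nat list set \<Rightarrow> bool" where
  "separated C \<longleftrightarrow> (\<forall>c\<in>C. decreasing c) \<and> (\<forall>c\<in>C. \<forall>d\<in>C. c \<noteq> d \<longrightarrow> apart c d)"

lemma apart_sym: "apart c d \<Longrightarrow> apart d c"
  unfolding apart_def by blast

lemma apart_subset: "apart c d \<Longrightarrow> set w \<subseteq> set c \<Longrightarrow> apart w d"
  unfolding apart_def by blast

lemma separated_replace:
  assumes "separated C" "c \<in> C" "decreasing w" "set w \<subseteq> set c"
  shows "separated (C - {c} \<union> ({w} - {[]}))"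
proof -
  have w: "apart w d" if "d \<in> C - {c}" for d
  proof (rule apart_subset)
    show "apart c d" using assms(1,2) that by (auto simp: separated_def)
  qed fact
  have "apart d e" if de: "d \<in> insert w (C - {c})" "e \<in> insert w (C - {c})" "d \<noteq> e" for d e
  proof (cases "d = w \<or> e = w")
    case True
    then show ?thesis using w[of d] w[of e] de apart_sym by auto
  next
    case False
    then show ?thesis using assms(1) de by (auto simp: separated_def)
  qed
  then show ?thesis using assms(1,3) by (auto simp: separated_def)
qed

lemma cycle_type_insert: "finite C \<Longrightarrow> c \<notin> C \<Longrightarrow> cycle_type (insert c C) = add_mset (length c) (cycle_type C)"
  by (simp add: cycle_type_def)

lemma cycle_type_remove: "finite C \<Longrightarrow> c \<in> C \<Longrightarrow> cycle_type C = add_mset (length c) (cycle_type (C - {c}))"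
  using cycle_type_insert[of "C - {c}" c] by (simp add: insert_absorb)

text \<open>The recursion of \<open>free_step\<close> with every count replaced by its bound.\<close>
lemma matching_sum_cycle_type:
  assumes "finite C"
  shows "matching_sum (add_mset (Suc m) (cycle_type C)) =
     (\<Sum>i\<le>m. catalan i * matching_sum (add_mset (m - i) (cycle_type C)))
     + (\<Sum>e\<in>C. merge_bound (length e) m * matching_sum (cycle_type (C - {e})))"
proof -
  have "(\<Sum>l\<in>#cycle_type C. merge_bound l m * matching_sum (cycle_type C - {#l#}))
      = (\<Sum>e\<in>C. merge_bound (length e) m * matching_sum (cycle_type C - {#length e#}))"
    by (simp add: cycle_type_def sum_unfold_sum_mset image_mset.compositionality comp_def)
  also have "\<dots> = (\<Sum>e\<in>C. merge_bound (length e) m * matching_sum (cycle_type (C - {e})))"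
    using assms by (intro sum.cong refl) (simp add: cycle_type_remove)
  finally show ?thesis unfolding matching_sum_add_Suc catalan_sum_def by simp
qed

lemma decreasing_max_head: "decreasing (p @ z # q) \<Longrightarrow> set p \<subseteq> {..z} \<Longrightarrow> p = []"
  by (cases p) auto

abbreviation count_bound :: "nat \<Rightarrow> nat \<Rightarrow> (nat \<Rightarrow> nat) \<Rightarrow> nat list set \<Rightarrow> nat list set \<Rightarrow> bool" where
  "count_bound n k \<sigma> R C \<equiv> prefix_count n k \<sigma> \<le> rooted_weight R * matching_sum (cycle_type C) \<and>
     (separated C \<longrightarrow> prefix_count n k \<sigma> = rooted_weight R * matching_sum (cycle_type C))"

text \<open>
  The sum in \<open>free_step\<close> for a cycle that consists of the largest element and \<open>b\<close>, with
  every count estimated as in \<open>count_bound\<close>; \<open>D\<close> contains the other cycles without root.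
\<close>
abbreviation top_step_sum :: "nat list \<Rightarrow> nat list set \<Rightarrow> nat" where
  "top_step_sum b D \<equiv>
     (\<Sum>i\<le>length b. rooted_count (take i b) * matching_sum (add_mset (length b - i) (cycle_type D)))
     + (\<Sum>e\<in>D. merge_count b e * matching_sum (cycle_type (D - {e})))"

lemma free_step_le:
  assumes IH_all: "\<forall>\<sigma> R C. cycle_state n k \<sigma> R C \<longrightarrow>
      count_bound n k \<sigma> R C"
    and st: "cycle_state n (Suc k) \<sigma> R C" and c: "c \<in> C" "c = p @ Suc k # q" and b: "b = q @ p"
  shows "prefix_count n (Suc k) \<sigma> \<le> rooted_weight R *
      top_step_sum b (C - {c})"
    and "separated C \<Longrightarrow> prefix_count n (Suc k) \<sigma> = rooted_weight R *
      top_step_sum b (C - {c})"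
proof -
  let ?z = "Suc k"
  note IH = IH_all[rule_format]
  note D = cycle_stateD[OF st]
  note step = free_step[OF st c b]
  have setc: "set c = insert ?z (set b)" using c(2) b by auto
  have zR: "?z \<notin> set d" if "d \<in> R" for d
    using D(6)[of c d] D(11) c(1) that setc by auto
  let ?cut = "\<lambda>i. prefix_count n k (transpose ?z ((b @ [?z]) ! i) \<circ> \<sigma>)"
  let ?cut' = "\<lambda>i. rooted_weight R * (rooted_count (take i b) * matching_sum (add_mset (length b - i) (cycle_type (C - {c}))))"
  let ?merge = "\<lambda>e i. prefix_count n k (transpose ?z (e ! i) \<circ> \<sigma>)"
  let ?merge' = "\<lambda>e i. rooted_weight R * (rooted_count (b @ rotate i e) * matching_sum (cycle_type (C - {c} - {e})))"
  have weight: "rooted_weight (R \<union> {?z # v}) = rooted_weight R * rooted_count v" for v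
  proof -
    have "?z # v \<notin> R" using zR[of "?z # v"] by auto
    then show ?thesis using D(1) by (simp add: rooted_weight_def mult.commute)
  qed
  have type: "matching_sum (cycle_type (C - {c} \<union> ({drop i b} - {[]}))) = matching_sum (add_mset (length b - i) (cycle_type (C - {c})))"
    if i: "i \<le> length b" for i
  proof (cases "drop i b = []")
    case True
    then show ?thesis by (simp add: matching_sum_add_0)
  next
    case False
    have sub: "set (drop i b) \<subseteq> set c" "set (drop i b) \<noteq> {}" using setc False set_drop_subset[of i b] by auto
    have "drop i b \<notin> C - {c}"
    proof
      assume "drop i b \<in> C - {c}"
      then have "set c \<inter> set (drop i b) = {}" using c(1) by (intro D(6)) auto
      then show False using sub by (simp only: Int_absorb1)
    qed
    then have "cycle_type (insert (drop i b) (C - {c})) = add_mset (length b - i) (cycle_type (C - {c}))"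
      using D(2) by (simp add: cycle_type_insert)
    then show ?thesis using False by simp
  qed
  let ?S = "(\<Sum>i\<le>length b. ?cut' i)
      + (\<Sum>e\<in>C - {c}. \<Sum>i<length e. ?merge' e i)"
  have S: "?S = rooted_weight R *
      top_step_sum b (C - {c})"
    by (simp add: distrib_left sum_distrib_left sum_distrib_right merge_count_def)
  have 1: "?cut i \<le> ?cut' i"
    "separated C \<Longrightarrow> ?cut i = ?cut' i"
    if i: "i \<le> length b" for i
  proof -
    note IH' = IH[OF step(2)[OF i], unfolded type[OF i] weight mult.assoc]
    show "?cut i \<le> ?cut' i"
      using IH' by blast
    assume sep: "separated C"
    have dec: "decreasing (p @ ?z # q)" and "set p \<subseteq> {..?z}"
      using sep c D(10)[OF c(1)] by (auto simp: separated_def)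
    then have "p = []" by (rule decreasing_max_head)
    then have "decreasing (drop i b)" using dec b by (simp add: sorted_wrt_drop)
    moreover have "set (drop i b) \<subseteq> set c" using setc set_drop_subset[of i b] by auto
    ultimately have "separated (C - {c} \<union> ({drop i b} - {[]}))"
      by (rule separated_replace[OF sep c(1)])
    then show "?cut i = ?cut' i"
      using IH' by blast
  qed
  have 2: "?merge e i \<le> ?merge' e i"
    "separated C \<Longrightarrow> ?merge e i = ?merge' e i"
    if e: "e \<in> C - {c}" and i: "i < length e" for e i
  proof -
    note IH' = IH[OF step(3)[OF e i], unfolded weight mult.assoc]
    show "?merge e i \<le> ?merge' e i"
      using IH' by blast
    assume "separated C"
    then have "separated (C - {c} - {e})" by (simp add: separated_def)
    then show "?merge e i = ?merge' e i"
      using IH' by blast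
  qed
  have "prefix_count n (Suc k) \<sigma> \<le> ?S"
    unfolding step(1) by (intro add_mono sum_mono 1 2) auto
  then show "prefix_count n (Suc k) \<sigma> \<le> rooted_weight R *
      top_step_sum b (C - {c})"
    unfolding S .
  assume sep: "separated C"
  have "prefix_count n (Suc k) \<sigma> = ?S"
    unfolding step(1) by (intro arg_cong2[of _ _ _ _ "(+)"] sum.cong refl 1(2) 2(2) sep) auto
  then show "prefix_count n (Suc k) \<sigma> = rooted_weight R *
      top_step_sum b (C - {c})"
    unfolding S .
qed

lemma rooted_step_le:
  assumes IH_all: "\<forall>\<sigma> R C. cycle_state n k \<sigma> R C \<longrightarrow>
      count_bound n k \<sigma> R C"
    and st: "cycle_state n (Suc k) \<sigma> R C" and c: "c \<in> R" "c = x # p @ Suc k # q"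
  shows "count_bound n (Suc k) \<sigma> R C"
proof -
  let ?z = "Suc k"
  note IH = IH_all[rule_format]
  note D = cycle_stateD[OF st]
  note step = rooted_step[OF st c]
  have dist: "distinct (x # p @ ?z # q)" using D(4)[of c] c by simp
  let ?w = "\<lambda>i. rooted_weight (R - {c}) * (rooted_count (take i q) * rooted_count (p @ drop i q)) * matching_sum (cycle_type C)"
  have weight: "rooted_weight (R - {c} \<union> {?z # take i q, x # p @ drop i q})
      = rooted_weight (R - {c}) * (rooted_count (take i q) * rooted_count (p @ drop i q))" for i
  proof -
    have notin: "d \<notin> R - {c}" if "y \<in> set c" "y \<in> set d" for y d
      using D(6)[of c d] c(1) that by auto
    have "?z # take i q \<notin> R - {c}" by (rule notin[of ?z]) (simp_all add: c(2))
    moreover have "x # p @ drop i q \<notin> R - {c}" by (rule notin[of x]) (simp_all add: c(2))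
    moreover have "?z # take i q \<noteq> x # p @ drop i q" using dist by auto
    ultimately show ?thesis using D(1) by (simp add: rooted_weight_def mult_ac)
  qed
  have "rooted_count (p @ ?z # q) = split_sum (\<lambda>u v. rooted_count u * rooted_count (p @ v)) q"
  proof (rule rooted_count_max)
    have "set p \<union> set q \<subseteq> {..k}" using D(9)[OF c(1)] dist c(2) by (auto simp: le_Suc_eq)
    then show "y < ?z" if "y \<in> set p \<union> set q" for y using that by auto
  qed
  moreover have "rooted_weight R = rooted_weight (R - {c}) * rooted_count (p @ ?z # q)"
    using prod.remove[of R c "\<lambda>c. rooted_count (tl c)"] D(1) c by (simp add: rooted_weight_def mult.commute)
  ultimately have total: "rooted_weight R * matching_sum (cycle_type C) = (\<Sum>i\<le>length q. ?w i)"
    by (simp add: split_sum_def sum_distrib_left sum_distrib_right)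
  have le: "prefix_count n k (transpose ?z ((q @ [x]) ! i) \<circ> \<sigma>) \<le> ?w i"
    "separated C \<Longrightarrow> prefix_count n k (transpose ?z ((q @ [x]) ! i) \<circ> \<sigma>) = ?w i" if "i \<le> length q" for i
    using IH[OF step(2)[OF that]] unfolding weight by blast+
  show ?thesis
    unfolding step(1) total using le by (auto intro: sum_mono sum.cong)
qed

text \<open>
  The main estimate. All bounds for the single contributions are attained together if the
  cycles are decreasing and separated, since cutting and merging as in \<open>free_step\<close> preserve
  this.
\<close>
lemma prefix_count_bound:
  assumes "k \<le> n" "cycle_state n k \<sigma> R C"
  shows "count_bound n k \<sigma> R C"
  using assms
proof (induction k arbitrary: \<sigma> R C)
  case 0
  note D = cycle_stateD[OF 0(2)]
  have sub: "set c \<subseteq> {1..n}" if "c \<in> R \<union> C" for c unfolding D(7)[symmetric] using that by auto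
  have "C = {}"
  proof (rule ccontr)
    assume "C \<noteq> {}"
    then obtain c where c: "c \<in> C" by auto
    then show False using D(10)[OF c] sub[of c] D(5)[of c] by (cases c) auto
  qed
  have tl: "tl c = []" if c: "c \<in> R" for c
  proof (rule ccontr)
    assume "tl c \<noteq> []"
    then obtain y where "y \<in> set (tl c)" by (cases "tl c") auto
    then show False using D(9)[OF c] sub[of c] c list.set_sel(2)[of c y] D(5)[of c] by auto
  qed
  then have w: "rooted_weight R = 1" by (simp add: rooted_weight_def)
  have "\<sigma> x = x" for x
  proof (cases "x \<in> {1..n}")
    case True
    then obtain c where c: "c \<in> R" "x \<in> set c" using cycle_state_obtain[OF 0(2)] \<open>C = {}\<close> by blast
    then have "c = [x]" using tl[OF c(1)] by (cases c) auto
    then show ?thesis using D(3)[of c] c(1) by (simp add: cycle_list_def)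
  next
    case False
    then show ?thesis using 0(2) unfolding cycle_state_def cycle_partition_def by blast
  qed
  then have "\<sigma> = id" by auto
  then have "prefix_count n 0 \<sigma> = 1" by (simp only: prefix_count_0 simp_thms if_True)
  then show ?case using w \<open>C = {}\<close> by (simp add: cycle_type_def)
next
  case (Suc k)
  note st = Suc.prems(2)
  note D = cycle_stateD[OF st]
  have IH: "\<forall>\<sigma> R C. cycle_state n k \<sigma> R C \<longrightarrow>
      count_bound n k \<sigma> R C"
    using Suc.prems(1) by (intro allI impI Suc.IH) simp_all
  obtain c where c: "c \<in> R \<union> C" "Suc k \<in> set c"
    using cycle_state_obtain[OF st, of "Suc k"] Suc.prems(1) by auto
  show ?case
  proof (cases "c \<in> R")
    case True
    then obtain x t where xt: "c = x # t" using D(5)[OF c(1)] by (cases c) auto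
    then have "Suc k \<in> set t" using D(8)[OF True] c(2) by auto
    then obtain p q where "t = p @ Suc k # q" by (meson split_list)
    then show ?thesis using rooted_step_le[OF IH st True] xt by blast
  next
    case False
    then have cC: "c \<in> C" using c(1) by simp
    obtain p q where pq: "c = p @ Suc k # q" using c(2) by (meson split_list)
    define b where "b = q @ p"
    let ?M = "cycle_type (C - {c})"
    note le = free_step_le[OF IH st cC pq b_def]
    have len: "length c = Suc (length b)" by (simp add: pq b_def)
    have type: "matching_sum (cycle_type C) = (\<Sum>i\<le>length b. catalan i * matching_sum (add_mset (length b - i) ?M))
       + (\<Sum>e\<in>C - {c}. merge_bound (length e) (length b) * matching_sum (cycle_type (C - {c} - {e})))"
      unfolding cycle_type_remove[OF D(2) cC] len by (rule matching_sum_cycle_type) (use D(2) in auto)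
    have dist: "distinct b" "distinct (b @ e)" "e \<noteq> []" if "e \<in> C - {c}" for e
      using D(4)[of c] D(4,5)[of e] D(6)[of c e] that cC by (auto simp: pq b_def)
    have dist_b: "distinct b" using D(4)[OF c(1)] by (auto simp: pq b_def)
    have cat: "rooted_count (take i b) \<le> catalan i" if "i \<le> length b" for i
      using rooted_count_le_catalan(1)[of "take i b"] dist_b that by simp
    have "top_step_sum b (C - {c}) \<le> matching_sum (cycle_type C)"
      unfolding type by (intro add_mono sum_mono mult_right_mono cat merge_count_le(1) dist(2,3)) auto
    then have "prefix_count n (Suc k) \<sigma> \<le> rooted_weight R * matching_sum (cycle_type C)"
      using le(1) by (meson le_trans mult_le_mono2)
    moreover have "prefix_count n (Suc k) \<sigma> = rooted_weight R * matching_sum (cycle_type C)" if sep: "separated C"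
    proof -
      have decc: "decreasing (p @ Suc k # q)" and "set p \<subseteq> {..Suc k}"
        using sep cC pq D(10)[OF cC] by (auto simp: separated_def)
      then have "p = []" by (rule decreasing_max_head)
      then have cb: "c = Suc k # b" using pq b_def by simp
      have decb: "decreasing b" using decc \<open>p = []\<close> b_def by simp
      have "rooted_count (take i b) = catalan i" if "i \<le> length b" for i
        using rooted_count_decreasing[of "take i b"] decb that by (simp add: sorted_wrt_take)
      moreover have "merge_count b e = merge_bound (length e) (length b)" if e: "e \<in> C - {c}" for e
      proof (rule merge_count_decreasing)
        have "decreasing e" using sep e by (simp add: separated_def)
        moreover have "\<forall>x\<in>set c. \<forall>y\<in>set e. y < x"
        proof -
          have "(\<forall>x\<in>set c. \<forall>y\<in>set e. y < x) \<or> (\<forall>x\<in>set c. \<forall>y\<in>set e. x < y)"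
            using sep e cC unfolding separated_def apart_def by blast
          moreover have "\<not> (\<forall>x\<in>set c. \<forall>y\<in>set e. x < y)"
          proof
            assume "\<forall>x\<in>set c. \<forall>y\<in>set e. x < y"
            moreover have "hd e \<in> set e" using dist(3)[OF e] by simp
            moreover from this have "hd e \<le> Suc k" using D(10)[of e] e by blast
            ultimately show False using cb by auto
          qed
          ultimately show ?thesis by blast
        qed
        ultimately show "decreasing (b @ e)" using decb cb by (simp add: sorted_wrt_append)
      qed
      ultimately have "top_step_sum b (C - {c}) = matching_sum (cycle_type C)"
        unfolding type by simp
      then show ?thesis using le(2)[OF sep] by simp
    qed
    ultimately show ?thesis by blast
  qed
qed

section \<open>Extremal permutations\<close>

lemma cycle_of_list_map: "distinct c \<Longrightarrow> map (cycle_of_list c) c = rotate1 c"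
  using cyclic_rotation[of c 1] by simp

lemma cycle_list_eq_cycle_of_list:
  assumes "cycle_list \<sigma> c" "x \<in> set c"
  shows "\<sigma> x = cycle_of_list c x"
proof -
  have "map \<sigma> c = map (cycle_of_list c) c" using assms(1) by (simp add: cycle_list_def cycle_of_list_map)
  then show ?thesis using assms(2) by simp
qed

lemma cycle_partition_compose:
  assumes P: "cycle_partition I \<sigma> C" and cs: "distinct cs" "set cs \<inter> I = {}"
  shows "cycle_partition (set cs \<union> I) (cycle_of_list cs \<circ> \<sigma>) (C \<union> ({cs} - {[]}))"
proof -
  have fin: "finite C" and cl: "\<And>c. c \<in> C \<Longrightarrow> cycle_list \<sigma> c"
    and dj: "\<And>c d. c \<in> C \<Longrightarrow> d \<in> C \<Longrightarrow> c \<noteq> d \<Longrightarrow> set c \<inter> set d = {}"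
    and un: "\<Union>(set ` C) = I" and out: "\<And>x. x \<notin> I \<Longrightarrow> \<sigma> x = x"
    using P by (auto simp: cycle_partition_def)
  have disj: "set cs \<inter> set c = {}" if "c \<in> C" for c using un cs(2) that by auto
  have 1: "cycle_list (cycle_of_list cs \<circ> \<sigma>) c" if c: "c \<in> C" for c
  proof -
    have "map (cycle_of_list cs) (rotate1 c) = rotate1 c"
      using disj[OF c] by (intro map_idI id_outside_supp) auto
    then show ?thesis using cl[OF c] unfolding cycle_list_def map_map[symmetric] by simp
  qed
  have 2: "cycle_list (cycle_of_list cs \<circ> \<sigma>) cs" if "cs \<noteq> []"
  proof -
    have "map \<sigma> cs = cs" using cs(2) by (intro map_idI out) auto
    then show ?thesis using that cs(1) unfolding cycle_list_def map_map[symmetric] by (simp add: cycle_of_list_map)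
  qed
  have 3: "\<Union>(set ` (C \<union> ({cs} - {[]}))) = set cs \<union> I" using un by auto
  have 4: "(cycle_of_list cs \<circ> \<sigma>) x = x" if "x \<notin> set cs \<union> I" for x
    using that out[of x] by (simp add: id_outside_supp)
  have 5: "set c \<inter> set d = {}" if "c \<in> C \<union> ({cs} - {[]})" "d \<in> C \<union> ({cs} - {[]})" "c \<noteq> d" for c d
    using that dj[of c d] disj[of c] disj[of d] by auto
  show ?thesis unfolding cycle_partition_def using fin 1 2 3 4 5 by auto
qed

lemma cycle_partition_id: "cycle_partition {} id {}"
  by (simp add: cycle_partition_def)

lemma cycle_partition_exists:
  assumes "\<sigma> permutes S" "finite S"
  shows "\<exists>C. cycle_partition S \<sigma> C"
  using cycle_decomposition[OF assms]
proof (induction rule: cycle_decomp.induct)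
  case empty
  then show ?case using cycle_partition_id by blast
next
  case (comp I p cs)
  then show ?case using cycle_partition_compose by blast
qed

lemma cycle_partition_permutes_state:
  assumes "cycle_partition {1..n} \<sigma> C"
  shows "cycle_state n n \<sigma> {} C"
  using assms unfolding cycle_state_def by (auto simp: cycle_partition_def)

lemma multiplicity_of_bound:
  assumes "cycle_partition {1..n} \<sigma> C"
  shows "multiplicity_of n \<sigma> \<le> matching_sum (cycle_type C)"
    and "separated C \<Longrightarrow> multiplicity_of n \<sigma> = matching_sum (cycle_type C)"
proof -
  have "multiplicity_of n \<sigma> = prefix_count n n \<sigma>" by (simp add: multiplicity_of_def prefix_count_def)
  then show "multiplicity_of n \<sigma> \<le> matching_sum (cycle_type C)"
    "separated C \<Longrightarrow> multiplicity_of n \<sigma> = matching_sum (cycle_type C)"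
    using prefix_count_bound[OF order_refl cycle_partition_permutes_state[OF assms]] by (simp_all add: rooted_weight_def)
qed

lemma sum_cycle_type:
  assumes "cycle_partition {1..n} \<sigma> C"
  shows "\<Sum>\<^sub># (cycle_type C) = n" "x \<in># cycle_type C \<Longrightarrow> x > 0" "size (cycle_type C) = card C"
proof -
  have fin: "finite C" and cl: "\<And>c. c \<in> C \<Longrightarrow> distinct c \<and> c \<noteq> []"
    and dj: "\<And>c d. c \<in> C \<Longrightarrow> d \<in> C \<Longrightarrow> c \<noteq> d \<Longrightarrow> set c \<inter> set d = {}"
    and un: "\<Union>(set ` C) = {1..n}"
    using assms by (auto simp: cycle_partition_def cycle_list_def)
  have "n = card (\<Union>(set ` C))" unfolding un by simp
  also have "\<dots> = (\<Sum>c\<in>C. card (set c))" using fin dj by (intro card_UN_disjoint) auto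
  also have "\<dots> = (\<Sum>c\<in>C. length c)" using cl by (intro sum.cong) (auto simp: distinct_card)
  finally show "\<Sum>\<^sub># (cycle_type C) = n" by (simp add: cycle_type_def sum_unfold_sum_mset)
  show "x \<in># cycle_type C \<Longrightarrow> x > 0" using cl fin by (auto simp: cycle_type_def)
  show "size (cycle_type C) = card C" by (simp add: cycle_type_def)
qed

lemma cycle_partition_nonempty:
  fixes n :: nat
  assumes P: "cycle_partition {1..n} \<sigma> C" and "card C > 0"
  shows "n > 0"
proof -
  have "C \<noteq> {}" using assms(2) by auto
  then obtain c where c: "c \<in> C" by blast
  then have "hd c \<in> set c" using P by (simp add: cycle_partition_def cycle_list_def)
  then have "hd c \<in> \<Union>(set ` C)" using c by blast
  also have "\<Union>(set ` C) = {1..n}" using P by (simp add: cycle_partition_def)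
  finally show ?thesis by auto
qed

lemma multiplicity_of_le_peak:
  assumes "cycle_partition {1..n} \<sigma> C"
  shows "multiplicity_of n \<sigma> \<le> peak_bound n"
    and "multiplicity_of n \<sigma> = peak_bound n \<Longrightarrow> matching_sum (cycle_type C) = peak_bound n"
proof -
  have "matching_sum (cycle_type C) \<le> peak_bound n"
    using matching_sum_le_peak(1)[of "cycle_type C"] sum_cycle_type[OF assms] by simp
  then show "multiplicity_of n \<sigma> \<le> peak_bound n"
     "multiplicity_of n \<sigma> = peak_bound n \<Longrightarrow> matching_sum (cycle_type C) = peak_bound n"
    using multiplicity_of_bound(1)[OF assms] by linarith+
qed

lemma decreasing_eq_rev_upt:
  assumes "decreasing w" "set w = {1..n}"
  shows "w = rev [1..<n + 1]"
proof -
  have "sorted_wrt (<) (rev w)" using assms(1) by (simp add: sorted_wrt_rev)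
  then have "rev w = [1..<n + 1]"
    using assms(2) by (intro sorted_distinct_set_unique) (auto simp: strict_sorted_iff atLeastLessThanSuc_atLeastAtMost simp del: upt_Suc)
  then show ?thesis by (metis rev_rev_ident)
qed

lemma rev_upt_split: "m \<le> n \<Longrightarrow> rev [1..<n + 1] = rev [m + 1..<n + 1] @ rev [1..<m + 1]"
  using upt_add_eq_append[of 1 "m + 1" "n - m"] by (simp only: rev_append[symmetric]) simp

lemma decreasing_rev_upt: "decreasing (rev [i..<j])"
  by (simp add: sorted_wrt_rev del: upt_Suc)

text \<open>
  The cycle lengths are \<open>n - m\<close> and \<open>m\<close>. For \<open>m = 0\<close> this is cycle left.
\<close>
definition two_cycles_left :: "nat \<Rightarrow> nat \<Rightarrow> nat \<Rightarrow> nat" where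
  "two_cycles_left n m = cycle_of_list (rev [m + 1..<n + 1]) \<circ> cycle_of_list (rev [1..<m + 1])"

lemma two_cycles_left_partition:
  assumes "m \<le> n"
  shows "cycle_partition {1..n} (two_cycles_left n m) ({rev [1..<m + 1]} - {[]} \<union> ({rev [m + 1..<n + 1]} - {[]}))"
proof -
  have "cycle_partition (set (rev [1..<m + 1]) \<union> {}) (cycle_of_list (rev [1..<m + 1]) \<circ> id) ({} \<union> ({rev [1..<m + 1]} - {[]}))"
    by (intro cycle_partition_compose cycle_partition_id) (auto simp del: upt_Suc)
  then have P: "cycle_partition {1..m} (cycle_of_list (rev [1..<m + 1])) ({rev [1..<m + 1]} - {[]})"
    by (simp add: atLeastLessThanSuc_atLeastAtMost del: upt_Suc)
  have "cycle_partition (set (rev [m + 1..<n + 1]) \<union> {1..m}) (two_cycles_left n m)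
     ({rev [1..<m + 1]} - {[]} \<union> ({rev [m + 1..<n + 1]} - {[]}))"
    unfolding two_cycles_left_def by (intro cycle_partition_compose P) (auto simp del: upt_Suc)
  moreover have "set (rev [m + 1..<n + 1]) \<union> {1..m} = {1..n}" using assms by (auto simp del: upt_Suc)
  ultimately show ?thesis by simp
qed

lemma two_cycles_left_separated: "separated ({rev [1..<m + 1]} - {[]} \<union> ({rev [m + 1..<n + 1]} - {[]}))"
proof -
  have "apart (rev [1..<m + 1]) (rev [m + 1..<n + 1])" by (auto simp: apart_def simp del: upt_Suc)
  then show ?thesis using apart_sym decreasing_rev_upt by (auto simp: separated_def simp del: upt_Suc)
qed

lemma two_cycles_left_permutes:
  assumes "m \<le> n"
  shows "two_cycles_left n m permutes {1..n}"
proof -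
  have *: "cycle_of_list (rev [i..<j]) permutes {1..n}" if "1 \<le> i" "j \<le> n + 1" for i j
    using cycle_permutes[of "rev [i..<j]"] by (rule permutes_subset) (use that in auto)
  then show ?thesis unfolding two_cycles_left_def by (intro permutes_compose *) (use assms in auto)
qed

lemma multiplicity_two_cycles_left:
  assumes "m \<le> n"
  shows "multiplicity_of n (two_cycles_left n m) = two_cycle_bound (n - m) m"
proof -
  have eq: "multiplicity_of n (two_cycles_left n m) = matching_sum (cycle_type ({rev [1..<m + 1]} - {[]} \<union> ({rev [m + 1..<n + 1]} - {[]})))"
    by (rule multiplicity_of_bound(2)[OF two_cycles_left_partition[OF assms] two_cycles_left_separated])
  have ne: "rev [1..<m + 1] = [] \<longleftrightarrow> m = 0" "rev [m + 1..<n + 1] = [] \<longleftrightarrow> m = n" using assms by auto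
  have len: "length (rev [1..<m + 1]) = m" "length (rev [m + 1..<n + 1]) = n - m" by auto
  have bound0: "two_cycle_bound k 0 = catalan k" for k
    unfolding two_cycle_bound_commute[of k] by (simp add: two_cycle_bound_def)
  consider "m = 0" "n = 0" | "m = 0" "n > 0" | "m = n" "n > 0" | "0 < m" "m < n" using assms by linarith
  then show ?thesis
  proof cases
    case 1
    then show ?thesis unfolding eq by (simp add: cycle_type_def bound0)
  next
    case 2
    then show ?thesis unfolding eq using ne len by (simp add: cycle_type_def bound0 matching_sum_single del: upt_Suc)
  next
    case 3
    then show ?thesis unfolding eq using ne len
      by (simp add: cycle_type_def two_cycle_bound_def matching_sum_single del: upt_Suc)
  next
    case 4
    have "hd (rev [1..<m + 1]) = m" "hd (rev [m + 1..<n + 1]) = n" using 4 by (auto simp: hd_rev)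
    then have "rev [1..<m + 1] \<noteq> rev [m + 1..<n + 1]" using 4 by auto
    then show ?thesis unfolding eq using ne len 4
      by (simp add: cycle_type_def matching_sum_pair two_cycle_bound_commute[of m] del: upt_Suc)
  qed
qed

lemma cycle_left_eq: "cycle_left n = two_cycles_left n 0"
  by (simp add: cycle_left_def two_cycles_left_def del: upt_Suc)

lemma double_cycle_lefts_eq: "double_cycle_lefts n = {two_cycles_left n (n div 2), two_cycles_left n ((n + 1) div 2)}"
  unfolding double_cycle_lefts_def two_cycles_left_def by blast

text \<open>The cycles of the identity are decreasing and separated.\<close>
lemma multiplicity_of_id: "multiplicity_of n id = involution_count n"
proof -
  let ?C = "(\<lambda>x. [x]) ` {1..n}"
  have "cycle_partition {1..n} id ?C" by (auto simp: cycle_partition_def cycle_list_def)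
  moreover have "separated ?C" by (auto simp: separated_def apart_def)
  moreover have "cycle_type ?C = replicate_mset n 1"
  proof -
    have "mset_set ?C = image_mset (\<lambda>x. [x]) (mset_set {1..n})" by (rule image_mset_mset_set[symmetric]) (auto intro: inj_onI)
    then show ?thesis by (simp add: cycle_type_def image_mset.compositionality comp_def image_mset_const_eq)
  qed
  ultimately show ?thesis using multiplicity_of_bound(2) matching_sum_ones by metis
qed

lemma cycle_partition_ones:
  assumes P: "cycle_partition {1..n} \<sigma> C" and ones: "cycle_type C = replicate_mset k 1"
  shows "\<sigma> = id"
proof
  fix x
  show "\<sigma> x = id x"
  proof (cases "x \<in> {1..n}")
    case True
    moreover have "\<Union>(set ` C) = {1..n}" using P by (simp add: cycle_partition_def)
    ultimately obtain c where c: "c \<in> C" "x \<in> set c" by blast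
    have "length c \<in># cycle_type C" using c P by (simp add: cycle_type_def cycle_partition_def)
    then have "length c = 1" using ones by (simp split: if_splits)
    then have "c = [x]" using c(2) by (cases c) auto
    then show ?thesis using P c(1) by (auto simp: cycle_partition_def cycle_list_def)
  next
    case False
    then show ?thesis using P by (simp add: cycle_partition_def)
  qed
qed

text \<open>
  In the equality cases it is enough to look at the last factor, which belongs to the largest
  element.
\<close>
lemma cycle_containing_top:
  assumes P: "cycle_partition {1..Suc k} \<sigma> C"
  obtains c b where "c \<in> C" "cycle_list \<sigma> (Suc k # b)" "set (Suc k # b) = set c" "length c = Suc (length b)"
    "multiplicity_of (Suc k) \<sigma> \<le>
      top_step_sum b (C - {c})"
proof -
  have st: "cycle_state (Suc k) (Suc k) \<sigma> {} C" by (rule cycle_partition_permutes_state[OF P])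
  obtain c where c: "c \<in> C" "Suc k \<in> set c" using cycle_state_obtain[OF st, of "Suc k"] by auto
  obtain p q where pq: "c = p @ Suc k # q" using c(2) by (meson split_list)
  have "cycle_list \<sigma> (Suc k # q @ p)"
    using cycle_list_rotate_append[of \<sigma> p "Suc k # q"] P c(1) pq by (simp add: cycle_partition_def)
  moreover have all: "\<forall>\<sigma> R C. cycle_state (Suc k) k \<sigma> R C \<longrightarrow>
      count_bound (Suc k) k \<sigma> R C"
    by (intro allI impI prefix_count_bound) simp_all
  have "multiplicity_of (Suc k) \<sigma> \<le>
      (\<Sum>i\<le>length (q @ p). rooted_count (take i (q @ p)) * matching_sum (add_mset (length (q @ p) - i) (cycle_type (C - {c}))))
       + (\<Sum>e\<in>C - {c}. merge_count (q @ p) e * matching_sum (cycle_type (C - {c} - {e})))"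
    using free_step_le(1)[OF all st c(1) pq refl]
    by (simp add: rooted_weight_def multiplicity_of_def prefix_count_def)
  ultimately show ?thesis using that[OF c(1), of "q @ p"] pq by auto
qed

text \<open>
  Equality forces the term in which the last factor is trivial to be \<open>catalan (length b)\<close>.
\<close>
lemma single_cycle_extremal:
  assumes P: "cycle_partition {1..n} \<sigma> C" and C: "card C = 1"
    and eq: "multiplicity_of n \<sigma> = matching_sum (cycle_type C)"
  shows "\<sigma> = cycle_left n"
proof -
  obtain k where n: "n = Suc k" using cycle_partition_nonempty[OF P] C by (cases n) auto
  obtain c b where cb: "c \<in> C" "cycle_list \<sigma> (Suc k # b)" "set (Suc k # b) = set c" "length c = Suc (length b)"
    "multiplicity_of (Suc k) \<sigma> \<le>
      top_step_sum b (C - {c})"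
    using cycle_containing_top[OF P[unfolded n]] .
  have Cc: "C = {c}" using C cb(1) by (metis card_1_singletonE singletonD)
  have setb: "set (Suc k # b) = {1..n}" using P cb(3) Cc by (simp add: cycle_partition_def)
  have distb: "distinct (Suc k # b)" using cb(2) by (simp add: cycle_list_def)
  have small: "x < Suc k" if "x \<in> set b" for x
    using setb distb that n by (metis atLeastAtMost_iff distinct.simps(2) le_neq_implies_less list.set_intros(2))
  have "catalan (Suc (length b)) \<le> (\<Sum>i\<le>length b. rooted_count (take i b) * catalan (length b - i))"
    using cb(5) eq cb(4) unfolding Cc n by (simp add: cycle_type_def matching_sum_single)
  also have "\<dots> = split_sum (\<lambda>u v. rooted_count u * catalan (length v)) b"
    by (simp add: split_sum_def)
  finally have le: "catalan (Suc (length b)) \<le> split_sum (\<lambda>u v. rooted_count u * catalan (length v)) b" .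
  have "rooted_count b = catalan (length b)"
  proof (rule ccontr)
    assume "rooted_count b \<noteq> catalan (length b)"
    then have lt: "rooted_count b < catalan (length b)"
      using rooted_count_le_catalan(1)[of b] distb by simp
    have "split_sum (\<lambda>u v. rooted_count u * catalan (length v)) b < split_sum (\<lambda>u v. catalan (length u) * catalan (length v)) b"
    proof (rule split_sum_strict_mono[of _ _ _ b "[]"])
      show "rooted_count u * catalan (length v) \<le> catalan (length u) * catalan (length v)" if "u @ v = b" for u v
        using rooted_count_le_catalan(1)[of u] distb that[symmetric] by (intro mult_right_mono) auto
    qed (use lt in simp_all)
    also have "\<dots> = catalan (Suc (length b))"
      unfolding split_sum_length[of "\<lambda>i j. catalan i * catalan j"] by (simp add: catalan.simps(2))
    finally show False using le by simp
  qed
  then have "decreasing b" using rooted_count_le_catalan(2)[of b] distb by simp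
  then have "decreasing (Suc k # b)" using small by auto
  then have b: "Suc k # b = rev [1..<n + 1]" by (rule decreasing_eq_rev_upt[OF _ setb])
  show ?thesis
  proof
    fix x
    show "\<sigma> x = cycle_left n x"
    proof (cases "x \<in> {1..n}")
      case True
      then show ?thesis
        unfolding setb[symmetric] cycle_left_def b[symmetric] by (rule cycle_list_eq_cycle_of_list[OF cb(2)])
    next
      case False
      then have "\<sigma> x = x" using P by (simp add: cycle_partition_def)
      moreover have "cycle_left n x = x" unfolding cycle_left_def by (rule id_outside_supp) (use False in auto)
      ultimately show ?thesis by simp
    qed
  qed
qed

text \<open>
  Equality forces \<open>merge_count\<close> to reach its maximum, so that the largest element together
  with \<open>b\<close> and a rotation of \<open>d\<close> decreases all the way from \<open>n\<close> to 1.
\<close>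
lemma two_cycles_extremal:
  assumes P: "cycle_partition {1..n} \<sigma> C" and C: "card C = 2"
    and eq: "multiplicity_of n \<sigma> = matching_sum (cycle_type C)"
  shows "\<exists>m. 0 < m \<and> m < n \<and> \<sigma> = two_cycles_left n m \<and> cycle_type C = {#n - m, m#}"
proof -
  obtain k where n: "n = Suc k" using cycle_partition_nonempty[OF P] C by (cases n) auto
  obtain c b where cb: "c \<in> C" "cycle_list \<sigma> (Suc k # b)" "set (Suc k # b) = set c" "length c = Suc (length b)"
    "multiplicity_of (Suc k) \<sigma> \<le>
      top_step_sum b (C - {c})"
    using cycle_containing_top[OF P[unfolded n]] .
  have "card (C - {c}) = 1" using C cb(1) by simp
  then obtain d where d: "C - {c} = {d}" by (rule card_1_singletonE)
  have Cc: "C = {c, d}" "c \<noteq> d" using d cb(1) by auto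
  have dl: "cycle_list \<sigma> d" "set c \<inter> set d = {}" "set c \<union> set d = {1..n}"
    using P Cc by (auto simp: cycle_partition_def)
  have dist: "distinct (Suc k # b)" "distinct d" "d \<noteq> []" using cb(2) dl(1) by (simp_all add: cycle_list_def)
  have distbd: "distinct (b @ d)" using dist dl(2) cb(3) by auto
  have small: "x < Suc k" if "x \<in> set b \<union> set d" for x
  proof -
    have "x \<in> {1..n}" "x \<noteq> Suc k" using that dl(2,3) cb(3) dist(1) by auto
    then show ?thesis using n by simp
  qed
  let ?S = "\<lambda>g. \<Sum>i\<le>length b. g i * matching_sum (add_mset (length b - i) {#length d#})"
  have "matching_sum (cycle_type C) = ?S catalan + merge_bound (length d) (length b)"
    using matching_sum_cycle_type[of "{d}" "length b"] Cc cb(4) by (simp add: cycle_type_def)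
  moreover have "matching_sum (cycle_type C) \<le> ?S (\<lambda>i. rooted_count (take i b)) + merge_count b d"
    using cb(5) eq unfolding d n by (simp add: cycle_type_def)
  moreover have "?S (\<lambda>i. rooted_count (take i b)) \<le> ?S catalan"
  proof (intro sum_mono mult_right_mono)
    fix i assume "i \<in> {..length b}"
    then show "rooted_count (take i b) \<le> catalan i"
      using rooted_count_le_catalan(1)[of "take i b"] dist(1) by simp
  qed simp
  moreover note merge_count_le(1)[OF distbd dist(3)]
  ultimately have "merge_count b d = merge_bound (length d) (length b)" by linarith
  then obtain i where i: "decreasing (b @ rotate i d)" using merge_count_le(2)[OF distbd dist(3)] by blast
  define e where "e = rotate i d"
  have "decreasing ((Suc k # b) @ e)" using i small by (auto simp: e_def)
  then have "(Suc k # b) @ e = rev [1..<n + 1]"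
    by (rule decreasing_eq_rev_upt) (use dl(3) cb(3) e_def in auto)
  define m where "m = length d"
  have m: "length e = m" "0 < m" using dist(3) by (simp_all add: e_def m_def)
  have len: "length c + m = n" using \<open>(Suc k # b) @ e = rev [1..<n + 1]\<close> m(1) cb(4)
    by (metis add_diff_cancel_right' length_Cons length_append length_rev length_upt)
  then have mn: "m < n" using cb(4) by simp
  have "(Suc k # b) @ e = rev [m + 1..<n + 1] @ rev [1..<m + 1]"
    using \<open>(Suc k # b) @ e = rev [1..<n + 1]\<close> rev_upt_split[of m n] mn by simp
  moreover have "length e = length (rev [1..<m + 1])" using m(1) by simp
  ultimately have be: "Suc k # b = rev [m + 1..<n + 1]" "e = rev [1..<m + 1]"
    using append_eq_append_conv by blast+
  have el: "cycle_list \<sigma> e" unfolding e_def by (rule cycle_list_rotate[OF dl(1)])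
  have "\<sigma> = two_cycles_left n m"
  proof
    fix x
    have bd: "set (rev [m + 1..<n + 1]) = set c" "set (rev [1..<m + 1]) = set d"
      using be cb(3) e_def by (metis, metis set_rotate)
    consider "x \<in> set c" | "x \<in> set d" | "x \<notin> {1..n}" unfolding dl(3)[symmetric] by blast
    then show "\<sigma> x = two_cycles_left n m x"
    proof cases
      case 1
      then have fx: "cycle_of_list (rev [1..<m + 1]) x = x" using dl(2) bd by (intro id_outside_supp) auto
      have sx: "\<sigma> x = cycle_of_list (rev [m + 1..<n + 1]) x"
        unfolding be(1)[symmetric] using 1 cb(3) by (intro cycle_list_eq_cycle_of_list[OF cb(2)]) simp
      show ?thesis unfolding two_cycles_left_def comp_def fx sx ..
    next
      case 2
      have sx: "\<sigma> x = cycle_of_list (rev [1..<m + 1]) x"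
        unfolding be(2)[symmetric] using 2 by (intro cycle_list_eq_cycle_of_list[OF el]) (simp add: e_def)
      have "\<sigma> x \<in> set (map \<sigma> d)" using 2 by simp
      also have "map \<sigma> d = rotate1 d" using dl(1) by (simp add: cycle_list_def)
      finally have "\<sigma> x \<notin> set c" using dl(2) by auto
      then have "cycle_of_list (rev [m + 1..<n + 1]) (\<sigma> x) = \<sigma> x" using bd by (intro id_outside_supp) auto
      then show ?thesis unfolding two_cycles_left_def comp_def sx[symmetric] by (simp only:)
    next
      case 3
      then have "\<sigma> x = x" using P by (simp add: cycle_partition_def)
      moreover have "two_cycles_left n m x = x"
        using two_cycles_left_permutes[of m n] mn 3 by (simp add: permutes_def)
      ultimately show ?thesis by simp
    qed
  qed
  moreover have "cycle_type C = {#n - m, m#}" using Cc len m_def by (simp add: cycle_type_def)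
  ultimately show ?thesis using m(2) mn by blast
qed

lemma positive_parts_all_one:
  assumes "\<And>x. x \<in># M \<Longrightarrow> x > 0" "\<Sum>\<^sub># M \<le> size M"
  shows "M = replicate_mset (size M) (1::nat)"
proof -
  have ge: "size N \<le> \<Sum>\<^sub># N" if "\<And>x. x \<in># N \<Longrightarrow> x > 0" for N :: "nat multiset"
    using that by (induction N) (auto simp: Suc_le_eq add_strict_increasing)
  have "x = 1" if x: "x \<in># M" for x
  proof -
    obtain N where M: "M = add_mset x N" using x by (metis insert_DiffM)
    have "size N \<le> \<Sum>\<^sub># N" by (rule ge) (use assms(1) M in auto)
    then show ?thesis using assms(1)[OF x] assms(2) by (simp add: M)
  qed
  then show ?thesis by (intro set_mset_subset_singletonD) auto
qed

lemma two_cycle_bound_peak: "n \<le> 17 \<Longrightarrow> two_cycle_bound (n - n div 2) (n div 2) = peak_bound n"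
  by (simp add: peak_bound_def balanced_bound_def two_cycle_bound_commute[of "n div 2"])

theorem theorem16:
  fixes n :: nat
  assumes "n \<ge> 1"
  shows "{\<pi>. \<pi> permutes {1..n} \<and>
              (\<forall>\<sigma>. \<sigma> permutes {1..n} \<longrightarrow> multiplicity_of n \<sigma> \<le> multiplicity_of n \<pi>)} =
         (if n = 1 then {id}
          else if n = 2 then {cycle_left n, id}
          else if n = 3 then {cycle_left n} \<union> double_cycle_lefts n
          else if n \<le> 17 then double_cycle_lefts n
          else {id})"
proof -
  let ?M = "multiplicity_of n"
  define X where "X = {\<pi>. \<pi> permutes {1..n} \<and> ?M \<pi> = peak_bound n}"
  have upper: "?M \<sigma> \<le> peak_bound n" if \<sigma>: "\<sigma> permutes {1..n}" for \<sigma>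
    using cycle_partition_exists[OF \<sigma>] multiplicity_of_le_peak(1) by auto
  have id: "id permutes {1..n}" "?M id = involution_count n"
    by (simp_all add: permutes_id multiplicity_of_id)
  have left: "two_cycles_left n m permutes {1..n}" "?M (two_cycles_left n m) = two_cycle_bound (n - m) m" if "m \<le> n" for m
    by (rule two_cycles_left_permutes multiplicity_two_cycles_left, rule that)+
  have halves: "double_cycle_lefts n = {two_cycles_left n (n div 2), two_cycles_left n (n - n div 2)}"
  proof -
    have "(n + 1) div 2 = n - n div 2" by linarith
    then show ?thesis by (simp add: double_cycle_lefts_eq)
  qed
  have double: "double_cycle_lefts n \<subseteq> X" if "n \<le> 17"
  proof -
    have "two_cycle_bound (n - (n - n div 2)) (n - n div 2) = peak_bound n"
      using two_cycle_bound_peak[OF that] two_cycle_bound_commute[of "n - n div 2"] by simp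
    then show ?thesis
      unfolding halves X_def using left[of "n div 2"] left[of "n - n div 2"] two_cycle_bound_peak[OF that] by simp
  qed
  have big: "id \<in> X" if "n \<ge> 18" using id that by (simp add: X_def peak_bound_def)
  have "\<exists>\<pi>. \<pi> \<in> X"
  proof (cases "n \<le> 17")
    case True
    then show ?thesis using double halves by blast
  next
    case False
    then show ?thesis using big by (intro exI[of _ id]) simp
  qed
  then obtain \<pi>0 where \<pi>0: "\<pi>0 permutes {1..n}" "?M \<pi>0 = peak_bound n" by (auto simp: X_def)
  have X: "{\<pi>. \<pi> permutes {1..n} \<and> (\<forall>\<sigma>. \<sigma> permutes {1..n} \<longrightarrow> ?M \<sigma> \<le> ?M \<pi>)} = X"
  proof (intro set_eqI iffI)
    fix \<pi> assume "\<pi> \<in> {\<pi>. \<pi> permutes {1..n} \<and> (\<forall>\<sigma>. \<sigma> permutes {1..n} \<longrightarrow> ?M \<sigma> \<le> ?M \<pi>)}"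
    then have p: "\<pi> permutes {1..n}" "?M \<pi>0 \<le> ?M \<pi>" using \<pi>0(1) by auto
    then show "\<pi> \<in> X" using upper[OF p(1)] \<pi>0(2) by (simp add: X_def)
  next
    fix \<pi> assume "\<pi> \<in> X"
    then show "\<pi> \<in> {\<pi>. \<pi> permutes {1..n} \<and> (\<forall>\<sigma>. \<sigma> permutes {1..n} \<longrightarrow> ?M \<sigma> \<le> ?M \<pi>)}"
      using upper by (simp add: X_def)
  qed
  have types: "\<exists>C. cycle_partition {1..n} \<pi> C \<and> ?M \<pi> = matching_sum (cycle_type C) \<and> matching_sum (cycle_type C) = peak_bound n"
    if "\<pi> \<in> X" for \<pi>
  proof -
    have p: "\<pi> permutes {1..n}" "?M \<pi> = peak_bound n" using that by (auto simp: X_def)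
    obtain C where C: "cycle_partition {1..n} \<pi> C" using cycle_partition_exists[OF p(1)] by auto
    then show ?thesis using multiplicity_of_le_peak(2)[OF C p(2)] p(2) by auto
  qed
  have few: "\<pi> \<in> {cycle_left n} \<union> {two_cycles_left n m | m. 0 < m \<and> m < n} \<or>
      (3 \<le> n \<and> matching_sum (replicate_mset n 1) = peak_bound n)" if n3: "n \<le> 3" and \<pi>: "\<pi> \<in> X" for \<pi>
  proof -
    obtain C where C: "cycle_partition {1..n} \<pi> C" "?M \<pi> = matching_sum (cycle_type C)" "matching_sum (cycle_type C) = peak_bound n"
      using types[OF \<pi>] by blast
    note sum = sum_cycle_type[OF C(1)]
    have "card C \<noteq> 0"
    proof
      assume "card C = 0"
      then have "cycle_type C = {#}" using sum(3) by simp
      then show False using sum(1) assms by simp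
    qed
    then consider "card C = 1" | "card C = 2" | "card C \<ge> 3" by linarith
    then show ?thesis
    proof cases
      case 1
      then show ?thesis using single_cycle_extremal[OF C(1) _ C(2)] by simp
    next
      case 2
      then show ?thesis using two_cycles_extremal[OF C(1) _ C(2)] by auto
    next
      case 3
      have "cycle_type C = replicate_mset (size (cycle_type C)) 1"
        by (rule positive_parts_all_one) (use sum n3 3 in auto)
      then have "cycle_type C = replicate_mset (card C) 1" unfolding sum(3) .
      moreover from this have "card C = n" using sum(1) by simp
      ultimately show ?thesis using C(3) 3 by simp
    qed
  qed
  have "n = 1 \<or> n = 2 \<or> n = 3 \<or> (4 \<le> n \<and> n \<le> 17) \<or> 18 \<le> n" using assms by linarith
  then have "X = (if n = 1 then {id}
          else if n = 2 then {cycle_left n, id}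
          else if n = 3 then {cycle_left n} \<union> double_cycle_lefts n
          else if n \<le> 17 then double_cycle_lefts n
          else {id})"
  proof (elim disjE)
    assume n: "n = 1"
    have "X \<subseteq> {id}" using n by (auto simp: X_def permutes_sing)
    then show ?thesis using \<pi>0 n by (auto simp: X_def)
  next
    assume n: "n = 2"
    have one: "two_cycles_left n 1 = id"
      by (simp add: two_cycles_left_def n upt_rec)
    have "X \<subseteq> {cycle_left n, id}"
    proof
      fix \<pi> assume "\<pi> \<in> X"
      then have "\<pi> \<in> {cycle_left n} \<union> {two_cycles_left n m | m. 0 < m \<and> m < n}" using few n by simp
      moreover have "m = 1" if "0 < m" "m < n" for m using that n by simp
      ultimately show "\<pi> \<in> {cycle_left n, id}" using one by auto
    qed
    moreover have "cycle_left n \<in> X" "id \<in> X"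
      using left[of 0] left[of 1] id n
      by (simp_all add: X_def cycle_left_eq peak_bound_values two_cycle_bound_def catalan_values involution_count_values pair_bound_commute[of 2 0])
    ultimately show ?thesis using n by auto
  next
    assume n: "n = 3"
    have halves3: "double_cycle_lefts n = {two_cycles_left n 1, two_cycles_left n 2}" using halves n by simp
    have "X \<subseteq> {cycle_left n} \<union> double_cycle_lefts n"
    proof
      fix \<pi> assume "\<pi> \<in> X"
      moreover have "matching_sum (replicate_mset n 1) \<noteq> peak_bound n"
        unfolding matching_sum_ones by (simp add: n involution_count_values peak_bound_values)
      ultimately have "\<pi> \<in> {cycle_left n} \<union> {two_cycles_left n m | m. 0 < m \<and> m < n}" using few n by blast
      moreover have "m = 1 \<or> m = 2" if "0 < m" "m < n" for m using that n by linarith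
      ultimately show "\<pi> \<in> {cycle_left n} \<union> double_cycle_lefts n" unfolding halves3 by blast
    qed
    moreover have "cycle_left n \<in> X"
      using left[of 0] n
      by (simp add: X_def cycle_left_eq peak_bound_values two_cycle_bound_def catalan_values pair_bound_commute[of 3 0])
    ultimately show ?thesis using n double by auto
  next
    assume n: "4 \<le> n \<and> n \<le> 17"
    have "X \<subseteq> double_cycle_lefts n"
    proof
      fix \<pi> assume "\<pi> \<in> X"
      then obtain C where C: "cycle_partition {1..n} \<pi> C" "?M \<pi> = matching_sum (cycle_type C)" "matching_sum (cycle_type C) = peak_bound n"
        using types by blast
      have type: "cycle_type C = {#n div 2, n - n div 2#}"
        using matching_sum_le_peak(2)[of "cycle_type C"] sum_cycle_type[OF C(1)] C(3) n by simp
      then have "card C = 2" using sum_cycle_type(3)[OF C(1)] by simp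
      then obtain m where m: "\<pi> = two_cycles_left n m" "cycle_type C = {#n - m, m#}"
        using two_cycles_extremal[OF C(1) _ C(2)] by blast
      have "m \<in># {#n div 2, n - n div 2#}" using m(2) type by (metis union_single_eq_member add_mset_commute)
      then show "\<pi> \<in> double_cycle_lefts n" unfolding halves m(1) by auto
    qed
    then show ?thesis using n double by auto
  next
    assume n: "18 \<le> n"
    have "X \<subseteq> {id}"
    proof
      fix \<pi> assume "\<pi> \<in> X"
      then obtain C where C: "cycle_partition {1..n} \<pi> C" "matching_sum (cycle_type C) = peak_bound n"
        using types by blast
      have "cycle_type C = replicate_mset n 1"
        using matching_sum_le_peak(2)[of "cycle_type C"] sum_cycle_type[OF C(1)] C(2) n by simp
      then show "\<pi> \<in> {id}" using cycle_partition_ones[OF C(1)] by simp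
    qed
    then show ?thesis using n big by auto
  qed
  then show ?thesis unfolding X .
qed

end
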